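(* Let $B^d \subset \mathbb{R}^d$ be the unit ball centered at the origin, and let $K \subset \mathbb{R}^d$ be a convex body. (1) If $K$ is contained in the ball of radius $\sqrt{\frac3{d+2}}$ concentric with $B^d$, then there is a unique projective transformation $\phi$, up to post-composition with orthogonal transformations, that fixes $B^d$ (that is, $\phi(B^d)=B^d$) and such that the centroid of $\phi(K)$ is the center of $B^d$. (2) If $K$ is contained in the ball of radius $\sqrt{\frac2{d+1}}$ concentric with $B^d$, then there is a unique Santaló point of the pair $(B^d, K)$.
   Context: A convex body is a compact convex set with non-empty interior; the centroid of $K$ is $\frac{1}{\operatorname{vol}(K)} \int_K x\, dx$. $\mathbb{R}^d$ is identified with the affine chart $\{x_0\ne 0\}$ of $\mathbb{R}\mathrm{P}^d$, and projective transformations are those of $\mathbb{R}\mathrm{P}^d$. For a convex body $L$, the polar dual with respect to $y$ is $L^\circ_y = \{x \in \mathbb{R}^d \mid \langle x-y, z-y \rangle \ge -1 \ \forall z \in L\}$. A point $y\in \operatorname{int} L_1 \cap \operatorname{int} L_2$ is a Santaló point of a pair $(L_1, L_2)$ of convex bodies if $(L_1)^\circ_y$ and $(L_2)^\circ_y$ have the same centroid.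
   Formalization: For d = 1, where both radii equal 1, K is additionally assumed to lie in the open unit ball (-1,1); if K touches ±1 both claims fail, e.g. for K = B^1 = [-1,1]. Nothing is added for d ≥ 2. *)

theory Defs
  imports "HOL-Analysis.Analysis"
begin

definition convex_body :: "'a::euclidean_space set \<Rightarrow> bool" where
  "convex_body K \<longleftrightarrow> compact K \<and> convex K \<and> interior K \<noteq> {}"

definition centroid :: "'a::euclidean_space set \<Rightarrow> 'a" where
  "centroid K = (1 / measure lebesgue K) *\<^sub>R integral K (\<lambda>x. x)"

definition polar_dual :: "'a::euclidean_space set \<Rightarrow> 'a \<Rightarrow> 'a set" where
  "polar_dual L y = {x. \<forall>z\<in>L. (x - y) \<bullet> (z - y) \<ge> -1}"

definition santalo_point :: "'a::euclidean_space set \<Rightarrow> 'a set \<Rightarrow> 'a \<Rightarrow> bool" where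
  "santalo_point L1 L2 y \<longleftrightarrow>
     y \<in> interior L1 \<inter> interior L2 \<and>
     centroid (polar_dual L1 y) = centroid (polar_dual L2 y)"

text \<open>The points of \<open>\<real>P\<^sup>d\<close> are the lines through the origin of \<open>\<real> \<times> \<real>\<^sup>d\<close>;
  the first factor carries the homogeneous coordinate \<open>x\<^sub>0\<close>.\<close>

typedef (overloaded) 'a proj_space =
  "{span {v} | v :: real \<times> 'a::euclidean_space. v \<noteq> 0}"
proof -
  have "(1, 0) \<noteq> (0 :: real \<times> 'a)"
    by (simp add: zero_prod_def)
  then show ?thesis
    by blast
qed

text \<open>The inverse of the affine chart \<open>x\<^sub>0 \<noteq> 0\<close>, identifying \<open>\<real>\<^sup>d\<close> with a subset of \<open>\<real>P\<^sup>d\<close>.\<close>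

definition affine_point :: "'a::euclidean_space \<Rightarrow> 'a proj_space" where
  "affine_point x = Abs_proj_space (span {(1, x)})"

text \<open>Only meaningful for injective linear \<open>A\<close>, which map lines to lines.\<close>

definition proj_map ::
  "(real \<times> 'a \<Rightarrow> real \<times> 'a) \<Rightarrow> 'a::euclidean_space proj_space \<Rightarrow> 'a proj_space" where
  "proj_map A p = Abs_proj_space (A ` Rep_proj_space p)"

definition projective_transformation ::
  "('a::euclidean_space proj_space \<Rightarrow> 'a proj_space) \<Rightarrow> bool" where
  "projective_transformation \<phi> \<longleftrightarrow> (\<exists>A. linear A \<and> bij A \<and> \<phi> = proj_map A)"

text \<open>The extension of a linear automorphism \<open>Q\<close> of \<open>\<real>\<^sup>d\<close> to \<open>\<real>P\<^sup>d\<close>.\<close>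

definition proj_extension ::
  "('a \<Rightarrow> 'a) \<Rightarrow> 'a::euclidean_space proj_space \<Rightarrow> 'a proj_space" where
  "proj_extension Q = proj_map (map_prod id Q)"

text \<open>The last conjunct reads \<open>\<phi>(K)\<close> in the affine chart. This loses no point of \<open>\<phi>(K)\<close>
  when \<open>K \<subseteq> B\<^sup>d\<close>, since then \<open>\<phi>(K) \<subseteq> \<phi>(B\<^sup>d) = B\<^sup>d\<close>.\<close>

definition ball_fixing_centering ::
  "'a::euclidean_space set \<Rightarrow> ('a proj_space \<Rightarrow> 'a proj_space) \<Rightarrow> bool" where
  "ball_fixing_centering K \<phi> \<longleftrightarrow>
     projective_transformation \<phi> \<and>
     \<phi> ` affine_point ` cball 0 1 = affine_point ` cball 0 1 \<and>
     centroid (affine_point -` \<phi> ` affine_point ` K) = 0"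

end

theory Submission
  imports Defs
begin

text \<open>Everything is expressed through the perspective maps \<open>persp p x = x / (1 - p \<bullet> x)\<close>, which compose
additively in \<open>p\<close>. In both parts there is a family of bodies \<open>F p\<close>, for \<open>p\<close> in a convex subset
of the open unit ball, with \<open>persp (q - p) (F p) = F q\<close>, and the required points are exactly the
solutions of the critical equation
\<open>centroid (F p) = p / (1 - \<bar>p\<bar>\<^sup>2)\<close>.

For the first part, \<open>F p = persp p K\<close>. In homogeneous coordinates, the projective transformations that
fix the ball are, up to scaling, the linear maps that preserve the form \<open>t\<^sup>2 - \<bar>x\<bar>\<^sup>2\<close> and its
positive cone. Such a map \<open>A\<close> is determined, up to a rotation applied afterwards, by the point \<open>p\<close> of the
ball that it sends to the center, and in the affine chart it is \<open>persp p\<close> followed by an affine map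
that takes \<open>p / (1 - \<bar>p\<bar>\<^sup>2)\<close> to \<open>0\<close>. As centroids commute with affine maps, \<open>A\<close>
centers \<open>K\<close> if and only if \<open>p\<close> solves the critical equation (\<open>centering_iff\<close>).

For the second part, \<open>F y\<close> is the polar of \<open>K - y\<close>. Moving the base point of a polar is a perspective
map (\<open>persp_dual_at\<close>), and the polar of the ball is an ellipsoid with center
\<open>y / (1 - \<bar>y\<bar>\<^sup>2)\<close>, so that the critical equation says that \<open>y\<close> is a Santalo point
(\<open>santalo_point_unit_ball_iff\<close>).

The equation is critical for \<open>vol (F p)\<^sup>2 (1 - \<bar>p\<bar>\<^sup>2)\<^sup>d\<^sup>+\<^sup>1\<close> (\<open>critical_at_extremum\<close>).
This gives existence: in the first part the functional is positive on the open ball and vanishes on the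
sphere, hence has a maximum; in the second part it blows up at the boundary of \<open>K\<close>, hence has a
minimum.

For uniqueness, consider two solutions, and let \<open>v\<close> be their difference. Along the segment between
them, the component along \<open>v\<close> of the difference of the two sides of the equation is a function that
vanishes at both ends. At each of its zeros \<open>p\<close>, with \<open>s = v \<bullet> p / (1 - \<bar>p\<bar>\<^sup>2)\<close>, its
derivative is
\<open>(d + 2) Var - \<bar>v\<bar>\<^sup>2 / (1 - \<bar>p\<bar>\<^sup>2) - s\<^sup>2\<close>,
where \<open>Var\<close> is the variance of \<open>v \<bullet> z\<close> for \<open>z\<close> uniform in \<open>F p\<close>. If this has a fixed
sign at all zeros, there cannot be two of them (\<open>no_two_increasing_zeros\<close>). So it remains to bound
variances of linear functionals on convex bodies.

In the first part the derivative is negative. The body \<open>persp p K\<close> lies in an ellipsoid, hence in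
a slab \<open>\<bar>v \<bullet> z - m\<bar> \<le> h\<close> of known width, and the variance of a convex body in such a
slab is at most \<open>h\<^sup>2 / 3\<close> (\<open>variance_le_of_slab\<close>). Indeed the marginal is log-concave, and
among log-concave densities on an interval with given mean the truncated exponential has the largest
variance, which is at most the variance \<open>h\<^sup>2 / 3\<close> of the uniform density.

In the second part the derivative is positive. If the values of \<open>v \<bullet> z\<close> on a convex body fill
\<open>[\<mu> - a, \<mu> + b]\<close>, where \<open>\<mu>\<close> is their mean, then the variance is at least
\<open>2 a b / ((d + 1) (d + 2))\<close>, with equality for symmetric double cones; this follows by contracting the
body towards its two extreme points (\<open>variance_lower_bound\<close>). As \<open>K\<close> lies in a ball
of radius \<open>r\<close>, both extents of its polar are large.

The radii in the theorem are those for which the two bounds just suffice. At such a radius the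
inequalities could become equalities only for \<open>p = 0\<close>, where they are strict for
another reason: when \<open>d \<ge> 2\<close>, the marginal of a body in a ball is not uniform, and a body that contains
a ball touching both supporting hyperplanes is not a double cone. In dimension one both
radii are \<open>1\<close>; there \<open>K\<close> lies in the open ball, hence by compactness in a strictly smaller ball.\<close>

section \<open>Lebesgue measure under linear and perspective maps\<close>

text \<open>Lebesgue measure on \<open>L\<close>, not normalised, as a measure on the whole space. It turns integrals over
\<open>L\<close> into Bochner integrals whose integrands need no indicator functions.\<close>

definition lborel_on :: "'a::euclidean_space set \<Rightarrow> 'a measure" where
  "lborel_on L = density lborel (indicator L)"

lemma sets_lborel_on [simp, measurable_cong]: "sets (lborel_on L) = sets borel"
  by (simp add: lborel_on_def)

lemma space_lborel_on [simp]: "space (lborel_on L) = UNIV"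
  by (simp add: lborel_on_def)

lemma nn_integral_lborel_on:
  assumes [measurable]: "f \<in> borel_measurable borel" "L \<in> sets borel"
  shows "(\<integral>\<^sup>+x. f x \<partial>lborel_on L) = (\<integral>\<^sup>+x. f x * indicator L x \<partial>lborel)"
  unfolding lborel_on_def by (subst nn_integral_density) (auto simp: mult.commute)

lemma emeasure_lborel_on:
  assumes [measurable]: "A \<in> sets borel" "L \<in> sets borel"
  shows "emeasure (lborel_on L) A = emeasure lborel (L \<inter> A)"
  unfolding lborel_on_def by (subst emeasure_density) (auto simp: indicator_inter_arith [symmetric] nn_integral_indicator)

lemma AE_lborel_on:
  assumes "L \<in> sets borel" "\<And>x. x \<in> L \<Longrightarrow> P x"
  shows "AE x in lborel_on L. P x"
proof -
  have "AE x in lborel. indicator L x > (0::ennreal) \<longrightarrow> P x"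
    using assms(2) by (intro AE_I2) (auto simp: indicator_def)
  then show ?thesis
    unfolding lborel_on_def using assms(1) by (subst AE_density) auto
qed

lemma emeasure_lborel_ball_positive:
  fixes x :: "'a::euclidean_space"
  assumes "e > 0"
  shows "0 < emeasure lborel (ball x e)"
proof -
  have "\<not> negligible (ball x e)"
    using assms by (intro open_not_negligible) auto
  then have "emeasure lebesgue (ball x e) \<noteq> 0"
    by (auto simp: negligible_iff_emeasure0)
  then show ?thesis by (simp add: zero_less_iff_neq_zero)
qed

lemma finite_measure_lborel_on:
  assumes "compact L"
  shows "finite_measure (lborel_on L)"
proof
  have "emeasure lborel L < \<infinity>"
    using assms by (intro emeasure_bounded_finite compact_imp_bounded)
  then show "emeasure (lborel_on L) (space (lborel_on L)) \<noteq> \<infinity>"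
    using assms by (simp add: emeasure_lborel_on borel_compact)
qed

lemma integrable_lborel_on:
  fixes f :: "'a::euclidean_space \<Rightarrow> 'b::{banach, second_countable_topology}"
  assumes L: "compact L" and f: "f \<in> borel_measurable borel" and c: "continuous_on L f"
  shows "integrable (lborel_on L) f"
proof -
  interpret finite_measure "lborel_on L" by (rule finite_measure_lborel_on[OF L])
  have "bounded (f ` L)"
    using L c compact_continuous_image compact_imp_bounded by blast
  then obtain B where B: "\<And>x. x \<in> L \<Longrightarrow> norm (f x) \<le> B"
    by (auto simp: bounded_iff)
  show ?thesis
    using f by (intro integrable_const_bound[where B=B] AE_lborel_on) (auto simp: B L borel_compact)
qed

lemma measure_lborel_on:
  assumes "compact L"
  shows "measure (lborel_on L) UNIV = measure lebesgue L"
  using assms by (simp add: measure_def emeasure_lborel_on borel_compact)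

lemma integral_lborel_on:
  fixes f :: "'a::euclidean_space \<Rightarrow> 'b::euclidean_space"
  assumes L: "compact L" and f: "f \<in> borel_measurable borel" and c: "continuous_on L f"
  shows "integral\<^sup>L (lborel_on L) f = integral L f"
proof -
  have [measurable]: "L \<in> sets borel"
    using L by (rule borel_compact)
  have "set_integrable lborel L f"
    unfolding set_integrable_def using L c by (rule borel_integrable_compact)
  then have "integral L f = (LINT x:L|lborel. f x)"
    by (rule set_borel_integral_eq_integral(2)[symmetric])
  also have "\<dots> = integral\<^sup>L (density lborel (\<lambda>x. ennreal (indicator L x))) f"
    unfolding set_lebesgue_integral_def using f by (subst integral_density) auto
  also have "density lborel (\<lambda>x. ennreal (indicator L x)) = lborel_on L"
    unfolding lborel_on_def by (rule density_cong) (auto simp: indicator_def)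
  finally show ?thesis by simp
qed

lemma measure_lborel_on_pos:
  assumes "compact L" "interior L \<noteq> {}"
  shows "0 < measure (lborel_on L) UNIV"
proof -
  interpret finite_measure "lborel_on L" by (rule finite_measure_lborel_on[OF assms(1)])
  obtain x e where e: "e > 0" "ball x e \<subseteq> L"
    using assms(2) mem_interior by blast
  have "0 < emeasure lborel (ball x e)"
    using e(1) by (rule emeasure_lborel_ball_positive)
  also have "\<dots> \<le> emeasure lborel L"
    using e assms by (intro emeasure_mono) (auto simp: borel_compact)
  finally have "0 < emeasure lborel L" .
  moreover have "emeasure lborel L < \<infinity>"
    using assms(1) by (intro emeasure_bounded_finite compact_imp_bounded)
  ultimately show ?thesis
    using assms by (simp add: emeasure_eq_measure[symmetric] measure_def emeasure_lborel_on borel_compact enn2real_positive_iff emeasure_bounded_finite compact_imp_bounded)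
qed

lemma nn_integral_lborel_affine:
  fixes f :: "'a::euclidean_space \<Rightarrow> ennreal"
  assumes [measurable]: "f \<in> borel_measurable borel" and c: "c \<noteq> 0"
  shows "(\<integral>\<^sup>+x. f x \<partial>lborel) = ennreal (\<bar>c\<bar> ^ DIM('a)) * (\<integral>\<^sup>+x. f (t + c *\<^sub>R x) \<partial>lborel)"
  by (subst lborel_affine[OF c, of t])
     (simp add: nn_integral_density nn_integral_distr nn_integral_cmult)

lemma linear_borel_measurable:
  fixes f :: "'a::euclidean_space \<Rightarrow> 'b::euclidean_space"
  shows "linear f \<Longrightarrow> f \<in> borel_measurable borel"
  by (intro borel_measurable_continuous_onI linear_continuous_on) (simp add: linear_linear)

text \<open>The argument for the uniqueness of Haar measure: the double integral of \<open>g x * h (x + f y)\<close> is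
evaluated in both orders, using only translation and reflection invariance. No determinant appears,
and the space is an arbitrary Euclidean space.\<close>

lemma nn_integral_linear_exchange:
  fixes f :: "'a::euclidean_space \<Rightarrow> 'a" and g h :: "'a \<Rightarrow> ennreal"
  assumes f: "linear f" "surj f"
    and g [measurable]: "g \<in> borel_measurable borel" and h [measurable]: "h \<in> borel_measurable borel"
  shows "(\<integral>\<^sup>+x. g x \<partial>lborel) * (\<integral>\<^sup>+y. h (f y) \<partial>lborel) = (\<integral>\<^sup>+x. h x \<partial>lborel) * (\<integral>\<^sup>+y. g (f y) \<partial>lborel)"
proof -
  have [measurable]: "f \<in> borel_measurable borel"
    using f(1) by (rule linear_borel_measurable)
  have "(\<integral>\<^sup>+x. g x \<partial>lborel) * (\<integral>\<^sup>+y. h (f y) \<partial>lborel) = (\<integral>\<^sup>+x. g x * (\<integral>\<^sup>+y. h (f y) \<partial>lborel) \<partial>lborel)"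
    by (simp add: nn_integral_multc)
  also have "\<dots> = (\<integral>\<^sup>+x. \<integral>\<^sup>+y. g x * h (x + f y) \<partial>lborel \<partial>lborel)"
  proof (rule nn_integral_cong)
    fix x :: 'a
    obtain t where t: "f t = x" using f(2) by (metis surjD)
    have "(\<integral>\<^sup>+y. h (f y) \<partial>lborel) = (\<integral>\<^sup>+y. h (x + f y) \<partial>lborel)"
      by (subst nn_integral_lborel_affine[where c=1 and t=t]) (simp_all add: linear_add[OF f(1)] t)
    then show "g x * (\<integral>\<^sup>+y. h (f y) \<partial>lborel) = (\<integral>\<^sup>+y. g x * h (x + f y) \<partial>lborel)"
      by (simp add: nn_integral_cmult)
  qed
  also have "\<dots> = (\<integral>\<^sup>+y. \<integral>\<^sup>+x. g x * h (x + f y) \<partial>lborel \<partial>lborel)"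
    by (rule lborel_pair.Fubini') (simp add: case_prod_unfold)
  also have "\<dots> = (\<integral>\<^sup>+y. \<integral>\<^sup>+x. g (x - f y) * h x \<partial>lborel \<partial>lborel)"
  proof (rule nn_integral_cong)
    fix y :: 'a
    show "(\<integral>\<^sup>+x. g x * h (x + f y) \<partial>lborel) = (\<integral>\<^sup>+x. g (x - f y) * h x \<partial>lborel)"
      by (subst nn_integral_lborel_affine[where c=1 and t="- f y"]) (simp_all add: algebra_simps)
  qed
  also have "\<dots> = (\<integral>\<^sup>+x. \<integral>\<^sup>+y. g (x - f y) * h x \<partial>lborel \<partial>lborel)"
    by (rule lborel_pair.Fubini') (simp add: case_prod_unfold)
  also have "\<dots> = (\<integral>\<^sup>+x. h x * (\<integral>\<^sup>+y. g (f y) \<partial>lborel) \<partial>lborel)"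
  proof (rule nn_integral_cong)
    fix x :: 'a
    obtain t where t: "f t = x" using f(2) by (metis surjD)
    have "(\<integral>\<^sup>+y. g (f y) \<partial>lborel) = (\<integral>\<^sup>+y. g (x - f y) \<partial>lborel)"
      by (subst nn_integral_lborel_affine[where c="-1" and t=t]) (simp_all add: linear_diff[OF f(1)] t)
    then show "(\<integral>\<^sup>+y. g (x - f y) * h x \<partial>lborel) = h x * (\<integral>\<^sup>+y. g (f y) \<partial>lborel)"
      by (simp add: nn_integral_cmult mult.commute[of _ "h x"])
  qed
  also have "\<dots> = (\<integral>\<^sup>+x. h x \<partial>lborel) * (\<integral>\<^sup>+y. g (f y) \<partial>lborel)"
    by (simp add: nn_integral_multc)
  finally show ?thesis .
qed

lemma emeasure_unit_ball: "0 < emeasure lborel (ball (0::'a::euclidean_space) 1)" "emeasure lborel (ball (0::'a) 1) < \<infinity>"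
   using emeasure_lborel_ball_finite[of "0::'a" 1] by (simp_all add: emeasure_lborel_ball_positive)

text \<open>Taking \<open>g\<close> to be the indicator of the unit ball in \<open>nn_integral_linear_exchange\<close> identifies the
scaling factor as a ratio of two volumes, both of which are positive and finite.\<close>

lemma lborel_linear:
  fixes f :: "'a::euclidean_space \<Rightarrow> 'a"
  assumes f: "linear f" "inj f"
  shows "\<exists>c>0. \<forall>h\<in>borel_measurable borel. (\<integral>\<^sup>+y. h (f y) \<partial>lborel) = ennreal c * (\<integral>\<^sup>+x. h x \<partial>lborel)"
proof -
  have sf: "surj f" using f linear_inj_imp_surj by blast
  have [measurable]: "f \<in> borel_measurable borel"
    using f(1) by (rule linear_borel_measurable)
  let ?b = "emeasure lborel (ball (0::'a) 1)"
  let ?c = "emeasure lborel (f -` ball (0::'a) 1)"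
  have b: "0 < ?b" "?b < \<infinity>" by (rule emeasure_unit_ball)+
  have fb: "f -` ball 0 1 \<in> sets borel"
    using measurable_sets[OF \<open>f \<in> borel_measurable borel\<close>, of "ball 0 1"] by simp
  obtain B where B: "B > 0" "\<And>x. norm (f x) \<ge> B * norm x"
    using linear_inj_bounded_below_pos[OF f] by (metis mult.commute)
  have "f -` ball 0 1 \<subseteq> ball 0 (1 / B)"
  proof
    fix x assume "x \<in> f -` ball 0 1"
    then have "B * norm x < 1" using B(2)[of x] by auto
    then show "x \<in> ball 0 (1 / B)" using B(1) by (simp add: field_simps)
  qed
  then have "?c \<le> emeasure lborel (ball (0::'a) (1 / B))"
    by (intro emeasure_mono) auto
  then have c2: "?c < \<infinity>"
    using emeasure_lborel_ball_finite[of "0::'a" "1/B"] by (auto simp: top_unique less_top)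
  obtain C where C: "C > 0" "\<And>x. norm (f x) \<le> C * norm x"
    using linear_bounded_pos[OF f(1)] by blast
  have "ball 0 (1 / C) \<subseteq> f -` ball 0 1"
  proof
    fix x :: 'a assume "x \<in> ball 0 (1 / C)"
    then have "C * norm x < 1" using C(1) by (simp add: field_simps)
    then show "x \<in> f -` ball 0 1" using C(2)[of x] by auto
  qed
  then have "emeasure lborel (ball (0::'a) (1 / C)) \<le> ?c"
    using fb by (intro emeasure_mono) auto
  moreover have "0 < emeasure lborel (ball (0::'a) (1 / C))"
    using C(1) by (intro emeasure_lborel_ball_positive) simp
  ultimately have c1: "0 < ?c" by simp
  have key: "(\<integral>\<^sup>+y. h (f y) \<partial>lborel) = ?c / ?b * (\<integral>\<^sup>+x. h x \<partial>lborel)"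
    if [measurable]: "h \<in> borel_measurable borel" for h :: "'a \<Rightarrow> ennreal"
  proof -
    have "?b * (\<integral>\<^sup>+y. h (f y) \<partial>lborel) = (\<integral>\<^sup>+x. h x \<partial>lborel) * ?c"
    proof -
      have "(\<integral>\<^sup>+y. indicator (ball 0 1) (f y) \<partial>lborel) = ?c"
      proof -
        have "indicator (ball 0 1) (f y) = (indicator (f -` ball 0 1) y :: ennreal)" for y
          by (simp add: indicator_def)
        then show ?thesis using fb by simp
      qed
      then show ?thesis
        using nn_integral_linear_exchange[OF f(1) sf, of "indicator (ball 0 1)" h]
        by (simp add: borel_measurable_indicator)
    qed
    then have "(\<integral>\<^sup>+y. h (f y) \<partial>lborel) = ((\<integral>\<^sup>+x. h x \<partial>lborel) * ?c) / ?b"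
      using b by (metis ennreal_mult_divide_eq mult.commute neq_iff infinity_ennreal_def)
    then show ?thesis by (simp add: ennreal_times_divide mult.commute divide_ennreal_def ac_simps)
  qed
  let ?r = "enn2real ?c / enn2real ?b"
  have ratio: "?c / ?b = ennreal ?r"
    using b c1 c2 by (metis divide_ennreal enn2real_nonneg enn2real_positive_iff ennreal_enn2real infinity_ennreal_def)
  have "?r > 0" using b c1 c2 by (simp add: enn2real_positive_iff)
  then show ?thesis using key unfolding ratio by (intro exI[of _ ?r] conjI ballI)
qed

text \<open>The scaling factor is \<open>1\<close> because an isometry fixes the unit ball.\<close>

lemma lborel_isometry:
  fixes f :: "'a::euclidean_space \<Rightarrow> 'a" and h :: "'a \<Rightarrow> ennreal"
  assumes f: "orthogonal_transformation f" and h: "h \<in> borel_measurable borel"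
  shows "(\<integral>\<^sup>+y. h (f y) \<partial>lborel) = (\<integral>\<^sup>+x. h x \<partial>lborel)"
proof -
  obtain c :: real where c: "c > 0" "\<forall>h\<in>borel_measurable borel. (\<integral>\<^sup>+y. h (f y) \<partial>lborel) = ennreal c * (\<integral>\<^sup>+x. h x \<partial>lborel)"
    using lborel_linear[OF orthogonal_transformation_linear[OF f] orthogonal_transformation_inj[OF f]]
    by (elim exE conjE) (rule that)
  have "(\<integral>\<^sup>+y. indicator (ball 0 1) (f y) \<partial>lborel) = ennreal c * emeasure lborel (ball (0::'a) 1)"
    using c(2)[rule_format, of "indicator (ball 0 1)"] by (simp add: borel_measurable_indicator)
  moreover have "indicator (ball 0 1) (f y) = (indicator (ball 0 1) y :: ennreal)" for y
    using f by (simp add: indicator_def orthogonal_transformation_norm)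
  ultimately have "emeasure lborel (ball (0::'a) 1) = ennreal c * emeasure lborel (ball (0::'a) 1)"
    by simp
  then have "ennreal c = 1"
    using emeasure_unit_ball[where 'a='a] by (metis ennreal_mult_divide_eq infinity_ennreal_def mult.commute mult_1 neq_iff)
  then show ?thesis using c(2)[rule_format, OF h] by simp
qed

text \<open>The projective map that fixes the origin to first order and sends the hyperplane \<open>p \<bullet> x = 1\<close> to infinity.
On homogeneous coordinates it acts as \<open>(t, x) \<mapsto> (t - p \<bullet> x, x)\<close>.\<close>

definition persp :: "'a::euclidean_space \<Rightarrow> 'a \<Rightarrow> 'a" where
  "persp p x = (1 / (1 - p \<bullet> x)) *\<^sub>R x"

lemma persp_zero [simp]: "persp 0 x = x"
  by (simp add: persp_def)

lemma persp_denominator: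
  assumes "1 - p \<bullet> x \<noteq> 0"
  shows "1 - q \<bullet> persp p x = (1 - (p + q) \<bullet> x) / (1 - p \<bullet> x)"
  using assms by (simp add: persp_def field_simps inner_add_left)

lemma persp_persp:
  assumes "1 - p \<bullet> x \<noteq> 0"
  shows "persp q (persp p x) = persp (p + q) x"
  using assms by (simp add: persp_def[of q] persp_denominator) (simp add: persp_def)

lemma persp_inverse:
  assumes "1 - p \<bullet> x \<noteq> 0"
  shows "persp (- p) (persp p x) = x"
  using persp_persp[OF assms, of "- p"] by simp

lemma borel_measurable_persp [measurable]: "persp p \<in> borel_measurable borel"
  unfolding persp_def by measurable

text \<open>The condition \<open>0 < 1 + p \<bullet> z\<close> excludes the hyperplane \<open>1 + p \<bullet> z = 0\<close>, where division by zero gives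
\<open>persp (- p) z = 0\<close>, a point that may lie in \<open>K\<close>.\<close>

lemma mem_persp_image:
  assumes K: "\<And>x. x \<in> K \<Longrightarrow> p \<bullet> x < 1"
  shows "z \<in> persp p ` K \<longleftrightarrow> 0 < 1 + p \<bullet> z \<and> persp (- p) z \<in> K"
proof
  assume "z \<in> persp p ` K"
  then obtain x where x: "x \<in> K" "z = persp p x" by blast
  have "1 - p \<bullet> x > 0" using K[OF x(1)] by simp
  then show "0 < 1 + p \<bullet> z \<and> persp (- p) z \<in> K"
    using x persp_inverse[of p x] persp_denominator[of p x "- p"] by simp
next
  assume z: "0 < 1 + p \<bullet> z \<and> persp (- p) z \<in> K"
  then have "z = persp p (persp (- p) z)"
    using persp_inverse[of "- p" z] by simp
  then show "z \<in> persp p ` K" using z by blast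
qed

lemma compact_persp_image:
  assumes "compact K" and "\<And>x. x \<in> K \<Longrightarrow> p \<bullet> x < 1"
  shows "compact (persp p ` K)"
proof (rule compact_continuous_image[OF _ assms(1)])
  show "continuous_on K (persp p)"
    unfolding persp_def using assms(2) by (intro continuous_intros) force
qed

lemma convex_persp_image:
  assumes "convex K" and K: "\<And>x. x \<in> K \<Longrightarrow> p \<bullet> x < 1"
  shows "convex (persp p ` K)"
proof (rule convexI)
  fix z w and u v :: real
  assume zw: "z \<in> persp p ` K" "w \<in> persp p ` K" and uv: "0 \<le> u" "0 \<le> v" "u + v = 1"
  note mem = mem_persp_image[OF K]
  have z: "0 < 1 + p \<bullet> z" "persp (- p) z \<in> K" using zw(1) mem by blast+
  have w: "0 < 1 + p \<bullet> w" "persp (- p) w \<in> K" using zw(2) mem by blast+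
  define s where "s = 1 + p \<bullet> (u *\<^sub>R z + v *\<^sub>R w)"
  have s: "s = u * (1 + p \<bullet> z) + v * (1 + p \<bullet> w)"
    unfolding s_def using uv(3) by (simp add: inner_add_right algebra_simps)
  have "s > 0"
  proof (cases "u = 0")
    case True
    then show ?thesis using s uv w by simp
  next
    case False
    then have "u * (1 + p \<bullet> z) > 0" "v * (1 + p \<bullet> w) \<ge> 0" using uv z w by auto
    then show ?thesis using s by linarith
  qed
  have "persp (- p) (u *\<^sub>R z + v *\<^sub>R w) = (1 / s) *\<^sub>R (u *\<^sub>R z + v *\<^sub>R w)"
    by (simp add: persp_def s_def)
  also have "\<dots> = (u * (1 + p \<bullet> z) / s) *\<^sub>R persp (- p) z + (v * (1 + p \<bullet> w) / s) *\<^sub>R persp (- p) w"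
    using z(1) w(1) by (simp add: persp_def scaleR_add_right)
  also have "\<dots> \<in> K"
    using uv z w \<open>s > 0\<close> by (intro convexD[OF assms(1)]) (auto simp: add_divide_distrib[symmetric] s[symmetric])
  finally show "u *\<^sub>R z + v *\<^sub>R w \<in> persp p ` K"
    using mem \<open>s > 0\<close> s_def by blast
qed

text \<open>The preimage of the interior of \<open>K\<close> under \<open>persp (- p)\<close> is open, since this map is continuous where
\<open>0 < 1 + p \<bullet> z\<close>.\<close>

lemma interior_persp_image:
  assumes "interior K \<noteq> {}" and K: "\<And>x. x \<in> K \<Longrightarrow> p \<bullet> x < 1"
  shows "interior (persp p ` K) \<noteq> {}"
proof -
  obtain x where x: "x \<in> interior K" using assms(1) by blast
  have px: "p \<bullet> x < 1" using x K interior_subset by blast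
  define U where "U = {z. 0 < 1 + p \<bullet> z}"
  have oU: "open U" unfolding U_def by (intro open_Collect_less continuous_intros)
  have c: "continuous_on U (persp (- p))"
    unfolding persp_def U_def by (intro continuous_intros) auto
  have o: "open (U \<inter> persp (- p) -` interior K)"
    using c oU by (intro continuous_open_preimage) auto
  have "U \<inter> persp (- p) -` interior K \<subseteq> persp p ` K"
    using mem_persp_image[OF K] interior_subset[of K] by (fastforce simp: U_def)
  moreover have "persp p x \<in> U \<inter> persp (- p) -` interior K"
  proof -
    have "0 < 1 + p \<bullet> persp p x" using persp_denominator[of p x "- p"] px by simp
    then show ?thesis using x px persp_inverse[of p x] by (simp add: U_def)
  qed
  ultimately show ?thesis using o interior_maximal by blast
qed

text \<open>The Jacobian \<open>(1 - p \<bullet> x)\<^sup>-\<^sup>(\<^sup>d\<^sup>+\<^sup>1\<^sup>)\<close>, obtained without derivatives. The integral of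
\<open>g\<close> over the image, multiplied by \<open>c = \<integral> t\<^sup>d dt\<close> over the unit interval, is an integral over the
cone on the image at heights \<open>0 < t < 1\<close>. The shear \<open>(t, x) \<mapsto> (t - p \<bullet> x, x)\<close>, which
preserves Lebesgue measure by Fubini, carries the cone on \<open>K\<close> onto that cone. The part of the
cone on \<open>K\<close> that is mapped to height at most \<open>1\<close> reaches, over \<open>x\<close>, the
height \<open>1 / (1 - p \<bullet> x)\<close>, and integrating \<open>t\<^sup>d\<close> up to it produces the power \<open>d + 1\<close>.\<close>

lemma nn_integral_persp_image:
  fixes K :: "'a::euclidean_space set" and g :: "'a \<Rightarrow> ennreal"
  assumes K: "\<And>x. x \<in> K \<Longrightarrow> p \<bullet> x < 1" and [measurable]: "K \<in> sets borel"
    and g [measurable]: "g \<in> borel_measurable borel"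
  shows "(\<integral>\<^sup>+z. g z * indicator (persp p ` K) z \<partial>lborel)
       = (\<integral>\<^sup>+x. g (persp p x) * ennreal (1 / (1 - p \<bullet> x) ^ (DIM('a) + 1)) * indicator K x \<partial>lborel)"
proof -
  let ?d = "DIM('a)"
  define G where "G z = g z * indicator (persp p ` K) z" for z
  have G_eq: "G = (\<lambda>z. g z * indicator {z. 0 < 1 + p \<bullet> z \<and> persp (- p) z \<in> K} z)"
    unfolding G_def using mem_persp_image[OF K] by (auto simp: indicator_def fun_eq_iff)
  have [measurable]: "G \<in> borel_measurable borel"
    unfolding G_eq by measurable
  define I :: "real \<Rightarrow> ennreal" where "I = indicator {0<..<1}"
  have [measurable]: "I \<in> borel_measurable borel" unfolding I_def by measurable
  define c where "c = (\<integral>\<^sup>+t. I t * ennreal (t ^ ?d) \<partial>lborel)"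
  \<comment> \<open>Integrals over the cone on the image: the slice at height \<open>t\<close> is the image scaled by \<open>t\<close>.\<close>
  have "c * (\<integral>\<^sup>+z. G z \<partial>lborel) = (\<integral>\<^sup>+t. I t * ennreal (t ^ ?d) * (\<integral>\<^sup>+z. G z \<partial>lborel) \<partial>lborel)"
    unfolding c_def by (simp add: nn_integral_multc)
  also have "\<dots> = (\<integral>\<^sup>+t. \<integral>\<^sup>+y. I t * G ((1 / t) *\<^sub>R y) \<partial>lborel \<partial>lborel)"
  proof (rule nn_integral_cong)
    fix t :: real
    show "I t * ennreal (t ^ ?d) * (\<integral>\<^sup>+z. G z \<partial>lborel) = (\<integral>\<^sup>+y. I t * G ((1 / t) *\<^sub>R y) \<partial>lborel)"
    proof (cases "t > 0")
      case True
      have "(\<integral>\<^sup>+y. G ((1 / t) *\<^sub>R y) \<partial>lborel) = ennreal (t ^ ?d) * (\<integral>\<^sup>+z. G z \<partial>lborel)"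
        using True by (subst nn_integral_lborel_affine[where c=t and t=0]) simp_all
      then show ?thesis by (simp add: nn_integral_cmult mult.assoc)
    qed (simp add: I_def)
  qed
  also have "\<dots> = (\<integral>\<^sup>+y. \<integral>\<^sup>+t. I t * G ((1 / t) *\<^sub>R y) \<partial>lborel \<partial>lborel)"
    by (rule lborel_pair.Fubini') (simp add: case_prod_unfold)
  \<comment> \<open>The shear.\<close>
  also have "\<dots> = (\<integral>\<^sup>+y. \<integral>\<^sup>+t. I (t - p \<bullet> y) * G ((1 / (t - p \<bullet> y)) *\<^sub>R y) \<partial>lborel \<partial>lborel)"
    by (rule nn_integral_cong, subst nn_integral_real_affine[where c=1 and t="- (p \<bullet> y)" for y]) simp_all
  also have "\<dots> = (\<integral>\<^sup>+t. \<integral>\<^sup>+y. I (t - p \<bullet> y) * G ((1 / (t - p \<bullet> y)) *\<^sub>R y) \<partial>lborel \<partial>lborel)"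
    by (rule lborel_pair.Fubini') (simp add: case_prod_unfold)
  also have "\<dots> = (\<integral>\<^sup>+t. \<integral>\<^sup>+x. indicator {0<..} t * ennreal (t ^ ?d) * (I (t * (1 - p \<bullet> x)) * (g (persp p x) * indicator K x)) \<partial>lborel \<partial>lborel)"
  proof (rule nn_integral_cong)
    fix t :: real
    show "(\<integral>\<^sup>+y. I (t - p \<bullet> y) * G ((1 / (t - p \<bullet> y)) *\<^sub>R y) \<partial>lborel)
      = (\<integral>\<^sup>+x. indicator {0<..} t * ennreal (t ^ ?d) * (I (t * (1 - p \<bullet> x)) * (g (persp p x) * indicator K x)) \<partial>lborel)"
    proof (cases "t > 0")
      case True
      have "(\<integral>\<^sup>+y. I (t - p \<bullet> y) * G ((1 / (t - p \<bullet> y)) *\<^sub>R y) \<partial>lborel)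
          = ennreal (t ^ ?d) * (\<integral>\<^sup>+x. I (t - p \<bullet> (t *\<^sub>R x)) * G ((1 / (t - p \<bullet> (t *\<^sub>R x))) *\<^sub>R (t *\<^sub>R x)) \<partial>lborel)"
        using True by (subst nn_integral_lborel_affine[where c=t and t=0]) simp_all
      also have "(\<integral>\<^sup>+x. I (t - p \<bullet> (t *\<^sub>R x)) * G ((1 / (t - p \<bullet> (t *\<^sub>R x))) *\<^sub>R (t *\<^sub>R x)) \<partial>lborel)
          = (\<integral>\<^sup>+x. I (t * (1 - p \<bullet> x)) * (g (persp p x) * indicator K x) \<partial>lborel)"
      proof (rule nn_integral_cong)
        fix x
        have e1: "t - p \<bullet> (t *\<^sub>R x) = t * (1 - p \<bullet> x)" by (simp add: algebra_simps)
        have e2: "(1 / (t - p \<bullet> (t *\<^sub>R x))) *\<^sub>R (t *\<^sub>R x) = persp p x"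
        proof -
          have "1 / (t * (1 - p \<bullet> x)) * t = 1 / (1 - p \<bullet> x)" using True by simp
          then show ?thesis unfolding e1 persp_def scaleR_scaleR by simp
        qed
        \<comment> \<open>For \<open>p \<bullet> x \<ge> 1\<close> the left-hand side vanishes because the sheared height is not positive.\<close>
        show "I (t - p \<bullet> (t *\<^sub>R x)) * G ((1 / (t - p \<bullet> (t *\<^sub>R x))) *\<^sub>R (t *\<^sub>R x))
           = I (t * (1 - p \<bullet> x)) * (g (persp p x) * indicator K x)"
        proof (cases "1 - p \<bullet> x > 0")
          case pos: True
          have "persp p x \<in> persp p ` K \<longleftrightarrow> x \<in> K"
            using persp_inverse[of p x] pos mem_persp_image[of K p "persp p x"] K by auto
          then show ?thesis by (simp only: e2, simp only: e1, simp add: G_def indicator_def)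
        next
          case False
          then have "\<not> t * (1 - p \<bullet> x) > 0" using True by (simp add: zero_less_mult_iff)
          then show ?thesis by (simp only: e2, simp only: e1, simp add: I_def)
        qed
      qed
      finally show ?thesis using True by (simp add: nn_integral_cmult)
    next
      case False
      have "I (t - p \<bullet> y) * G ((1 / (t - p \<bullet> y)) *\<^sub>R y) = 0" for y
      proof (cases "t - p \<bullet> y > 0")
        case True
        then have "1 + p \<bullet> ((1 / (t - p \<bullet> y)) *\<^sub>R y) = t / (t - p \<bullet> y)" by (simp add: field_simps)
        then have "\<not> 0 < 1 + p \<bullet> ((1 / (t - p \<bullet> y)) *\<^sub>R y)" using False True by (simp add: field_simps)
        then show ?thesis unfolding G_eq by (simp add: indicator_def)
      qed (simp add: I_def)
      then show ?thesis using False by (simp only: nn_integral_const) simp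
    qed
  qed
  also have "\<dots> = (\<integral>\<^sup>+x. \<integral>\<^sup>+t. indicator {0<..} t * ennreal (t ^ ?d) * (I (t * (1 - p \<bullet> x)) * (g (persp p x) * indicator K x)) \<partial>lborel \<partial>lborel)"
    by (rule lborel_pair.Fubini') (simp add: case_prod_unfold)
  also have "\<dots> = (\<integral>\<^sup>+x. c * (g (persp p x) * ennreal (1 / (1 - p \<bullet> x) ^ (DIM('a) + 1)) * indicator K x) \<partial>lborel)"
  proof (rule nn_integral_cong)
    fix x
    show "(\<integral>\<^sup>+t. indicator {0<..} t * ennreal (t ^ ?d) * (I (t * (1 - p \<bullet> x)) * (g (persp p x) * indicator K x)) \<partial>lborel)
      = c * (g (persp p x) * ennreal (1 / (1 - p \<bullet> x) ^ (DIM('a) + 1)) * indicator K x)"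
    proof (cases "x \<in> K")
      case True
      define r where "r = 1 / (1 - p \<bullet> x)"
      have r: "r > 0" using K[OF True] by (simp add: r_def)
      have "(\<integral>\<^sup>+t. indicator {0<..} t * ennreal (t ^ ?d) * I (t * (1 - p \<bullet> x)) \<partial>lborel)
        = ennreal r * (\<integral>\<^sup>+t. indicator {0<..} (r * t) * ennreal ((r * t) ^ ?d) * I ((r * t) * (1 - p \<bullet> x)) \<partial>lborel)"
        using r by (subst nn_integral_real_affine[where c=r and t=0]) simp_all
      also have "(\<lambda>t. indicator {0<..} (r * t) * ennreal ((r * t) ^ ?d) * I ((r * t) * (1 - p \<bullet> x)))
        = (\<lambda>t. ennreal (r ^ ?d) * (I t * ennreal (t ^ ?d)))"
      proof
        fix t
        have "(r * t) * (1 - p \<bullet> x) = t" using K[OF True] by (simp add: r_def)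
        moreover have "indicator {0<..} (r * t) * I t = I t"
          using r by (auto simp: I_def indicator_def zero_less_mult_iff)
        moreover have "ennreal ((r * t) ^ ?d) = ennreal (r ^ ?d) * ennreal (t ^ ?d)"
          using r by (simp add: power_mult_distrib ennreal_mult')
        ultimately show "indicator {0<..} (r * t) * ennreal ((r * t) ^ ?d) * I ((r * t) * (1 - p \<bullet> x)) = ennreal (r ^ ?d) * (I t * ennreal (t ^ ?d))"
          by (metis mult.assoc mult.commute)
      qed
      also have "ennreal r * (\<integral>\<^sup>+t. ennreal (r ^ ?d) * (I t * ennreal (t ^ ?d)) \<partial>lborel) = ennreal (r ^ (?d + 1)) * c"
        using r by (simp add: nn_integral_cmult c_def ennreal_mult' mult.assoc)
      also have "r ^ (?d + 1) = 1 / (1 - p \<bullet> x) ^ (DIM('a) + 1)"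
        by (simp add: r_def power_one_over)
      finally have e: "(\<integral>\<^sup>+t. indicator {0<..} t * ennreal (t ^ ?d) * I (t * (1 - p \<bullet> x)) \<partial>lborel) = ennreal (1 / (1 - p \<bullet> x) ^ (DIM('a) + 1)) * c" .
      have "(\<integral>\<^sup>+t. indicator {0<..} t * ennreal (t ^ ?d) * (I (t * (1 - p \<bullet> x)) * (g (persp p x) * indicator K x)) \<partial>lborel)
        = (\<integral>\<^sup>+t. indicator {0<..} t * ennreal (t ^ ?d) * I (t * (1 - p \<bullet> x)) \<partial>lborel) * (g (persp p x) * indicator K x)"
        by (subst nn_integral_multc[symmetric]) (simp_all add: mult.assoc)
      then show ?thesis unfolding e by (simp add: ac_simps)
    qed simp
  qed
  also have "\<dots> = c * (\<integral>\<^sup>+x. g (persp p x) * ennreal (1 / (1 - p \<bullet> x) ^ (DIM('a) + 1)) * indicator K x \<partial>lborel)"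
    by (rule nn_integral_cmult) simp
  finally have eq: "c * (\<integral>\<^sup>+z. G z \<partial>lborel) = c * (\<integral>\<^sup>+x. g (persp p x) * ennreal (1 / (1 - p \<bullet> x) ^ (DIM('a) + 1)) * indicator K x \<partial>lborel)" .
  have "c \<noteq> 0"
  proof
    assume "c = 0"
    then have "AE t in lborel. I t * ennreal (t ^ ?d) = 0"
      unfolding c_def by (subst (asm) nn_integral_0_iff_AE) auto
    then have "AE t in lborel. t \<notin> {0<..<(1::real)}"
    proof eventually_elim
      case (elim t)
      show ?case
      proof
        assume t: "t \<in> {0<..<1}"
        then have "0 < t ^ ?d" by simp
        then show False using elim t by (simp add: I_def ennreal_eq_0_iff)
      qed
    qed
    then have "emeasure lborel {0<..<(1::real)} = 0"
      by (subst (asm) AE_iff_null_sets[symmetric]) auto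
    then show False by simp
  qed
  moreover have "c < \<infinity>"
  proof -
    have "c \<le> (\<integral>\<^sup>+t. indicator {0<..<(1::real)} t \<partial>lborel)"
      unfolding c_def
    proof (rule nn_integral_mono)
      fix t :: real
      show "I t * ennreal (t ^ ?d) \<le> indicator {0<..<1} t"
        by (auto simp: I_def indicator_def power_le_one)
    qed
    also have "\<dots> = 1" by simp
    finally show ?thesis by (simp add: le_less_trans)
  qed
  ultimately have "(\<integral>\<^sup>+z. G z \<partial>lborel) = (\<integral>\<^sup>+x. g (persp p x) * ennreal (1 / (1 - p \<bullet> x) ^ (DIM('a) + 1)) * indicator K x \<partial>lborel)"
    using eq unfolding ennreal_mult_cancel_left by (metis infinity_ennreal_def less_irrefl)
  then show ?thesis unfolding G_def .
qed

lemma lborel_on_persp_image: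
  fixes K :: "'a::euclidean_space set"
  assumes K: "\<And>x. x \<in> K \<Longrightarrow> p \<bullet> x < 1" and c: "compact K"
  shows "lborel_on (persp p ` K) = distr (density (lborel_on K) (\<lambda>x. ennreal (1 / (1 - p \<bullet> x) ^ (DIM('a) + 1)))) borel (persp p)"
proof (rule measure_eqI)
  have [measurable]: "K \<in> sets borel" using c by (rule borel_compact)
  have [measurable]: "persp p ` K \<in> sets borel" using compact_persp_image[OF c K] by (rule borel_compact)
  fix A assume "A \<in> sets (lborel_on (persp p ` K))"
  then have [measurable]: "A \<in> sets borel" by simp
  let ?w = "\<lambda>x. ennreal (1 / (1 - p \<bullet> x) ^ (DIM('a) + 1))"
  have "emeasure (lborel_on (persp p ` K)) A = (\<integral>\<^sup>+z. indicator A z * indicator (persp p ` K) z \<partial>lborel)"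
    by (subst nn_integral_lborel_on[symmetric]) auto
  also have "\<dots> = (\<integral>\<^sup>+x. indicator A (persp p x) * ?w x * indicator K x \<partial>lborel)"
    using K by (rule nn_integral_persp_image) auto
  also have "\<dots> = (\<integral>\<^sup>+x. indicator A (persp p x) * ?w x \<partial>lborel_on K)"
    by (subst nn_integral_lborel_on) auto
  also have "\<dots> = (\<integral>\<^sup>+x. indicator A (persp p x) \<partial>density (lborel_on K) ?w)"
    by (subst nn_integral_density) (auto simp: mult.commute)
  also have "\<dots> = (\<integral>\<^sup>+x. indicator A x \<partial>distr (density (lborel_on K) ?w) borel (persp p))"
    by (subst nn_integral_distr) auto
  finally show "emeasure (lborel_on (persp p ` K)) A = emeasure (distr (density (lborel_on K) ?w) borel (persp p)) A"
    by simp
qed simp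

lemma integral_persp_image:
  fixes K :: "'a::euclidean_space set" and f :: "'a \<Rightarrow> 'b::{banach, second_countable_topology}"
  assumes K: "\<And>x. x \<in> K \<Longrightarrow> p \<bullet> x < 1" and c: "compact K" and [measurable]: "f \<in> borel_measurable borel"
  shows "(\<integral>z. f z \<partial>lborel_on (persp p ` K)) = (\<integral>x. (1 / (1 - p \<bullet> x) ^ (DIM('a) + 1)) *\<^sub>R f (persp p x) \<partial>lborel_on K)"
proof -
  have [measurable]: "K \<in> sets borel" using c by (rule borel_compact)
  have "AE x in lborel_on K. 0 \<le> 1 / (1 - p \<bullet> x) ^ (DIM('a) + 1)"
    by (rule AE_lborel_on) (use K in \<open>auto intro: less_imp_le\<close>)
  then have "(\<integral>x. f (persp p x) \<partial>density (lborel_on K) (\<lambda>x. ennreal (1 / (1 - p \<bullet> x) ^ (DIM('a) + 1))))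
      = (\<integral>x. (1 / (1 - p \<bullet> x) ^ (DIM('a) + 1)) *\<^sub>R f (persp p x) \<partial>lborel_on K)"
    by (intro integral_density) auto
  moreover have "(\<integral>z. f z \<partial>lborel_on (persp p ` K))
      = (\<integral>x. f (persp p x) \<partial>density (lborel_on K) (\<lambda>x. ennreal (1 / (1 - p \<bullet> x) ^ (DIM('a) + 1))))"
  proof -
    have "lborel_on (persp p ` K) = distr (density (lborel_on K) (\<lambda>x. ennreal (1 / (1 - p \<bullet> x) ^ (DIM('a) + 1)))) borel (persp p)"
      using K c by (rule lborel_on_persp_image)
    then show ?thesis by (simp only:) (rule integral_distr, auto)
  qed
  ultimately show ?thesis by simp
qed

section \<open>Log-concavity of marginals\<close>

lemma ennreal_as_length:
  assumes "a < \<infinity>"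
  shows "a = (\<integral>\<^sup>+t. indicator {t. 0 \<le> t \<and> ennreal t < a} t \<partial>lborel)"
proof (cases a)
  case (real r)
  then have "{t. 0 \<le> t \<and> ennreal t < a} = {0..<r}"
    by (auto simp: ennreal_less_iff)
  then show ?thesis using real by simp
qed (use assms in simp)

text \<open>The area under the graph of \<open>f\<close>, computed by horizontal instead of vertical slices.\<close>

lemma nn_integral_layer_cake:
  fixes f :: "real \<Rightarrow> ennreal"
  assumes [measurable]: "f \<in> borel_measurable borel" and fin: "\<And>x. f x < \<infinity>"
  shows "(\<integral>\<^sup>+x. f x \<partial>lborel) = (\<integral>\<^sup>+t. indicator {0..} t * emeasure lborel {x. ennreal t < f x} \<partial>lborel)"
proof -
  have "(\<integral>\<^sup>+x. f x \<partial>lborel) = (\<integral>\<^sup>+x. \<integral>\<^sup>+t. indicator {0..} t * indicator {x. ennreal t < f x} x \<partial>lborel \<partial>lborel)"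
    by (subst ennreal_as_length[OF fin], intro nn_integral_cong) (auto simp: indicator_def)
  also have "\<dots> = (\<integral>\<^sup>+t. \<integral>\<^sup>+x. indicator {0..} t * indicator {x. ennreal t < f x} x \<partial>lborel \<partial>lborel)"
    by (rule lborel_pair.Fubini') (simp add: case_prod_unfold)
  also have "\<dots> = (\<integral>\<^sup>+t. indicator {0..} t * emeasure lborel {x. ennreal t < f x} \<partial>lborel)"
    by (intro nn_integral_cong) (simp add: nn_integral_cmult)
  finally show ?thesis .
qed

lemma convex_bounded_real_between:
  fixes I :: "real set"
  assumes I: "convex I" "I \<noteq> {}" "bounded I" and \<theta>: "0 < \<theta>" "\<theta> < 1"
  shows "(1 - \<theta>) * Inf I + \<theta> * Sup I \<in> I"
proof (cases "Inf I = Sup I")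
  case True
  obtain x where "x \<in> I" using I by blast
  then have "Inf I \<le> x" "x \<le> Sup I"
    using I by (auto intro: cInf_lower cSup_upper bounded_imp_bdd_below bounded_imp_bdd_above)
  then have "x = Inf I" "x = Sup I" using True by auto
  then show ?thesis using \<open>x \<in> I\<close> by (simp add: algebra_simps)
next
  case False
  let ?z = "(1 - \<theta>) * Inf I + \<theta> * Sup I"
  have "Inf I \<le> Sup I"
    using I by (intro cInf_le_cSup bounded_imp_bdd_below bounded_imp_bdd_above)
  then have lt: "Inf I < Sup I" using False by simp
  have e: "?z = Inf I + \<theta> * (Sup I - Inf I)" "?z = Sup I - (1 - \<theta>) * (Sup I - Inf I)" by algebra+
  have "\<theta> * (Sup I - Inf I) > 0" "(1 - \<theta>) * (Sup I - Inf I) > 0" using lt \<theta> by auto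
  then have "Inf I < ?z" "?z < Sup I" using e by linarith+
  then obtain x y where xy: "x \<in> I" "x < ?z" "y \<in> I" "?z < y"
    using I by (meson cInf_lessD less_cSupD)
  then have "?z \<in> closed_segment x y" by (simp add: closed_segment_eq_real_ivl)
  then show ?thesis
    using I(1) xy by (auto simp: convex_contains_segment)
qed

lemma emeasure_bounded_real_le:
  fixes I :: "real set"
  assumes "I \<noteq> {}" "bounded I"
  shows "emeasure lborel I \<le> ennreal (Sup I - Inf I)"
proof -
  have "I \<subseteq> {Inf I..Sup I}"
    using cInf_lower[OF _ bounded_imp_bdd_below[OF assms(2)]] cSup_upper[OF _ bounded_imp_bdd_above[OF assms(2)]] by auto
  then have "emeasure lborel I \<le> emeasure lborel {Inf I..Sup I}"
    by (intro emeasure_mono) auto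
  also have "\<dots> = ennreal (Sup I - Inf I)"
    using assms by (intro emeasure_lborel_Icc cInf_le_cSup bounded_imp_bdd_below bounded_imp_bdd_above)
  finally show ?thesis .
qed

text \<open>When the suprema agree, the superlevel sets of \<open>f\<close> and \<open>g\<close> at each height are both empty or
both nonempty. In the latter case they are intervals, and the superlevel set of \<open>h\<close> contains their weighted
Minkowski sum, whose length is the weighted sum of lengths. Integration over the heights gives a
bound by the arithmetic mean.\<close>

lemma prekopa_leindler_equal_sups:
  fixes f g h :: "real \<Rightarrow> ennreal"
  assumes [measurable]: "f \<in> borel_measurable borel" "g \<in> borel_measurable borel" "h \<in> borel_measurable borel"
    and qf: "\<And>t. convex {x. t < f x}" and qg: "\<And>t. convex {x. t < g x}"
    and sf: "\<And>x. R < \<bar>x\<bar> \<Longrightarrow> f x = 0" and sg: "\<And>x. R < \<bar>x\<bar> \<Longrightarrow> g x = 0"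
    and fin: "\<And>x. f x < \<infinity>" "\<And>x. g x < \<infinity>" "\<And>x. h x < \<infinity>"
    and sup: "(SUP x. f x) = (SUP x. g x)"
    and l: "0 < l" "l < 1"
    and le: "\<And>s t. min (f s) (g t) \<le> h ((1 - l) * s + l * t)"
  shows "ennreal (1 - l) * (\<integral>\<^sup>+x. f x \<partial>lborel) + ennreal l * (\<integral>\<^sup>+x. g x \<partial>lborel) \<le> (\<integral>\<^sup>+x. h x \<partial>lborel)"
proof -
  let ?m = "emeasure lborel"
  have level: "ennreal (1 - l) * ?m {x. ennreal t < f x} + ennreal l * ?m {x. ennreal t < g x} \<le> ?m {x. ennreal t < h x}"
    if t: "t \<ge> 0" for t
  proof (cases "ennreal t < (SUP x. f x)")
    case False
    have "f x \<le> (SUP x. f x)" "g x \<le> (SUP x. f x)" for x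
      using SUP_upper[of x UNIV f] SUP_upper[of x UNIV g] sup by auto
    then have "\<not> ennreal t < f x" "\<not> ennreal t < g x" for x
      using False less_le_trans by blast+
    then show ?thesis by simp
  next
    case True
    let ?F = "{x. ennreal t < f x}" and ?G = "{x. ennreal t < g x}"
    have "\<exists>x. ennreal t < f x" using True by (auto simp: less_SUP_iff)
    moreover have "\<exists>x. ennreal t < g x" using True unfolding sup by (auto simp: less_SUP_iff)
    ultimately have ne: "?F \<noteq> {}" "?G \<noteq> {}" by auto
    have sub: "{x. ennreal t < u x} \<subseteq> {-R..R}" if "\<And>x. R < \<bar>x\<bar> \<Longrightarrow> u x = 0" for u :: "real \<Rightarrow> ennreal"
    proof
      fix x assume "x \<in> {x. ennreal t < u x}"
      then have "u x \<noteq> 0" by auto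
      then have "\<not> R < \<bar>x\<bar>" using that by blast
      then show "x \<in> {-R..R}" by auto
    qed
    have bF: "bounded ?F" and bG: "bounded ?G"
      using bounded_subset[OF bounded_closed_interval sub[OF sf]] bounded_subset[OF bounded_closed_interval sub[OF sg]] by auto
    let ?lo = "(1 - l) * Inf ?F + l * Inf ?G" and ?hi = "(1 - l) * Sup ?F + l * Sup ?G"
    have "Inf ?F \<le> Sup ?F" using ne bF by (intro cInf_le_cSup bounded_imp_bdd_below bounded_imp_bdd_above)
    moreover have "Inf ?G \<le> Sup ?G" using ne bG by (intro cInf_le_cSup bounded_imp_bdd_below bounded_imp_bdd_above)
    ultimately have ge: "0 \<le> Sup ?F - Inf ?F" "0 \<le> Sup ?G - Inf ?G" by auto
    have hl: "?hi - ?lo = (1 - l) * (Sup ?F - Inf ?F) + l * (Sup ?G - Inf ?G)" by (simp add: algebra_simps)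
    have "0 \<le> (1 - l) * (Sup ?F - Inf ?F)" "0 \<le> l * (Sup ?G - Inf ?G)"
      using ge l by (auto intro!: mult_nonneg_nonneg)
    then have lohi: "?lo \<le> ?hi" using hl by linarith
    have sub: "{?lo<..<?hi} \<subseteq> {x. ennreal t < h x}"
    proof
      fix z assume z: "z \<in> {?lo<..<?hi}"
      \<comment> \<open>The same ratio is used in both intervals, so the combination of the two points is exactly \<open>z\<close>.\<close>
      define \<theta> where "\<theta> = (z - ?lo) / (?hi - ?lo)"
      have \<theta>: "0 < \<theta>" "\<theta> < 1" using z by (auto simp: \<theta>_def divide_simps)
      define s where "s = (1 - \<theta>) * Inf ?F + \<theta> * Sup ?F"
      define r where "r = (1 - \<theta>) * Inf ?G + \<theta> * Sup ?G"
      have "s \<in> ?F" unfolding s_def by (rule convex_bounded_real_between[OF qf ne(1) bF \<theta>])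
      moreover have "r \<in> ?G" unfolding r_def by (rule convex_bounded_real_between[OF qg ne(2) bG \<theta>])
      moreover have "\<theta> * (?hi - ?lo) = z - ?lo" using z by (simp add: \<theta>_def)
      then have "(1 - l) * s + l * r = z" unfolding s_def r_def by (simp add: algebra_simps)
      ultimately show "z \<in> {x. ennreal t < h x}"
        using le[of s r] by (auto simp: min_def split: if_splits)
    qed
    have "ennreal (1 - l) * ?m ?F + ennreal l * ?m ?G
        \<le> ennreal (1 - l) * ennreal (Sup ?F - Inf ?F) + ennreal l * ennreal (Sup ?G - Inf ?G)"
      using ne bF bG by (intro add_mono mult_left_mono emeasure_bounded_real_le) auto
    also have "\<dots> = ennreal (?hi - ?lo)"
      using l ge unfolding hl by (simp add: ennreal_mult[symmetric] ennreal_plus[symmetric] del: ennreal_plus)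
    also have "\<dots> = ?m {?lo<..<?hi}" using lohi by simp
    also have "\<dots> \<le> ?m {x. ennreal t < h x}"
      using sub by (intro emeasure_mono) auto
    finally show ?thesis .
  qed
  have "ennreal (1 - l) * (\<integral>\<^sup>+x. f x \<partial>lborel) + ennreal l * (\<integral>\<^sup>+x. g x \<partial>lborel)
      = (\<integral>\<^sup>+t. ennreal (1 - l) * (indicator {0..} t * ?m {x. ennreal t < f x}) + ennreal l * (indicator {0..} t * ?m {x. ennreal t < g x}) \<partial>lborel)"
    unfolding nn_integral_layer_cake[OF assms(1) fin(1)] nn_integral_layer_cake[OF assms(2) fin(2)]
    by (subst nn_integral_add) (auto simp: nn_integral_cmult)
  also have "\<dots> \<le> (\<integral>\<^sup>+t. indicator {0..} t * ?m {x. ennreal t < h x} \<partial>lborel)"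
    using level by (intro nn_integral_mono) (auto simp: indicator_def)
  also have "\<dots> = (\<integral>\<^sup>+x. h x \<partial>lborel)"
    by (rule nn_integral_layer_cake[OF assms(3) fin(3), symmetric])
  finally show ?thesis .
qed

lemma exp_weighted_mean:
  fixes u l :: real
  assumes "0 < l" "l < 1"
  shows "exp (l * u) \<le> (1 - l) + l * exp u"
proof -
  have "convex_on UNIV (exp :: real \<Rightarrow> real)" by (rule exp_convex)
  from convex_onD[OF this, of l 0 u] show ?thesis using assms by simp
qed

text \<open>Multiplying \<open>g\<close> by \<open>exp \<kappa>\<close> makes the suprema equal, and the weighted arithmetic-geometric
mean inequality in the form \<open>exp_weighted_mean\<close> removes the factor again. The hypothesis is the
usual one, \<open>f(s)\<^sup>1\<^sup>-\<^sup>l g(t)\<^sup>l \<le> h((1 - l) s + l t)\<close>, in the form explained at \<open>log_concave_on\<close>.\<close>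

lemma prekopa_leindler:
  fixes f g h :: "real \<Rightarrow> ennreal"
  assumes [measurable]: "f \<in> borel_measurable borel" "g \<in> borel_measurable borel" "h \<in> borel_measurable borel"
    and qf: "\<And>t. convex {x. t < f x}" and qg: "\<And>t. convex {x. t < g x}"
    and sf: "\<And>x. R < \<bar>x\<bar> \<Longrightarrow> f x = 0" and sg: "\<And>x. R < \<bar>x\<bar> \<Longrightarrow> g x = 0"
    and bf: "\<And>x. f x \<le> ennreal C" and bg: "\<And>x. g x \<le> ennreal C" and fin: "\<And>x. h x < \<infinity>"
    and l: "0 < l" "l < 1"
    and le: "\<And>s t c. min (f s) (ennreal (exp c) * g t) \<le> ennreal (exp (l * c)) * h ((1 - l) * s + l * t)"
  shows "min (\<integral>\<^sup>+x. f x \<partial>lborel) (ennreal (exp c) * (\<integral>\<^sup>+x. g x \<partial>lborel)) \<le> ennreal (exp (l * c)) * (\<integral>\<^sup>+x. h x \<partial>lborel)"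
proof -
  let ?A = "SUP x. f x" and ?B = "SUP x. g x"
  show ?thesis
  proof (cases "?A = 0 \<or> ?B = 0")
    case True
    then have "(\<forall>x. f x = 0) \<or> (\<forall>x. g x = 0)"
      by (metis SUP_upper UNIV_I le_zero_eq)
    then show ?thesis by auto
  next
    case False
    have "?A \<le> ennreal C" "?B \<le> ennreal C" using bf bg by (auto intro: SUP_least)
    then have fAB: "?A < \<infinity>" "?B < \<infinity>" by (auto simp: le_less_trans)
    obtain a where a: "?A = ennreal a" "a > 0"
      using fAB False by (cases ?A) (auto simp: less_le)
    obtain b where b: "?B = ennreal b" "b > 0"
      using fAB False by (cases ?B) (auto simp: less_le)
    define \<kappa> where "\<kappa> = ln (a / b)"
    have e\<kappa>: "exp \<kappa> * b = a" using a b by (simp add: \<kappa>_def)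
    let ?g = "\<lambda>x. ennreal (exp \<kappa>) * g x" and ?h = "\<lambda>x. ennreal (exp (l * \<kappa>)) * h x"
    have supeq: "(SUP x. f x) = (SUP x. ?g x)"
      using a b e\<kappa> by (simp add: SUP_mult_left_ennreal[symmetric] ennreal_mult[symmetric])
    have qg': "convex {x. t < ?g x}" for t
    proof -
      have "{x. t < ?g x} = {x. t / ennreal (exp \<kappa>) < g x}"
        by (auto simp: divide_less_ennreal mult.commute)
      then show ?thesis using qg by simp
    qed
    let ?F = "\<integral>\<^sup>+x. f x \<partial>lborel" and ?G = "\<integral>\<^sup>+x. g x \<partial>lborel" and ?H = "\<integral>\<^sup>+x. h x \<partial>lborel"
    define m where "m = min ?F (ennreal (exp c) * ?G)"
    have "ennreal (1 - l) * ?F + ennreal l * (\<integral>\<^sup>+x. ?g x \<partial>lborel) \<le> (\<integral>\<^sup>+x. ?h x \<partial>lborel)"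
    proof (rule prekopa_leindler_equal_sups[where R=R])
      show "f x < \<infinity>" for x using bf[of x] by (simp add: le_less_trans)
      have "g x < \<infinity>" for x using bg[of x] by (simp add: le_less_trans)
      then show "?g x < \<infinity>" for x by (simp add: ennreal_mult_less_top)
      show "?h x < \<infinity>" for x using fin by (simp add: ennreal_mult_less_top)
      show "convex {x. t < ?g x}" for t by (rule qg')
    qed (use qf sf sg supeq l le in auto)
    then have 1: "ennreal (1 - l) * ?F + ennreal l * (ennreal (exp \<kappa>) * ?G) \<le> ennreal (exp (l * \<kappa>)) * ?H"
      by (simp add: nn_integral_cmult)
    have mF: "m \<le> ?F" and mG: "m \<le> ennreal (exp c) * ?G" by (auto simp: m_def)
    have mG': "ennreal (exp (- c)) * m \<le> ?G"
    proof -
      have "ennreal (exp (- c)) * m \<le> ennreal (exp (- c)) * (ennreal (exp c) * ?G)"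
        using mG by (rule mult_left_mono) simp
      also have "\<dots> = ?G" by (simp add: mult.assoc[symmetric] ennreal_mult[symmetric] exp_add[symmetric])
      finally show ?thesis .
    qed
    have "ennreal (exp (l * (\<kappa> - c))) * m \<le> ennreal ((1 - l) + l * exp (\<kappa> - c)) * m"
      using exp_weighted_mean[OF l, of "\<kappa> - c"] by (intro mult_right_mono ennreal_leI) auto
    also have "\<dots> = ennreal (1 - l) * m + ennreal l * (ennreal (exp \<kappa>) * (ennreal (exp (- c)) * m))"
    proof -
      have "exp (\<kappa> - c) = exp \<kappa> * exp (- c)" by (simp add: exp_add[symmetric])
      then show ?thesis using l by (simp add: ennreal_plus ennreal_mult' distrib_right mult.assoc)
    qed
    also have "\<dots> \<le> ennreal (1 - l) * ?F + ennreal l * (ennreal (exp \<kappa>) * ?G)"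
      using mF mG' by (intro add_mono mult_left_mono) auto
    also note 1
    finally have 2: "ennreal (exp (l * (\<kappa> - c))) * m \<le> ennreal (exp (l * \<kappa>)) * ?H" .
    have "m = ennreal (exp (- (l * (\<kappa> - c)))) * (ennreal (exp (l * (\<kappa> - c))) * m)"
      by (simp add: mult.assoc[symmetric] ennreal_mult[symmetric] exp_add[symmetric])
    also have "\<dots> \<le> ennreal (exp (- (l * (\<kappa> - c)))) * (ennreal (exp (l * \<kappa>)) * ?H)"
      using 2 by (rule mult_left_mono) simp
    also have "\<dots> = ennreal (exp (- (l * (\<kappa> - c)) + l * \<kappa>)) * ?H"
      by (simp only: mult.assoc[symmetric] ennreal_mult[symmetric] exp_add exp_ge_zero)
    also have "- (l * (\<kappa> - c)) + l * \<kappa> = l * c" by (simp add: algebra_simps)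
    finally show ?thesis by (simp add: m_def)
  qed
qed

text \<open>Choosing \<open>c\<close> with \<open>exp c * f y = f x\<close> turns the inequality into
\<open>f(x)\<^sup>1\<^sup>-\<^sup>l f(y)\<^sup>l \<le> f((1 - l) x + l y)\<close>; conversely a minimum is at most the weighted geometric mean.
This form avoids real powers of extended reals and is the one that passes through integration.
The points are extensional because they are the points of a finite product measure.\<close>

definition log_concave_on :: "'i set \<Rightarrow> (('i \<Rightarrow> real) \<Rightarrow> ennreal) \<Rightarrow> bool" where
  "log_concave_on I f \<longleftrightarrow> (\<forall>x\<in>extensional I. \<forall>y\<in>extensional I. \<forall>l c. 0 < l \<longrightarrow> l < 1 \<longrightarrow>
     min (f x) (ennreal (exp c) * f y) \<le> ennreal (exp (l * c)) * f (\<lambda>i. (1 - l) * x i + l * y i))"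

definition log_concave_line :: "(real \<Rightarrow> ennreal) \<Rightarrow> bool" where
  "log_concave_line f \<longleftrightarrow> (\<forall>x y l c. 0 < l \<longrightarrow> l < 1 \<longrightarrow>
     min (f x) (ennreal (exp c) * f y) \<le> ennreal (exp (l * c)) * f ((1 - l) * x + l * y))"

lemma fun_upd_combination:
  fixes x y :: "'i \<Rightarrow> real"
  shows "(\<lambda>j. (1 - l) * (x(i := s)) j + l * (y(i := t)) j) = (\<lambda>j. (1 - l) * x j + l * y j)(i := (1 - l) * s + l * t)"
  by auto

lemma convex_superlevel_slice:
  assumes f: "log_concave_on (insert i I) f" and x: "x \<in> extensional I"
  shows "convex {t. u < f (x(i := t))}"
proof -
  have "(1 - l) * s + l * t \<in> {t. u < f (x(i := t))}"
    if st: "s \<in> {t. u < f (x(i := t))}" "t \<in> {t. u < f (x(i := t))}" and l: "0 < l" "l < 1" for s t l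
  proof -
    have ext: "x(i := r) \<in> extensional (insert i I)" for r using x by (auto simp: extensional_def)
    have "min (f (x(i := s))) (ennreal (exp 0) * f (x(i := t))) \<le> ennreal (exp (l * 0)) * f (\<lambda>j. (1 - l) * (x(i := s)) j + l * (x(i := t)) j)"
      using f ext l unfolding log_concave_on_def by blast
    moreover have "(\<lambda>j. (1 - l) * x j + l * x j) = x" by (simp add: algebra_simps)
    ultimately have "min (f (x(i := s))) (f (x(i := t))) \<le> f (x(i := (1 - l) * s + l * t))"
      unfolding fun_upd_combination by simp
    then show ?thesis using st by (auto simp: min_def split: if_splits)
  qed
  note inner = this
  show ?thesis
    unfolding convex_alt
  proof (intro ballI allI impI)
    fix s t v :: real
    assume st: "s \<in> {t. u < f (x(i := t))}" "t \<in> {t. u < f (x(i := t))}" and v: "0 \<le> v \<and> v \<le> 1"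
    consider "v = 0" | "v = 1" | "0 < v" "v < 1" using v by linarith
    then show "(1 - v) *\<^sub>R s + v *\<^sub>R t \<in> {t. u < f (x(i := t))}"
      using inner st by cases auto
  qed
qed

section \<open>Marginal densities of convex bodies\<close>

text \<open>The reflection in the hyperplane orthogonal to \<open>v - b\<close>.\<close>

lemma exists_orthogonal_transformation:
  fixes v b :: "'a::euclidean_space"
  assumes v: "norm v = 1" "norm b = 1"
  obtains T where "orthogonal_transformation T" "T v = b"
proof (cases "v = b")
  case True
  then show thesis using that[of "\<lambda>x. x"] by (simp add: orthogonal_transformation_def linear_iff)
next
  case False
  define n where "n = v - b"
  have nn: "n \<bullet> n \<noteq> 0" using False by (simp add: n_def)
  define T where "T x = x - (2 * (x \<bullet> n) / (n \<bullet> n)) *\<^sub>R n" for x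
  have "linear T"
    unfolding T_def by (rule linearI) (simp_all add: inner_add_left algebra_simps add_divide_distrib)
  moreover have "T x \<bullet> T y = x \<bullet> y" for x y
    using nn unfolding T_def by (simp add: inner_diff_left inner_diff_right inner_commute[of n y] field_simps)
  moreover have "T v = b"
  proof -
    have vv: "v \<bullet> v = 1" "b \<bullet> b = 1" using v by (simp_all add: dot_square_norm)
    have "n \<bullet> n = 2 * (v \<bullet> n)"
      using vv by (simp add: n_def inner_diff_left inner_diff_right inner_commute)
    then have "2 * (v \<bullet> n) / (n \<bullet> n) = 1" using nn by (metis divide_self)
    then have "T v = v - n" by (simp only: T_def scaleR_one)
    then show ?thesis by (simp add: n_def)
  qed
  ultimately show thesis using that[of T] by (simp add: orthogonal_transformation_def)
qed

lemma nn_integral_lborel_on_isometry: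
  fixes T :: "'a::euclidean_space \<Rightarrow> 'a" and g :: "'a \<Rightarrow> ennreal"
  assumes T: "orthogonal_transformation T" and K: "compact K" and [measurable]: "g \<in> borel_measurable borel"
  shows "(\<integral>\<^sup>+x. g (T x) \<partial>lborel_on K) = (\<integral>\<^sup>+y. g y \<partial>lborel_on (T ` K))"
proof -
  have lin: "linear T" using T by (rule orthogonal_transformation_linear)
  have [measurable]: "T \<in> borel_measurable borel" using lin by (rule linear_borel_measurable)
  have c: "compact (T ` K)" using K lin by (intro compact_continuous_image linear_continuous_on) (simp add: linear_linear)
  have [measurable]: "K \<in> sets borel" "T ` K \<in> sets borel" using K c by (auto intro: borel_compact)
  have "(\<integral>\<^sup>+x. g (T x) \<partial>lborel_on K) = (\<integral>\<^sup>+x. g (T x) * indicator (T ` K) (T x) \<partial>lborel)"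
  proof -
    have "T x \<in> T ` K \<longleftrightarrow> x \<in> K" for x
      using orthogonal_transformation_inj[OF T] by (auto dest: injD)
    then show ?thesis by (subst nn_integral_lborel_on) (auto intro!: nn_integral_cong simp: indicator_def)
  qed
  also have "\<dots> = (\<integral>\<^sup>+y. g y * indicator (T ` K) y \<partial>lborel)"
    by (rule lborel_isometry[OF T]) simp
  also have "\<dots> = (\<integral>\<^sup>+y. g y \<partial>lborel_on (T ` K))"
    by (subst nn_integral_lborel_on) auto
  finally show ?thesis .
qed

lemma log_concave_onD:
  assumes "log_concave_on I f" "x \<in> extensional I" "y \<in> extensional I" "0 < l" "l < 1"
  shows "min (f x) (ennreal (exp c) * f y) \<le> ennreal (exp (l * c)) * f (\<lambda>i. (1 - l) * x i + l * y i)"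
  using assms by (simp add: log_concave_on_def)

text \<open>The coordinates other than \<open>k\<close> are integrated out one at a time; each step preserves log-concavity by
\<open>prekopa_leindler\<close>. The functions \<open>C\<close> and \<open>\<rho>\<close> record how the height and the support depend
on the remaining coordinate, and yield the bound by the volume of a cube that contains the slice.\<close>

lemma marginal_log_concave_PiM:
  fixes J :: "'i set" and f :: "('i \<Rightarrow> real) \<Rightarrow> ennreal" and \<rho> :: "real \<Rightarrow> real"
  assumes "finite J" "k \<notin> J"
    and "f \<in> borel_measurable (Pi\<^sub>M (insert k J) (\<lambda>_. lborel))"
    and "log_concave_on (insert k J) f"
    and "\<And>x. f x \<le> ennreal (C (x k))"
    and "\<And>x j. j \<in> J \<Longrightarrow> \<rho> (x k) < \<bar>x j\<bar> \<Longrightarrow> f x = 0"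
    and "\<And>s. 0 \<le> C s" and \<rho>: "\<And>s. 0 \<le> \<rho> s"
  shows "\<exists>\<psi>. \<psi> \<in> borel_measurable borel \<and> log_concave_line \<psi> \<and>
     (\<forall>s. \<psi> s \<le> ennreal (C s * (2 * \<rho> s) ^ card J)) \<and>
     (\<forall>g\<in>borel_measurable borel. (\<integral>\<^sup>+x. f x * g (x k) \<partial>Pi\<^sub>M (insert k J) (\<lambda>_. lborel)) = (\<integral>\<^sup>+s. \<psi> s * g s \<partial>lborel))"
  using assms(1-7)
proof (induction J arbitrary: f C rule: finite_induct)
  case empty
  interpret product_sigma_finite "\<lambda>_::'i. lborel :: real measure"
    by standard
  let ?e = "\<lambda>s. (\<lambda>_. undefined)(k := s)"
  have m: "?e \<in> measurable lborel (Pi\<^sub>M {k} (\<lambda>_. lborel))"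
    by (rule measurable_fun_upd[where J="{}"], simp, rule measurable_const, simp add: space_PiM, measurable)
  have ext: "?e s \<in> extensional {k}" for s by (auto simp: extensional_def)
  define \<psi> where "\<psi> s = f (?e s)" for s
  have \<psi>m: "\<psi> \<in> borel_measurable borel"
    using measurable_compose[OF m empty(2)] unfolding \<psi>_def[abs_def] by (simp only: measurable_lborel2)
  have lc: "log_concave_line \<psi>"
    unfolding log_concave_line_def
  proof (intro allI impI)
    fix x y l c :: real assume l: "0 < l" "l < 1"
    have "(\<lambda>i. (1 - l) * ?e x i + l * ?e y i) = ?e ((1 - l) * x + l * y)"
      by (simp add: fun_eq_iff algebra_simps)
    moreover have "min (f (?e x)) (ennreal (exp c) * f (?e y)) \<le> ennreal (exp (l * c)) * f (\<lambda>i. (1 - l) * ?e x i + l * ?e y i)"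
      using empty(3) ext ext l by (rule log_concave_onD)
    ultimately show "min (\<psi> x) (ennreal (exp c) * \<psi> y) \<le> ennreal (exp (l * c)) * \<psi> ((1 - l) * x + l * y)"
      unfolding \<psi>_def by (simp only:)
  qed
  have int: "(\<integral>\<^sup>+x. f x * g (x k) \<partial>Pi\<^sub>M {k} (\<lambda>_. lborel)) = (\<integral>\<^sup>+s. \<psi> s * g s \<partial>lborel)"
    if g: "g \<in> borel_measurable borel" for g
  proof -
    have "(\<integral>\<^sup>+x. f x * g (x k) \<partial>Pi\<^sub>M {k} (\<lambda>_. lborel)) = (\<integral>\<^sup>+x. \<psi> (x k) * g (x k) \<partial>Pi\<^sub>M {k} (\<lambda>_. lborel))"
    proof (rule nn_integral_cong)
      fix x :: "'i \<Rightarrow> real" assume "x \<in> space (Pi\<^sub>M {k} (\<lambda>_. lborel))"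
      then have "x = ?e (x k)"
        by (simp add: space_PiM PiE_def extensional_def fun_eq_iff)
      then have "f x = \<psi> (x k)" unfolding \<psi>_def by (rule arg_cong[where f=f])
      then show "f x * g (x k) = \<psi> (x k) * g (x k)" by simp
    qed
    also have "\<dots> = (\<integral>\<^sup>+s. \<psi> s * g s \<partial>lborel)"
      using g \<psi>m by (intro product_nn_integral_singleton[where f="\<lambda>s. \<psi> s * g s"]) simp
    finally show ?thesis .
  qed
  have "\<psi> s \<le> ennreal (C s * (2 * \<rho> s) ^ card {})" for s
    using empty(4)[of "?e s"] by (simp add: \<psi>_def fun_upd_def)
  then show ?case using \<psi>m lc int by blast
next
  case (insert i J)
  interpret product_sigma_finite "\<lambda>_::'i. lborel :: real measure"
    by standard
  have ik: "i \<noteq> k" "i \<notin> insert k J" "k \<notin> J" using insert by auto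
  have ins: "insert k (insert i J) = insert i (insert k J)" by auto
  have fm [measurable]: "f \<in> borel_measurable (Pi\<^sub>M (insert i (insert k J)) (\<lambda>_. lborel))"
    using insert.prems(2) by (simp add: ins)
  have fl: "log_concave_on (insert i (insert k J)) f"
    using insert.prems(3) by (simp add: ins)
  define F where "F x = (\<integral>\<^sup>+t. f (x(i := t)) \<partial>lborel)" for x
  have Fm: "F \<in> borel_measurable (Pi\<^sub>M (insert k J) (\<lambda>_. lborel))"
    unfolding F_def by measurable
  have slice: "(\<lambda>t. f (x(i := t))) \<in> borel_measurable borel" if "x \<in> extensional (insert k J)" for x
  proof -
    have "(\<lambda>t. x(i := t)) \<in> measurable lborel (Pi\<^sub>M (insert i (insert k J)) (\<lambda>_. lborel))"
      using that by (intro measurable_fun_upd[where J="insert k J"]) (auto simp: space_PiM PiE_def)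
    from measurable_compose[OF this fm] show ?thesis by simp
  qed
  have fb: "f (x(i := t)) \<le> ennreal (C (x k))" for x t
    using insert.prems(4)[of "x(i := t)"] ik by (simp add: fun_upd_def)
  have fz: "f (x(i := t)) = 0" if "\<rho> (x k) < \<bar>t\<bar>" for x t
    using insert.prems(5)[of i "x(i := t)"] ik that by (simp add: fun_upd_def)
  have Fb: "F x \<le> ennreal (C (x k) * (2 * \<rho> (x k)))" for x
  proof -
    have "F x \<le> (\<integral>\<^sup>+t. ennreal (C (x k)) * indicator {- \<rho> (x k)..\<rho> (x k)} t \<partial>lborel)"
      unfolding F_def
    proof (rule nn_integral_mono)
      fix t :: real
      show "f (x(i := t)) \<le> ennreal (C (x k)) * indicator {- \<rho> (x k)..\<rho> (x k)} t"
        using fb[of x t] fz[of x t] by (cases "\<rho> (x k) < \<bar>t\<bar>") (auto simp: indicator_def)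
    qed
    also have "\<dots> = ennreal (C (x k)) * ennreal (2 * \<rho> (x k))"
      using \<rho>[of "x k"] by (simp add: nn_integral_cmult)
    also have "\<dots> = ennreal (C (x k) * (2 * \<rho> (x k)))"
      using insert.prems(6) \<rho> by (simp add: ennreal_mult)
    finally show ?thesis .
  qed
  have Fl: "log_concave_on (insert k J) F"
    unfolding log_concave_on_def
  proof (intro ballI allI impI)
    fix x y :: "'i \<Rightarrow> real" and l c :: real
    assume x: "x \<in> extensional (insert k J)" and y: "y \<in> extensional (insert k J)" and l: "0 < l" "l < 1"
    let ?z = "\<lambda>j. (1 - l) * x j + l * y j"
    have z: "?z \<in> extensional (insert k J)"
      using x y by (auto simp: extensional_def algebra_simps)
    show "min (F x) (ennreal (exp c) * F y) \<le> ennreal (exp (l * c)) * F ?z"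
      unfolding F_def
    proof (rule prekopa_leindler[where R="max (\<rho> (x k)) (\<rho> (y k))" and C="max (C (x k)) (C (y k))"])
      show "(\<lambda>t. f (x(i := t))) \<in> borel_measurable borel" "(\<lambda>t. f (y(i := t))) \<in> borel_measurable borel"
        "(\<lambda>t. f (?z(i := t))) \<in> borel_measurable borel"
        using slice x y z by blast+
      show "convex {t. u < f (x(i := t))}" "convex {t. u < f (y(i := t))}" for u
        using convex_superlevel_slice[OF fl] x y by blast+
      show "f (x(i := t)) = 0" "f (y(i := t)) = 0" if "max (\<rho> (x k)) (\<rho> (y k)) < \<bar>t\<bar>" for t
        using fz that by auto
      show "f (x(i := t)) \<le> ennreal (max (C (x k)) (C (y k)))" for t
        using fb[of x t] by (rule order_trans) (simp add: ennreal_leI)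
      show "f (y(i := t)) \<le> ennreal (max (C (x k)) (C (y k)))" for t
        using fb[of y t] by (rule order_trans) (simp add: ennreal_leI)
      show "f (?z(i := t)) < \<infinity>" for t
        using fb[of ?z t] by (simp add: le_less_trans)
      fix s t c
      have e: "x(i := s) \<in> extensional (insert i (insert k J))" "y(i := t) \<in> extensional (insert i (insert k J))"
        using x y by (auto simp: extensional_def)
      show "min (f (x(i := s))) (ennreal (exp c) * f (y(i := t))) \<le> ennreal (exp (l * c)) * f (?z(i := (1 - l) * s + l * t))"
        using fl e l unfolding log_concave_on_def fun_upd_combination[symmetric] by blast
    qed (use l in auto)
  qed
  have Fz: "F x = 0" if "j \<in> J" "\<rho> (x k) < \<bar>x j\<bar>" for x j
  proof -
    have "j \<noteq> i" using that insert.hyps by auto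
    then have "f (x(i := t)) = 0" for t
      using insert.prems(5)[of j "x(i := t)"] that ik insert.hyps by (auto simp: fun_upd_def)
    then show ?thesis by (simp add: F_def)
  qed
  have "0 \<le> C s * (2 * \<rho> s)" for s using insert.prems(6) \<rho> by simp
  with ik(3) Fm Fl Fb have "\<exists>\<psi>. \<psi> \<in> borel_measurable borel \<and> log_concave_line \<psi> \<and>
     (\<forall>s. \<psi> s \<le> ennreal (C s * (2 * \<rho> s) * (2 * \<rho> s) ^ card J)) \<and>
     (\<forall>g\<in>borel_measurable borel. (\<integral>\<^sup>+x. F x * g (x k) \<partial>Pi\<^sub>M (insert k J) (\<lambda>_. lborel)) = (\<integral>\<^sup>+s. \<psi> s * g s \<partial>lborel))"
    by (intro insert.IH[of F "\<lambda>s. C s * (2 * \<rho> s)"]) (use Fz in blast)+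
  then obtain \<psi> where
    [measurable]: "\<psi> \<in> borel_measurable borel" and \<psi>: "log_concave_line \<psi>"
     "\<And>s. \<psi> s \<le> ennreal (C s * (2 * \<rho> s) * (2 * \<rho> s) ^ card J)"
     "\<And>g. g \<in> borel_measurable borel \<Longrightarrow> (\<integral>\<^sup>+x. F x * g (x k) \<partial>Pi\<^sub>M (insert k J) (\<lambda>_. lborel)) = (\<integral>\<^sup>+s. \<psi> s * g s \<partial>lborel)"
    by blast
  have "(\<integral>\<^sup>+x. f x * g (x k) \<partial>Pi\<^sub>M (insert k (insert i J)) (\<lambda>_. lborel)) = (\<integral>\<^sup>+s. \<psi> s * g s \<partial>lborel)"
    if g [measurable]: "g \<in> borel_measurable borel" for g
  proof -
    have "(\<integral>\<^sup>+x. f x * g (x k) \<partial>Pi\<^sub>M (insert k (insert i J)) (\<lambda>_. lborel))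
        = (\<integral>\<^sup>+x. \<integral>\<^sup>+t. f (x(i := t)) * g ((x(i := t)) k) \<partial>lborel \<partial>Pi\<^sub>M (insert k J) (\<lambda>_. lborel))"
      unfolding ins using ik insert.hyps by (intro product_nn_integral_insert) auto
    also have "\<dots> = (\<integral>\<^sup>+x. F x * g (x k) \<partial>Pi\<^sub>M (insert k J) (\<lambda>_. lborel))"
    proof (rule nn_integral_cong)
      fix x :: "'i \<Rightarrow> real" assume "x \<in> space (Pi\<^sub>M (insert k J) (\<lambda>_. lborel))"
      then have "x \<in> extensional (insert k J)" by (auto simp: space_PiM PiE_def)
      then show "(\<integral>\<^sup>+t. f (x(i := t)) * g ((x(i := t)) k) \<partial>lborel) = F x * g (x k)"
        unfolding F_def using ik slice by (subst nn_integral_multc[symmetric]) auto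
    qed
    also have "\<dots> = (\<integral>\<^sup>+s. \<psi> s * g s \<partial>lborel)" by (rule \<psi>(3)) simp
    finally show ?thesis .
  qed
  moreover have "\<psi> s \<le> ennreal (C s * (2 * \<rho> s) ^ card (insert i J))" for s
    using \<psi>(2)[of s] insert.hyps by (simp add: mult.assoc)
  ultimately show ?case
    using \<psi>(1) \<open>\<psi> \<in> borel_measurable borel\<close> by blast
qed

text \<open>The slice at height \<open>s\<close> of a body in the ball of radius \<open>R\<close> lies in a ball of radius
\<open>sqrt (R\<^sup>2 - s\<^sup>2)\<close>, hence in a cube. That the bound vanishes at \<open>s = R\<close> when \<open>d \<ge> 2\<close> is what makes
\<open>variance_less_of_ball\<close> strict.\<close>

lemma marginal_density_basis:
  fixes K :: "'a::euclidean_space set"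
  assumes K: "compact K" "convex K" "K \<subseteq> cball 0 R" and b: "b \<in> Basis"
  shows "\<exists>\<psi>. \<psi> \<in> borel_measurable borel \<and> log_concave_line \<psi> \<and>
     (\<forall>s. \<psi> s \<le> ennreal (indicator {-R..R} s * (2 * sqrt (max 0 (R\<^sup>2 - s\<^sup>2))) ^ (DIM('a) - 1))) \<and>
     (\<forall>g\<in>borel_measurable borel. (\<integral>\<^sup>+x. g (x \<bullet> b) \<partial>lborel_on K) = (\<integral>\<^sup>+s. \<psi> s * g s \<partial>lborel))"
proof -
  have [measurable]: "K \<in> sets borel" using K by (auto intro: borel_compact)
  define E where "E x = (\<Sum>c\<in>Basis. x c *\<^sub>R c)" for x :: "'a \<Rightarrow> real"
  have Eb: "E x \<bullet> c = x c" if "c \<in> Basis" for x c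
    using that unfolding E_def by (simp add: inner_sum_left inner_Basis if_distrib cong: if_cong)
  have Em [measurable]: "E \<in> measurable (Pi\<^sub>M Basis (\<lambda>_. lborel)) borel"
    unfolding E_def by measurable
  define f where "f x = (indicator K (E x) :: ennreal)" for x
  define \<rho> where "\<rho> s = sqrt (max 0 (R\<^sup>2 - s\<^sup>2))" for s
  let ?J = "Basis - {b}"
  have ins: "insert b ?J = Basis" using b by auto
  have "\<exists>\<psi>. \<psi> \<in> borel_measurable borel \<and> log_concave_line \<psi> \<and>
     (\<forall>s. \<psi> s \<le> ennreal (indicator {-R..R} s * (2 * \<rho> s) ^ card ?J)) \<and>
     (\<forall>g\<in>borel_measurable borel. (\<integral>\<^sup>+x. f x * g (x b) \<partial>Pi\<^sub>M (insert b ?J) (\<lambda>_. lborel)) = (\<integral>\<^sup>+s. \<psi> s * g s \<partial>lborel))"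
  proof (rule marginal_log_concave_PiM)
    show "f \<in> borel_measurable (Pi\<^sub>M (insert b ?J) (\<lambda>_. lborel))"
      unfolding ins f_def by measurable
    show "log_concave_on (insert b ?J) f"
      unfolding log_concave_on_def
    proof (intro ballI allI impI)
      fix x y :: "'a \<Rightarrow> real" and l c :: real assume l: "0 < l" "l < 1"
      have "E (\<lambda>i. (1 - l) * x i + l * y i) = (1 - l) *\<^sub>R E x + l *\<^sub>R E y"
        unfolding E_def by (simp add: scaleR_sum_right sum.distrib[symmetric] scaleR_left_distrib)
      then have mem: "E (\<lambda>i. (1 - l) * x i + l * y i) \<in> K" if "E x \<in> K" "E y \<in> K"
        using that l convexD[OF K(2), of "E x" "E y" "1 - l" l] by simp
      have "min 1 (exp c) \<le> exp (l * c)"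
      proof (cases "c \<ge> 0")
        case True
        then have "0 \<le> l * c" using l by simp
        then show ?thesis by (simp add: min_le_iff_disj)
      next
        case False
        then have "c \<le> l * c" using l mult_right_mono_neg[of l 1 c] by simp
        then show ?thesis by (simp add: min_le_iff_disj)
      qed
      then have "ennreal (min 1 (exp c)) \<le> ennreal (exp (l * c))" by (rule ennreal_leI)
      then have "min 1 (ennreal (exp c)) \<le> ennreal (exp (l * c))"
        by (cases "1 \<le> exp c") (auto simp: min_def ennreal_leI)
      then show "min (f x) (ennreal (exp c) * f y) \<le> ennreal (exp (l * c)) * f (\<lambda>i. (1 - l) * x i + l * y i)"
        using mem by (auto simp: f_def indicator_def)
    qed
    have sq: "(x b)\<^sup>2 + (x j)\<^sup>2 \<le> R\<^sup>2" if "E x \<in> K" "j \<in> ?J" for x j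
    proof -
      have "norm (E x) \<le> R" using that K(3) by auto
      then have "(norm (E x))\<^sup>2 \<le> R\<^sup>2" by (simp add: power_mono)
      moreover have "(norm (E x))\<^sup>2 = (\<Sum>c\<in>Basis. (x c)\<^sup>2)"
        unfolding power2_norm_eq_inner euclidean_inner[of "E x" "E x"] by (simp add: Eb power2_eq_square)
      moreover have "(\<Sum>c\<in>{b, j}. (x c)\<^sup>2) \<le> (\<Sum>c\<in>Basis. (x c)\<^sup>2)"
        using b that by (intro sum_mono2) auto
      ultimately show ?thesis using that by auto
    qed
    have sb: "\<bar>x b\<bar> \<le> R" if "E x \<in> K" for x
    proof -
      have "\<bar>E x \<bullet> b\<bar> \<le> norm (E x)" using b by (rule Basis_le_norm)
      then show ?thesis using that K(3) Eb[OF b] by fastforce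
    qed
    show "f x \<le> ennreal (indicator {-R..R} (x b))" for x
      using sb[of x] by (auto simp: f_def indicator_def)
    show "f x = 0" if "j \<in> ?J" "\<rho> (x b) < \<bar>x j\<bar>" for x j
    proof (rule ccontr)
      assume "f x \<noteq> 0"
      then have "E x \<in> K" by (auto simp: f_def indicator_def split: if_splits)
      from sq[OF this that(1)] have "(x j)\<^sup>2 \<le> max 0 (R\<^sup>2 - (x b)\<^sup>2)" by simp
      then have "sqrt ((x j)\<^sup>2) \<le> \<rho> (x b)" unfolding \<rho>_def by (rule real_sqrt_le_mono)
      then show False using that by simp
    qed
  qed (auto simp: \<rho>_def)
  then obtain \<psi> where [measurable]: "\<psi> \<in> borel_measurable borel" and \<psi>: "log_concave_line \<psi>"
     "\<And>s. \<psi> s \<le> ennreal (indicator {-R..R} s * (2 * \<rho> s) ^ card ?J)"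
     "\<And>g. g \<in> borel_measurable borel \<Longrightarrow> (\<integral>\<^sup>+x. f x * g (x b) \<partial>Pi\<^sub>M Basis (\<lambda>_. lborel)) = (\<integral>\<^sup>+s. \<psi> s * g s \<partial>lborel)"
    unfolding ins by blast
  have "(\<integral>\<^sup>+x. g (x \<bullet> b) \<partial>lborel_on K) = (\<integral>\<^sup>+s. \<psi> s * g s \<partial>lborel)" if [measurable]: "g \<in> borel_measurable borel" for g
  proof -
    have "(\<integral>\<^sup>+x. g (x \<bullet> b) \<partial>lborel_on K) = (\<integral>\<^sup>+x. g (x \<bullet> b) * indicator K x \<partial>lborel)"
      by (rule nn_integral_lborel_on) auto
    also have "\<dots> = (\<integral>\<^sup>+x. f x * g (x b) \<partial>Pi\<^sub>M Basis (\<lambda>_. lborel))"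
    proof -
      have "(\<integral>\<^sup>+x. h x \<partial>lborel) = (\<integral>\<^sup>+x. h (E x) \<partial>Pi\<^sub>M Basis (\<lambda>_. lborel))"
        if [measurable]: "h \<in> borel_measurable borel" for h :: "'a \<Rightarrow> ennreal"
        unfolding lborel_eq[where 'a='a] E_def[symmetric] by (subst nn_integral_distr) auto
      from this[of "\<lambda>x. g (x \<bullet> b) * indicator K x"] show ?thesis
        using b by (simp add: f_def Eb mult.commute)
    qed
    also have "\<dots> = (\<integral>\<^sup>+s. \<psi> s * g s \<partial>lborel)" by (rule \<psi>(3)) simp
    finally show ?thesis .
  qed
  moreover have "card ?J = DIM('a) - 1" using b by simp
  ultimately show ?thesis
    using \<psi>(1,2) unfolding \<rho>_def by (intro exI[of _ \<psi>]) auto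
qed

lemma marginal_density:
  fixes K :: "'a::euclidean_space set"
  assumes K: "compact K" "convex K" "K \<subseteq> cball 0 R" and v: "norm v = 1"
  obtains \<psi> where "\<psi> \<in> borel_measurable borel" "log_concave_line \<psi>"
     "\<And>s. \<psi> s \<le> ennreal (indicator {-R..R} s * (2 * sqrt (max 0 (R\<^sup>2 - s\<^sup>2))) ^ (DIM('a) - 1))"
     "\<And>g. g \<in> borel_measurable borel \<Longrightarrow> (\<integral>\<^sup>+x. g (v \<bullet> x) \<partial>lborel_on K) = (\<integral>\<^sup>+s. \<psi> s * g s \<partial>lborel)"
proof -
  obtain b :: 'a where b: "b \<in> Basis" using nonempty_Basis by blast
  obtain T where T: "orthogonal_transformation T" "T v = b"
    using exists_orthogonal_transformation[OF v, of b] b by (metis norm_Basis)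
  have lin: "linear T" using T by (simp add: orthogonal_transformation_linear)
  have TK: "compact (T ` K)" "convex (T ` K)" "T ` K \<subseteq> cball 0 R"
  proof -
    show "compact (T ` K)"
      using K(1) lin by (intro compact_continuous_image linear_continuous_on) (simp_all add: linear_linear)
    show "convex (T ` K)" using lin K(2) by (rule convex_linear_image)
    show "T ` K \<subseteq> cball 0 R" using K(3) T(1) by (auto simp: orthogonal_transformation_norm)
  qed
  obtain \<psi> where \<psi>: "\<psi> \<in> borel_measurable borel" "log_concave_line \<psi>"
     "\<And>s. \<psi> s \<le> ennreal (indicator {-R..R} s * (2 * sqrt (max 0 (R\<^sup>2 - s\<^sup>2))) ^ (DIM('a) - 1))"
     "\<And>g. g \<in> borel_measurable borel \<Longrightarrow> (\<integral>\<^sup>+x. g (x \<bullet> b) \<partial>lborel_on (T ` K)) = (\<integral>\<^sup>+s. \<psi> s * g s \<partial>lborel)"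
    using marginal_density_basis[OF TK b] by blast
  have "(\<integral>\<^sup>+x. g (v \<bullet> x) \<partial>lborel_on K) = (\<integral>\<^sup>+s. \<psi> s * g s \<partial>lborel)" if [measurable]: "g \<in> borel_measurable borel" for g
  proof -
    have "v \<bullet> x = T x \<bullet> b" for x
      using T by (metis inner_commute orthogonal_transformation_def)
    then have "(\<integral>\<^sup>+x. g (v \<bullet> x) \<partial>lborel_on K) = (\<integral>\<^sup>+x. g (T x \<bullet> b) \<partial>lborel_on K)" by simp
    also have "\<dots> = (\<integral>\<^sup>+x. g (x \<bullet> b) \<partial>lborel_on (T ` K))"
      by (rule nn_integral_lborel_on_isometry[OF T(1) K(1), of "\<lambda>x. g (x \<bullet> b)"]) simp
    finally show ?thesis using \<psi>(4) by simp
  qed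
  then show thesis using that \<psi>(1-3) by blast
qed

section \<open>The upper variance bound for convex bodies in a slab\<close>

text \<open>The third derivative of the difference of the two sides is nonnegative, and the difference and its first two
derivatives vanish at \<open>0\<close>. Equivalently \<open>x / sinh x \<ge> 1 - x\<^sup>2 / 6\<close>.\<close>

lemma sinh_upper_bound:
  fixes x :: real
  assumes "0 \<le> x"
  shows "(6 - x\<^sup>2) * sinh x \<le> 6 * x"
proof -
  have mono0: "0 \<le> f x" if "f 0 = 0" "\<And>t. 0 \<le> t \<Longrightarrow> (f has_real_derivative f' t) (at t)" "\<And>t. 0 \<le> t \<Longrightarrow> 0 \<le> f' t" "0 \<le> x"
    for f f' :: "real \<Rightarrow> real" and x :: real
    using DERIV_nonneg_imp_nondecreasing[of 0 x f] that by (metis order_refl)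
  define f where "f = (\<lambda>t::real. 6 * t - (6 - t\<^sup>2) * sinh t)"
  define f1 where "f1 = (\<lambda>t::real. 6 + 2 * t * sinh t - (6 - t\<^sup>2) * cosh t)"
  define f2 where "f2 = (\<lambda>t::real. 4 * t * cosh t + (t\<^sup>2 - 4) * sinh t)"
  define f3 where "f3 = (\<lambda>t::real. 6 * t * sinh t + t\<^sup>2 * cosh t)"
  have d2: "(f2 has_real_derivative f3 t) (at t)" for t
    unfolding f2_def f3_def by (auto intro!: derivative_eq_intros simp: algebra_simps power2_eq_square)
  have d1: "(f1 has_real_derivative f2 t) (at t)" for t
    unfolding f1_def f2_def by (auto intro!: derivative_eq_intros simp: algebra_simps power2_eq_square)
  have d0: "(f has_real_derivative f1 t) (at t)" for t
    unfolding f_def f1_def by (auto intro!: derivative_eq_intros simp: algebra_simps power2_eq_square)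
  have n3: "0 \<le> f3 t" if "0 \<le> t" for t
    using that by (simp add: f3_def)
  have n2: "0 \<le> f2 t" if "0 \<le> t" for t
    using d2 n3 that by (intro mono0[of f2 f3]) (auto simp: f2_def)
  have n1: "0 \<le> f1 t" if "0 \<le> t" for t
    using d1 n2 that by (intro mono0[of f1 f2]) (auto simp: f1_def)
  have "0 \<le> f x"
    using d0 n1 assms by (intro mono0[of f f1]) (auto simp: f_def)
  then show ?thesis by (simp add: f_def)
qed

text \<open>Equivalently \<open>1 - x\<^sup>2 / sinh\<^sup>2 x \<le> x\<^sup>2 / 3\<close>; this is the variance bound for truncated exponentials
in disguise.\<close>

lemma sinh_square_bound:
  fixes x :: real
  shows "(sinh x)\<^sup>2 * (1 - x\<^sup>2 / 3) \<le> x\<^sup>2"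
proof -
  have pos: "(sinh x)\<^sup>2 * (1 - x\<^sup>2 / 3) \<le> x\<^sup>2" if x: "0 \<le> x" for x :: real
  proof (cases "x\<^sup>2 < 3")
    case False
    then have "(sinh x)\<^sup>2 * (1 - x\<^sup>2 / 3) \<le> 0" by (intro mult_nonneg_nonpos) auto
    then show ?thesis by (smt (verit) zero_le_power2)
  next
    case True
    have "0 \<le> sinh x" using x by simp
    then have "((6 - x\<^sup>2) * sinh x)\<^sup>2 \<le> (6 * x)\<^sup>2"
      using sinh_upper_bound[OF x] True by (intro power_mono) auto
    then have 1: "(6 - x\<^sup>2)\<^sup>2 * (sinh x)\<^sup>2 \<le> 36 * x\<^sup>2" by (simp add: power_mult_distrib)
    have "36 * (1 - x\<^sup>2 / 3) \<le> (6 - x\<^sup>2)\<^sup>2"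
    proof -
      have "(6 - x\<^sup>2)\<^sup>2 = 36 * (1 - x\<^sup>2 / 3) + (x\<^sup>2)\<^sup>2" by (simp add: power2_eq_square algebra_simps)
      then show ?thesis by simp
    qed
    then have "36 * (1 - x\<^sup>2 / 3) * (sinh x)\<^sup>2 \<le> (6 - x\<^sup>2)\<^sup>2 * (sinh x)\<^sup>2"
      by (rule mult_right_mono) simp
    then show ?thesis using 1 by (simp add: algebra_simps)
  qed
  show ?thesis
  proof (cases "0 \<le> x")
    case False
    then show ?thesis using pos[of "- x"] by simp
  qed (rule pos)
qed

lemma lborel_on_interval_FTC:
  fixes f F :: "real \<Rightarrow> real"
  assumes "a \<le> b" and f: "continuous_on UNIV f" and F: "\<And>s. (F has_real_derivative f s) (at s)"
  shows "(\<integral>s. f s \<partial>lborel_on {a..b}) = F b - F a"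
proof -
  have "(\<integral>s. f s \<partial>lborel_on {a..b}) = integral {a..b} f"
    using f by (intro integral_lborel_on) (auto intro: borel_measurable_continuous_onI continuous_on_subset)
  moreover have "(f has_integral F b - F a) {a..b}"
    using assms by (intro fundamental_theorem_of_calculus)
      (auto simp: has_real_derivative_iff_has_vector_derivative[symmetric] intro: has_field_derivative_at_within)
  ultimately show ?thesis by (simp add: integral_unique)
qed

lemma exp_moments:
  fixes k a b :: real
  assumes ab: "0 \<le> a" "0 \<le> b"
  shows "k * (\<integral>s. exp (k * s) \<partial>lborel_on {-a..b}) = exp (k * b) - exp (- (k * a))"
    and "k * (\<integral>s. s * exp (k * s) \<partial>lborel_on {-a..b}) = b * exp (k * b) + a * exp (- (k * a)) - (\<integral>s. exp (k * s) \<partial>lborel_on {-a..b})"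
    and "k * (\<integral>s. s\<^sup>2 * exp (k * s) \<partial>lborel_on {-a..b}) = b\<^sup>2 * exp (k * b) - a\<^sup>2 * exp (- (k * a)) - 2 * (\<integral>s. s * exp (k * s) \<partial>lborel_on {-a..b})"
proof -
  have le: "-a \<le> b" using ab by simp
  have int: "integrable (lborel_on {-a..b}) f" if "continuous_on UNIV f" for f :: "real \<Rightarrow> real"
    using that by (intro integrable_lborel_on) (auto intro: borel_measurable_continuous_onI continuous_on_subset)
  have "(\<integral>s. k * exp (k * s) \<partial>lborel_on {-a..b}) = exp (k * b) - exp (k * (- a))"
    by (rule lborel_on_interval_FTC[OF le]) (auto intro!: derivative_eq_intros continuous_intros)
  then show "k * (\<integral>s. exp (k * s) \<partial>lborel_on {-a..b}) = exp (k * b) - exp (- (k * a))" by simp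
  have "(\<integral>s. exp (k * s) + k * (s * exp (k * s)) \<partial>lborel_on {-a..b}) = b * exp (k * b) - (-a) * exp (k * (- a))"
    by (rule lborel_on_interval_FTC[OF le]) (auto intro!: derivative_eq_intros continuous_intros simp: algebra_simps)
  moreover have "(\<integral>s. exp (k * s) + k * (s * exp (k * s)) \<partial>lborel_on {-a..b})
     = (\<integral>s. exp (k * s) \<partial>lborel_on {-a..b}) + k * (\<integral>s. s * exp (k * s) \<partial>lborel_on {-a..b})"
    by (subst Bochner_Integration.integral_add) (auto intro!: int continuous_intros)
  ultimately show "k * (\<integral>s. s * exp (k * s) \<partial>lborel_on {-a..b}) = b * exp (k * b) + a * exp (- (k * a)) - (\<integral>s. exp (k * s) \<partial>lborel_on {-a..b})"
    by simp
  have "(\<integral>s. 2 * (s * exp (k * s)) + k * (s\<^sup>2 * exp (k * s)) \<partial>lborel_on {-a..b}) = b\<^sup>2 * exp (k * b) - (-a)\<^sup>2 * exp (k * (- a))"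
    by (rule lborel_on_interval_FTC[OF le]) (auto intro!: derivative_eq_intros continuous_intros simp: algebra_simps power2_eq_square)
  moreover have "(\<integral>s. 2 * (s * exp (k * s)) + k * (s\<^sup>2 * exp (k * s)) \<partial>lborel_on {-a..b})
     = 2 * (\<integral>s. s * exp (k * s) \<partial>lborel_on {-a..b}) + k * (\<integral>s. s\<^sup>2 * exp (k * s) \<partial>lborel_on {-a..b})"
    by (subst Bochner_Integration.integral_add) (auto intro!: int continuous_intros)
  ultimately show "k * (\<integral>s. s\<^sup>2 * exp (k * s) \<partial>lborel_on {-a..b}) = b\<^sup>2 * exp (k * b) - a\<^sup>2 * exp (- (k * a)) - 2 * (\<integral>s. s * exp (k * s) \<partial>lborel_on {-a..b})"
    by simp
qed

text \<open>The first moment is continuous in \<open>k\<close>. Integration by parts evaluates its sign at \<open>k = 1 / b\<close> and at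
\<open>k = - 1 / a\<close>, where one of its two terms vanishes.\<close>

lemma centering_tilt_exists:
  fixes a b :: real
  assumes ab: "0 < a" "0 < b"
  obtains k where "(\<integral>s. s * exp (k * s) \<partial>lborel_on {-a..b}) = 0"
proof -
  define T where "T k = (\<integral>s. s * exp (k * s) \<partial>lborel_on {-a..b})" for k
  have T_eq: "T k = integral (cbox (-a) b) (\<lambda>s. s * exp (k * s))" for k
    unfolding T_def by (subst integral_lborel_on) (auto intro!: continuous_intros)
  have "continuous_on UNIV (\<lambda>k. integral (cbox (-a) b) (\<lambda>s. s * exp (k * s)))"
    by (rule integral_continuous_on_param) (auto intro!: continuous_intros simp: case_prod_unfold)
  then have cont: "continuous_on UNIV T" unfolding T_eq[abs_def] .
  have T2: "k\<^sup>2 * T k = exp (k * b) * (k * b - 1) + exp (- (k * a)) * (k * a + 1)" for k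
  proof -
    have kT: "k * T k = b * exp (k * b) + a * exp (- (k * a)) - (\<integral>s. exp (k * s) \<partial>lborel_on {-a..b})"
      using exp_moments(2)[of a b k] ab unfolding T_def by simp
    have "k\<^sup>2 * T k = k * (k * T k)" by (simp add: power2_eq_square)
    also have "\<dots> = k * (b * exp (k * b) + a * exp (- (k * a))) - k * (\<integral>s. exp (k * s) \<partial>lborel_on {-a..b})"
      unfolding kT by (rule right_diff_distrib)
    also have "\<dots> = k * (b * exp (k * b) + a * exp (- (k * a))) - (exp (k * b) - exp (- (k * a)))"
      using exp_moments(1)[of a b k] ab by simp
    finally show ?thesis by (simp add: algebra_simps)
  qed
  have "0 \<le> (1 / b)\<^sup>2 * T (1 / b)" unfolding T2 using ab by simp
  then have "0 \<le> T (1 / b)" using ab by (simp add: zero_le_mult_iff)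
  moreover have "(- (1 / a))\<^sup>2 * T (- (1 / a)) \<le> 0"
  proof -
    have "exp (- (b / a)) * (- (b / a) - 1) \<le> 0"
      by (rule mult_nonneg_nonpos) (use ab in \<open>auto simp: field_simps\<close>)
    then show ?thesis unfolding T2 using ab by simp
  qed
  then have "T (- (1 / a)) \<le> 0" using ab by (simp add: mult_le_0_iff)
  moreover have "- (1 / a) \<le> 1 / b" using ab by (smt (verit) divide_pos_pos)
  ultimately obtain k where "T k = 0"
    using IVT'[of T "- (1 / a)" 0 "1 / b"] cont continuous_on_subset by blast
  then show thesis using that unfolding T_def by blast
qed

text \<open>With \<open>x = k (a + b) / 2\<close>, the vanishing first moment says that \<open>\<delta> = k (b - a) / 2\<close> equals
\<open>1 - x coth x\<close>, and the variance becomes \<open>(1 - x\<^sup>2 / sinh\<^sup>2 x) / k\<^sup>2\<close>. So \<open>sinh_square_bound\<close> applies.\<close>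

lemma truncated_exponential_variance:
  fixes a b k :: real
  assumes ab: "0 < a" "0 < b" and T: "(\<integral>s. s * exp (k * s) \<partial>lborel_on {-a..b}) = 0"
  shows "(\<integral>s. s\<^sup>2 * exp (k * s) \<partial>lborel_on {-a..b}) \<le> ((a + b) / 2)\<^sup>2 / 3 * (\<integral>s. exp (k * s) \<partial>lborel_on {-a..b})"
proof (cases "k = 0")
  case True
  have le: "-a \<le> b" using ab by simp
  have "(\<integral>s. s \<partial>lborel_on {-a..b}) = b\<^sup>2 / 2 - (-a)\<^sup>2 / 2"
    by (rule lborel_on_interval_FTC[OF le]) (auto intro!: derivative_eq_intros continuous_intros)
  with T True have "b\<^sup>2 = a\<^sup>2" by simp
  then have "b = a" using ab by (simp add: power2_eq_iff)
  have "(\<integral>s. s\<^sup>2 \<partial>lborel_on {-a..b}) = b ^ 3 / 3 - (-a) ^ 3 / 3"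
    by (rule lborel_on_interval_FTC[OF le]) (auto intro!: derivative_eq_intros continuous_intros)
  moreover have "(\<integral>s. 1 \<partial>lborel_on {-a..b}) = b - (-a)"
    by (rule lborel_on_interval_FTC[OF le]) (auto intro!: derivative_eq_intros continuous_intros)
  ultimately show ?thesis using True \<open>b = a\<close> by (simp add: power2_eq_square power3_eq_cube)
next
  case False
  define E where "E = (\<integral>s. exp (k * s) \<partial>lborel_on {-a..b})"
  define S where "S = (\<integral>s. s\<^sup>2 * exp (k * s) \<partial>lborel_on {-a..b})"
  define u where "u = exp (k * b)"
  define w where "w = exp (- (k * a))"
  have ab': "0 \<le> a" "0 \<le> b" using ab by auto
  have kE: "k * E = u - w" and Ebu: "E = b * u + a * w" and kS: "k * S = b\<^sup>2 * u - a\<^sup>2 * w"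
    using exp_moments[OF ab', of k] T unfolding E_def S_def u_def w_def by simp_all
  have E0: "E \<ge> 0" unfolding Ebu u_def w_def using ab by simp
  define x where "x = k * (a + b) / 2"
  define \<delta> where "\<delta> = k * (b - a) / 2"
  have kb: "k * b = x + \<delta>" "k * a = x - \<delta>" by (simp_all add: x_def \<delta>_def field_simps)
  have x0: "x \<noteq> 0" using False ab by (simp add: x_def)
  have SE: "k\<^sup>2 * S = (x\<^sup>2 - \<delta>\<^sup>2 + 2 * \<delta>) * E"
  proof -
    have "k\<^sup>2 * S = k * (b\<^sup>2 * u - a\<^sup>2 * w)" using kS by (simp add: power2_eq_square)
    also have "\<dots> = (k * a) * b * (u - w) + k * (b - a) * (b * u + a * w)" by (simp add: algebra_simps power2_eq_square)
    also have "\<dots> = (k * a) * (k * b) * E + k * (b - a) * E" unfolding kE[symmetric] Ebu[symmetric] by simp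
    also have "k * (b - a) = 2 * \<delta>" by (simp add: \<delta>_def)
    also have "(k * a) * (k * b) * E + 2 * \<delta> * E = (x\<^sup>2 - \<delta>\<^sup>2 + 2 * \<delta>) * E"
      unfolding kb by (simp add: algebra_simps power2_eq_square)
    finally show ?thesis .
  qed
  have "(1 - \<delta>) * sinh x = x * cosh x"
  proof -
    have "k * (b * u + a * w) = u - w" using kE Ebu by simp
    then have "(x + \<delta>) * u + (x - \<delta>) * w = u - w" unfolding kb[symmetric] by (simp add: algebra_simps)
    moreover have "u = exp \<delta> * exp x" "w = exp \<delta> * exp (- x)"
      unfolding u_def w_def kb by (simp_all add: exp_add[symmetric])
    ultimately have "exp \<delta> * ((x + \<delta>) * exp x + (x - \<delta>) * exp (- x)) = exp \<delta> * (exp x - exp (- x))"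
      by (simp add: algebra_simps)
    then have "(x + \<delta>) * exp x + (x - \<delta>) * exp (- x) = exp x - exp (- x)" by simp
    then show ?thesis by (simp add: sinh_field_def cosh_field_def field_simps)
  qed
  then have "(1 - \<delta>)\<^sup>2 * (sinh x)\<^sup>2 = x\<^sup>2 * (1 + (sinh x)\<^sup>2)"
    by (metis power_mult_distrib cosh_square_eq add.commute)
  moreover have "(sinh x)\<^sup>2 * (1 - x\<^sup>2 / 3) \<le> x\<^sup>2" by (rule sinh_square_bound)
  ultimately have "(1 + 2 * x\<^sup>2 / 3) * (sinh x)\<^sup>2 \<le> (1 - \<delta>)\<^sup>2 * (sinh x)\<^sup>2"
    by (simp add: algebra_simps)
  then have "1 + 2 * x\<^sup>2 / 3 \<le> (1 - \<delta>)\<^sup>2" using x0 by simp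
  then have "x\<^sup>2 - \<delta>\<^sup>2 + 2 * \<delta> \<le> x\<^sup>2 / 3" by (simp add: power2_eq_square algebra_simps)
  then have "k\<^sup>2 * S \<le> x\<^sup>2 / 3 * E" unfolding SE using E0 by (rule mult_right_mono)
  also have "\<dots> = k\<^sup>2 * (((a + b) / 2)\<^sup>2 / 3 * E)" by (simp add: x_def power2_eq_square)
  finally show ?thesis using False unfolding S_def E_def by simp
qed

text \<open>A convex set of reals is the set of points between its infimum and its supremum, up to end points. The
factored form of the conclusion is a quadratic polynomial that is nonpositive on the set and nonnegative off it.\<close>

lemma convex_real_sign_pattern:
  fixes S :: "real set"
  assumes S: "convex S" "S \<subseteq> {lo..hi}" and "lo \<le> hi"
  obtains s1 s2 where "s1 \<le> s2" "s2 \<le> hi" "\<And>s. s \<in> S \<Longrightarrow> (s - s1) * (s - s2) \<le> 0" "\<And>s. s \<notin> S \<Longrightarrow> 0 \<le> (s - s1) * (s - s2)"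
proof (cases "S = {}")
  case True
  then show thesis using that[of lo lo] assms(3) by simp
next
  case False
  have bdd: "bdd_below S" "bdd_above S" "bounded S"
    using S(2) by (meson bdd_below_Icc bdd_below_mono bdd_above_Icc bdd_above_mono bounded_closed_interval bounded_subset)+
  show thesis
  proof (rule that[of "Inf S" "Sup S"])
    show "Inf S \<le> Sup S" using False bdd by (intro cInf_le_cSup)
    show "Sup S \<le> hi" using False S(2) by (intro cSup_least) auto
    show "(s - Inf S) * (s - Sup S) \<le> 0" if "s \<in> S" for s
      using cInf_lower[OF that bdd(1)] cSup_upper[OF that bdd(2)] by (intro mult_nonneg_nonpos) auto
    show "0 \<le> (s - Inf S) * (s - Sup S)" if "s \<notin> S" for s
    proof (rule ccontr)
      assume "\<not> 0 \<le> (s - Inf S) * (s - Sup S)"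
      then have "Inf S < s" "s < Sup S"
        using \<open>Inf S \<le> Sup S\<close> by (auto simp: not_le mult_less_0_iff)
      define t where "t = (s - Inf S) / (Sup S - Inf S)"
      have t: "0 < t" "t < 1" "t * (Sup S - Inf S) = s - Inf S"
        using \<open>Inf S < s\<close> \<open>s < Sup S\<close> by (auto simp: t_def divide_simps)
      have "(1 - t) * Inf S + t * Sup S = s" using t(3) by (simp add: algebra_simps)
      then show False using convex_bounded_real_between[OF S(1) False bdd(3) t(1,2)] that by simp
    qed
  qed
qed

text \<open>The difference \<open>Q - w\<close> is nonnegative on an interval and nonpositive outside, so its product with the
quadratic polynomial \<open>(s - s1) (s - s2)\<close> of opposite sign pattern is nonpositive. As the moments of
order \<open>0\<close> and \<open>1\<close> agree, only the second moments survive in the integral of the product. A gap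
\<open>\<kappa>\<close> between \<open>Q\<close> and \<open>w\<close> on \<open>(hi, b]\<close> is kept as a quantitative gain.\<close>

lemma second_moment_comparison:
  fixes Q w :: "real \<Rightarrow> real" and a b hi \<kappa> :: real
  defines "U \<equiv> lborel_on {-a..b}"
  assumes ab: "-a \<le> hi" "hi \<le> b"
    and [measurable]: "Q \<in> borel_measurable borel" "w \<in> borel_measurable borel"
    and bd: "\<And>s. s \<in> {-a..b} \<Longrightarrow> \<bar>Q s\<bar> \<le> C" "\<And>s. s \<in> {-a..b} \<Longrightarrow> \<bar>w s\<bar> \<le> C"
    and conv: "convex {s\<in>{-a..b}. w s \<le> Q s}"
    and m0: "(\<integral>s. Q s \<partial>U) = (\<integral>s. w s \<partial>U)"
    and m1: "(\<integral>s. s * Q s \<partial>U) = (\<integral>s. s * w s \<partial>U)"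
    and gap: "0 \<le> \<kappa>" "\<And>s. hi < s \<Longrightarrow> s \<le> b \<Longrightarrow> Q s < w s \<and> Q s \<le> w s - \<kappa>"
  shows "(\<integral>s. s\<^sup>2 * Q s \<partial>U) \<le> (\<integral>s. s\<^sup>2 * w s \<partial>U) - \<kappa> * ((b - hi) / 2) ^ 3"
proof -
  interpret finite_measure U unfolding U_def by (rule finite_measure_lborel_on) simp
  let ?S = "{s\<in>{-a..b}. w s \<le> Q s}"
  have "?S \<subseteq> {-a..hi}"
  proof
    fix s assume s: "s \<in> ?S"
    then have "\<not> hi < s" using gap(2)[of s] by auto
    then show "s \<in> {-a..hi}" using s by auto
  qed
  then obtain s1 s2 where s12: "s1 \<le> s2" "s2 \<le> hi" "\<And>s. s \<in> ?S \<Longrightarrow> (s - s1) * (s - s2) \<le> 0" "\<And>s. s \<notin> ?S \<Longrightarrow> 0 \<le> (s - s1) * (s - s2)"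
    using convex_real_sign_pattern[OF conv, of "-a" hi] ab by blast
  \<comment> \<open>Beyond the midpoint both factors of the quadratic polynomial are at least \<open>(b - hi) / 2\<close>.\<close>
  let ?mid = "(hi + b) / 2"
  have pt: "(s - s1) * (s - s2) * (Q s - w s) \<le> - (\<kappa> * ((b - hi) / 2)\<^sup>2) * indicator {?mid<..b} s" if s: "s \<in> {-a..b}" for s
  proof (cases "s \<in> {?mid<..b}")
    case True
    then have hs: "hi < s" "s \<le> b" using ab by (auto simp: field_simps)
    have "(b - hi) / 2 \<le> s - s2" "(b - hi) / 2 \<le> s - s1" using True s12 by (auto simp: field_simps)
    then have "((b - hi) / 2)\<^sup>2 \<le> (s - s1) * (s - s2)"
      unfolding power2_eq_square using ab by (intro mult_mono) auto
    then have "((b - hi) / 2)\<^sup>2 * \<kappa> \<le> (s - s1) * (s - s2) * (w s - Q s)"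
      using gap(1) gap(2)[OF hs] by (intro mult_mono) (auto intro: order_trans[OF zero_le_power2])
    then show ?thesis using True by (simp add: algebra_simps)
  next
    case False
    have "(s - s1) * (s - s2) * (Q s - w s) \<le> 0"
    proof (cases "s \<in> ?S")
      case True
      then show ?thesis by (intro mult_nonpos_nonneg[OF s12(3)[OF True]]) auto
    next
      case False
      then show ?thesis using s by (intro mult_nonneg_nonpos[OF s12(4)[OF False]]) auto
    qed
    then show ?thesis using False by simp
  qed
  have meas_I: "{-a..b} \<in> sets borel" by simp
  have int: "integrable U (\<lambda>s. p s * f s)" if "f \<in> borel_measurable borel" "\<And>s. s \<in> {-a..b} \<Longrightarrow> \<bar>f s\<bar> \<le> C" "continuous_on UNIV p" for f p :: "real \<Rightarrow> real"
  proof -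
    have pm: "p \<in> borel_measurable borel" using that(3) by (rule borel_measurable_continuous_onI)
    have "compact (p ` {-a..b})" using that(3) by (intro compact_continuous_image) (auto intro: continuous_on_subset)
    then obtain B where B: "\<And>s. s \<in> {-a..b} \<Longrightarrow> \<bar>p s\<bar> \<le> B"
      by (metis compact_imp_bounded bounded_iff image_eqI real_norm_def)
    show ?thesis
    proof (rule integrable_const_bound[where B="B * C"])
      show "AE s in U. norm (p s * f s) \<le> B * C"
        unfolding U_def using meas_I
      proof (rule AE_lborel_on)
        fix s assume "s \<in> {-a..b}"
        then have "\<bar>p s\<bar> * \<bar>f s\<bar> \<le> B * C" using B that(2) by (intro mult_mono) (auto intro: order_trans[OF abs_ge_zero])
        then show "norm (p s * f s) \<le> B * C" by (simp add: abs_mult)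
      qed
      show "(\<lambda>s. p s * f s) \<in> borel_measurable U" unfolding U_def using pm that(1) by simp
    qed
  qed
  have c2: "continuous_on UNIV (\<lambda>s::real. s\<^sup>2)" "continuous_on UNIV (\<lambda>s::real. s)" "continuous_on UNIV (\<lambda>s::real. 1::real)"
    by (intro continuous_intros)+
  have iQ: "integrable U Q" "integrable U (\<lambda>s. s * Q s)" "integrable U (\<lambda>s. s\<^sup>2 * Q s)"
    using int[of Q "\<lambda>_. 1"] int[of Q "\<lambda>s. s"] int[of Q "\<lambda>s. s\<^sup>2"] bd(1) c2 by auto
  have iw: "integrable U w" "integrable U (\<lambda>s. s * w s)" "integrable U (\<lambda>s. s\<^sup>2 * w s)"
    using int[of w "\<lambda>_. 1"] int[of w "\<lambda>s. s"] int[of w "\<lambda>s. s\<^sup>2"] bd(2) c2 by auto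
  have eq: "(\<lambda>s. (s - s1) * (s - s2) * (Q s - w s)) = (\<lambda>s. (s\<^sup>2 * Q s - s\<^sup>2 * w s) - (s1 + s2) * (s * Q s - s * w s) + s1 * s2 * (Q s - w s))"
    by (auto simp: algebra_simps power2_eq_square)
  have "(\<integral>s. (s - s1) * (s - s2) * (Q s - w s) \<partial>U) \<le> (\<integral>s. - (\<kappa> * ((b - hi) / 2)\<^sup>2) * indicator {?mid<..b} s \<partial>U)"
  proof (rule integral_mono_AE)
    show "integrable U (\<lambda>s. (s - s1) * (s - s2) * (Q s - w s))"
      unfolding eq using iQ iw by auto
    have "integrable U (indicator {?mid<..b} :: real \<Rightarrow> real)"
      by (rule integrable_const_bound[where B=1]) (auto simp: U_def indicator_def)
    then show "integrable U (\<lambda>s. - (\<kappa> * ((b - hi) / 2)\<^sup>2) * indicator {?mid<..b} s)" by simp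
    show "AE s in U. (s - s1) * (s - s2) * (Q s - w s) \<le> - (\<kappa> * ((b - hi) / 2)\<^sup>2) * indicator {?mid<..b} s"
      unfolding U_def using meas_I pt by (rule AE_lborel_on)
  qed
  also have "(\<integral>s. - (\<kappa> * ((b - hi) / 2)\<^sup>2) * indicator {?mid<..b} s \<partial>U) = - (\<kappa> * ((b - hi) / 2)\<^sup>2) * measure U {?mid<..b}"
    by (simp add: U_def)
  also have "measure U {?mid<..b} = (b - hi) / 2"
  proof -
    have "{-a..b} \<inter> {?mid<..b} = {?mid<..b}" using ab by (auto simp: field_simps)
    then show ?thesis unfolding U_def using ab by (simp add: measure_def emeasure_lborel_on field_simps)
  qed
  finally have "(\<integral>s. (s - s1) * (s - s2) * (Q s - w s) \<partial>U) \<le> - (\<kappa> * ((b - hi) / 2) ^ 3)"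
    by (simp add: power2_eq_square power3_eq_cube)
  moreover have "(\<integral>s. (s - s1) * (s - s2) * (Q s - w s) \<partial>U) = (\<integral>s. s\<^sup>2 * Q s \<partial>U) - (\<integral>s. s\<^sup>2 * w s \<partial>U)"
    unfolding eq using iQ iw m0 m1 by simp
  ultimately show ?thesis by simp
qed

text \<open>A log-concave function divided by an exponential is log-concave, hence has convex superlevel sets. This is
how log-concavity enters the comparison of a marginal with an exponential.\<close>

lemma log_concave_line_tilted_superlevel:
  assumes \<psi>: "log_concave_line \<psi>" and "\<And>s. \<psi> s = ennreal (Q s)" "\<And>s. 0 \<le> Q s" and c: "0 < c"
  shows "convex {s \<in> {lo..hi}. c * exp (k * s) \<le> Q s}"
  unfolding convex_alt
proof (intro ballI allI impI)
  fix s t v :: real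
  assume s: "s \<in> {s \<in> {lo..hi}. c * exp (k * s) \<le> Q s}" and t: "t \<in> {s \<in> {lo..hi}. c * exp (k * s) \<le> Q s}"
    and v: "0 \<le> v \<and> v \<le> 1"
  let ?z = "(1 - v) * s + v * t"
  consider "v = 0" | "v = 1" | "0 < v" "v < 1" using v by linarith
  then show "(1 - v) *\<^sub>R s + v *\<^sub>R t \<in> {s \<in> {lo..hi}. c * exp (k * s) \<le> Q s}"
  proof cases
    case 3
    have "?z \<in> {lo..hi}"
      using convexD[OF convex_real_interval(5)[of lo hi], of s t "1 - v" v] s t 3 by simp
    moreover have "c * exp (k * ?z) \<le> Q ?z"
    proof -
      \<comment> \<open>This tilt makes the two values of the exponential agree.\<close>
      define d where "d = - (k * (t - s))"
      have "min (\<psi> s) (ennreal (exp d) * \<psi> t) \<le> ennreal (exp (v * d)) * \<psi> ?z"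
        using \<psi> 3 unfolding log_concave_line_def by blast
      then have "min (ennreal (Q s)) (ennreal (exp d * Q t)) \<le> ennreal (exp (v * d) * Q ?z)"
        using assms(2,3) by (simp add: ennreal_mult)
      moreover have "ennreal (c * exp (k * s)) \<le> ennreal (Q s)" using s by (intro ennreal_leI) simp
      moreover have "ennreal (c * exp (k * s)) \<le> ennreal (exp d * Q t)"
      proof (rule ennreal_leI)
        have "c * exp (k * s) = exp d * (c * exp (k * t))"
          unfolding d_def by (simp add: exp_add[symmetric] algebra_simps)
        also have "\<dots> \<le> exp d * Q t" using t by simp
        finally show "c * exp (k * s) \<le> exp d * Q t" .
      qed
      ultimately have "ennreal (c * exp (k * s)) \<le> ennreal (exp (v * d) * Q ?z)"
        by (meson min.boundedI order_trans)
      then have "c * exp (k * s) \<le> exp (v * d) * Q ?z"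
        using assms(3) by (subst (asm) ennreal_le_iff) auto
      moreover have "c * exp (k * s) = exp (v * d) * (c * exp (k * ?z))"
        unfolding d_def by (simp add: exp_add[symmetric] algebra_simps)
      ultimately show ?thesis by simp
    qed
    ultimately show ?thesis by simp
  qed (use s t in auto)
qed

text \<open>The marginal of \<open>v \<bullet> x - \<mu>\<close> with real values, in the form in which the variance bounds use it.\<close>

lemma marginal_density_real:
  fixes K :: "'a::euclidean_space set"
  assumes K: "compact K" "convex K" "K \<subseteq> cball 0 R" "0 \<le> R" and v: "norm v = 1"
  shows "\<exists>Q :: real \<Rightarrow> real. Q \<in> borel_measurable borel \<and> (\<forall>s. 0 \<le> Q s) \<and> (\<forall>s. Q s \<le> (2 * R) ^ (DIM('a) - 1)) \<and>
    (\<forall>s. Q s \<le> (2 * sqrt (max 0 (R\<^sup>2 - (s + \<mu>)\<^sup>2))) ^ (DIM('a) - 1)) \<and>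
    (\<forall>lo hi k c. 0 < c \<longrightarrow> convex {s \<in> {lo..hi}. c * exp (k * s) \<le> Q s}) \<and>
    (\<forall>g lo hi. g \<in> borel_measurable borel \<longrightarrow> (\<forall>x\<in>K. v \<bullet> x - \<mu> \<in> {lo..hi}) \<longrightarrow>
       (\<integral>x. g (v \<bullet> x - \<mu>) \<partial>lborel_on K) = (\<integral>s. g s * Q s \<partial>lborel_on {lo..hi} :: real))"
proof -
  obtain \<psi>0 where m0 [measurable]: "\<psi>0 \<in> borel_measurable borel" and l0: "log_concave_line \<psi>0"
    and b0: "\<And>s. \<psi>0 s \<le> ennreal (indicator {-R..R} s * (2 * sqrt (max 0 (R\<^sup>2 - s\<^sup>2))) ^ (DIM('a) - 1))"
    and i0: "\<And>g. g \<in> borel_measurable borel \<Longrightarrow> (\<integral>\<^sup>+x. g (v \<bullet> x) \<partial>lborel_on K) = (\<integral>\<^sup>+s. \<psi>0 s * g s \<partial>lborel)"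
    using marginal_density[OF K(1-3) v] by blast
  define \<psi> where "\<psi> s = \<psi>0 (s + \<mu>)" for s
  define Q where "Q s = enn2real (\<psi> s)" for s
  have [measurable]: "\<psi> \<in> borel_measurable borel" unfolding \<psi>_def by measurable
  have Qm [measurable]: "Q \<in> borel_measurable borel" unfolding Q_def by measurable
  have Q0: "0 \<le> Q s" for s by (simp add: Q_def)
  have \<psi>Q: "\<psi> s = ennreal (Q s)" for s
    using b0[of "s + \<mu>"] unfolding Q_def \<psi>_def by (subst ennreal_enn2real) (auto simp: less_top[symmetric] top_unique)
  have b1: "Q s \<le> indicator {-R..R} (s + \<mu>) * (2 * sqrt (max 0 (R\<^sup>2 - (s + \<mu>)\<^sup>2))) ^ (DIM('a) - 1)" for s
  proof -
    have "ennreal (Q s) \<le> ennreal (indicator {-R..R} (s + \<mu>) * (2 * sqrt (max 0 (R\<^sup>2 - (s + \<mu>)\<^sup>2))) ^ (DIM('a) - 1))"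
      using b0[of "s + \<mu>"] unfolding \<psi>Q[symmetric] \<psi>_def .
    then show ?thesis by (subst (asm) ennreal_le_iff) auto
  qed
  have b2: "Q s \<le> (2 * sqrt (max 0 (R\<^sup>2 - (s + \<mu>)\<^sup>2))) ^ (DIM('a) - 1)" for s
    by (rule order_trans[OF b1]) (simp add: indicator_def)
  have b3: "Q s \<le> (2 * R) ^ (DIM('a) - 1)" for s
  proof (rule order_trans[OF b2], rule power_mono)
    have "sqrt (max 0 (R\<^sup>2 - (s + \<mu>)\<^sup>2)) \<le> sqrt (R\<^sup>2)" by (intro real_sqrt_le_mono) auto
    then show "2 * sqrt (max 0 (R\<^sup>2 - (s + \<mu>)\<^sup>2)) \<le> 2 * R" using K(4) by simp
  qed simp
  have l: "log_concave_line \<psi>"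
    unfolding log_concave_line_def
  proof (intro allI impI)
    fix x y t c :: real assume t: "0 < t" "t < 1"
    have "min (\<psi>0 (x + \<mu>)) (ennreal (exp c) * \<psi>0 (y + \<mu>)) \<le> ennreal (exp (t * c)) * \<psi>0 ((1 - t) * (x + \<mu>) + t * (y + \<mu>))"
      using l0 t unfolding log_concave_line_def by blast
    moreover have "(1 - t) * (x + \<mu>) + t * (y + \<mu>) = (1 - t) * x + t * y + \<mu>" by (simp add: algebra_simps)
    ultimately show "min (\<psi> x) (ennreal (exp c) * \<psi> y) \<le> ennreal (exp (t * c)) * \<psi> ((1 - t) * x + t * y)"
      unfolding \<psi>_def by simp
  qed
  have d: "distr (lborel_on K) borel (\<lambda>x. v \<bullet> x - \<mu>) = density lborel (\<lambda>s. ennreal (Q s))"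
  proof (rule measure_eqI)
    fix A assume "A \<in> sets (distr (lborel_on K) borel (\<lambda>x. v \<bullet> x - \<mu>))"
    then have [measurable]: "A \<in> sets borel" by simp
    have "emeasure (distr (lborel_on K) borel (\<lambda>x. v \<bullet> x - \<mu>)) A = (\<integral>\<^sup>+s. indicator A s \<partial>distr (lborel_on K) borel (\<lambda>x. v \<bullet> x - \<mu>))"
      by simp
    also have "\<dots> = (\<integral>\<^sup>+x. indicator A (v \<bullet> x - \<mu>) \<partial>lborel_on K)"
      by (rule nn_integral_distr) auto
    also have "\<dots> = (\<integral>\<^sup>+s. \<psi>0 s * indicator A (s - \<mu>) \<partial>lborel)"
      by (rule i0[of "\<lambda>s. indicator A (s - \<mu>)"]) simp
    also have "\<dots> = (\<integral>\<^sup>+s. \<psi> s * indicator A s \<partial>lborel)"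
      unfolding \<psi>_def by (subst nn_integral_real_affine[where c=1 and t=\<mu>]) (auto simp: add.commute)
    also have "\<dots> = emeasure (density lborel (\<lambda>s. ennreal (Q s))) A"
      by (subst emeasure_density) (auto simp: \<psi>Q)
    finally show "emeasure (distr (lborel_on K) borel (\<lambda>x. v \<bullet> x - \<mu>)) A = emeasure (density lborel (\<lambda>s. ennreal (Q s))) A" .
  qed simp
  have i: "(\<integral>x. g (v \<bullet> x - \<mu>) \<partial>lborel_on K) = (\<integral>s. g s * Q s \<partial>lborel_on {lo..hi})"
    if [measurable]: "g \<in> borel_measurable borel" and K': "\<And>x. x \<in> K \<Longrightarrow> v \<bullet> x - \<mu> \<in> {lo..hi}" for g :: "real \<Rightarrow> real" and lo hi
  proof -
    have [measurable]: "K \<in> sets borel" using K(1) by (rule borel_compact)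
    let ?g = "\<lambda>s. indicator {lo..hi} s * g s"
    have "(\<integral>x. g (v \<bullet> x - \<mu>) \<partial>lborel_on K) = (\<integral>x. ?g (v \<bullet> x - \<mu>) \<partial>lborel_on K)"
      by (rule integral_cong_AE) (auto intro!: AE_lborel_on simp: indicator_def dest: K')
    also have "\<dots> = (\<integral>s. ?g s \<partial>distr (lborel_on K) borel (\<lambda>x. v \<bullet> x - \<mu>))"
      by (rule integral_distr[symmetric]) auto
    also have "\<dots> = (\<integral>s. Q s *\<^sub>R ?g s \<partial>lborel)"
      unfolding d using Q0 by (intro integral_density) auto
    also have "\<dots> = (\<integral>s. indicator {lo..hi} s *\<^sub>R (g s * Q s) \<partial>lborel)"
      by (simp add: ac_simps)
    also have "\<dots> = (\<integral>s. g s * Q s \<partial>density lborel (\<lambda>s. ennreal (indicator {lo..hi} s)))"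
      by (rule integral_density[symmetric]) auto
    also have "density lborel (\<lambda>s. ennreal (indicator {lo..hi} s)) = lborel_on {lo..hi}"
      unfolding lborel_on_def by (rule density_cong) (auto simp: indicator_def)
    finally show ?thesis .
  qed
  show ?thesis
  proof (intro exI[of _ Q] conjI allI impI)
    show "convex {s \<in> {lo..hi}. c * exp (k * s) \<le> Q s}" if "0 < c" for lo hi k c
      using l \<psi>Q Q0 that by (rule log_concave_line_tilted_superlevel)
    show "(\<integral>x. g (v \<bullet> x - \<mu>) \<partial>lborel_on K) = (\<integral>s. g s * Q s \<partial>lborel_on {lo..hi})"
      if "g \<in> borel_measurable borel" "\<forall>x\<in>K. v \<bullet> x - \<mu> \<in> {lo..hi}" for g :: "real \<Rightarrow> real" and lo hi
      using that by (intro i) auto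
  qed (fact Qm Q0 b3 b2)+
qed

text \<open>The marginal is compared with the truncated exponential of the same mass and mean on the interval
\<open>[-a, b]\<close> of length \<open>2 h\<close>. The cases \<open>a = 0\<close> and \<open>b = 0\<close> are degenerate; there the elementary
bound \<open>a b\<close> for the variance already gives \<open>0\<close>.\<close>

lemma variance_le_of_slab:
  fixes K :: "'a::euclidean_space set" and v :: 'a
  assumes K: "compact K" "convex K" "interior K \<noteq> {}" and v: "norm v = 1"
    and slab: "\<And>x. x \<in> K \<Longrightarrow> \<bar>v \<bullet> x - m\<bar> \<le> h"
    and mean: "(\<integral>x. v \<bullet> x - \<mu> \<partial>lborel_on K) = 0"
  shows "(\<integral>x. (v \<bullet> x - \<mu>)\<^sup>2 \<partial>lborel_on K) \<le> h\<^sup>2 / 3 * measure (lborel_on K) UNIV"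
proof -
  interpret finite_measure "lborel_on K" using K(1) by (rule finite_measure_lborel_on)
  define V where "V = measure (lborel_on K) UNIV"
  have V: "V > 0" unfolding V_def using K by (intro measure_lborel_on_pos)
  have int: "integrable (lborel_on K) f" if "continuous_on UNIV f" for f :: "'a \<Rightarrow> real"
    using K(1) that by (intro integrable_lborel_on) (auto intro: borel_measurable_continuous_onI continuous_on_subset)
  have Km: "K \<in> sets borel" using K(1) by (rule borel_compact)
  define a where "a = \<mu> - m + h"
  define b where "b = m + h - \<mu>"
  have I: "v \<bullet> x - \<mu> \<in> {-a..b}" if "x \<in> K" for x
    using slab[OF that] by (auto simp: a_def b_def abs_le_iff)
  have h: "h = (a + b) / 2" by (simp add: a_def b_def)
  have i1: "integrable (lborel_on K) (\<lambda>x. v \<bullet> x - \<mu>)" by (intro int continuous_intros)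
  have i2: "integrable (lborel_on K) (\<lambda>x. (v \<bullet> x - \<mu>)\<^sup>2)" by (intro int continuous_intros)
  \<comment> \<open>Integrate \<open>(b - s) (s + a) \<ge> 0\<close>.\<close>
  have up: "(\<integral>x. (v \<bullet> x - \<mu>)\<^sup>2 \<partial>lborel_on K) \<le> a * b * V"
  proof -
    have "(\<integral>x. (v \<bullet> x - \<mu>)\<^sup>2 \<partial>lborel_on K) \<le> (\<integral>x. a * b + (b - a) * (v \<bullet> x - \<mu>) \<partial>lborel_on K)"
    proof (rule integral_mono_AE[OF i2])
      show "integrable (lborel_on K) (\<lambda>x. a * b + (b - a) * (v \<bullet> x - \<mu>))" using i1 by simp
      show "AE x in lborel_on K. (v \<bullet> x - \<mu>)\<^sup>2 \<le> a * b + (b - a) * (v \<bullet> x - \<mu>)"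
        using Km
      proof (rule AE_lborel_on)
        fix x assume "x \<in> K"
        from I[OF this] have "0 \<le> (b - (v \<bullet> x - \<mu>)) * ((v \<bullet> x - \<mu>) + a)" by (intro mult_nonneg_nonneg) auto
        then show "(v \<bullet> x - \<mu>)\<^sup>2 \<le> a * b + (b - a) * (v \<bullet> x - \<mu>)" by (simp add: power2_eq_square algebra_simps)
      qed
    qed
    also have "\<dots> = a * b * V" using i1 mean by (simp add: V_def)
    finally show ?thesis .
  qed
  have a0: "0 \<le> a"
  proof -
    have "0 \<le> (\<integral>x. (v \<bullet> x - \<mu>) + a \<partial>lborel_on K)"
      using Km by (intro integral_nonneg_AE AE_lborel_on) (use I in \<open>fastforce+\<close>)
    also have "\<dots> = a * V" using i1 mean by (simp add: V_def)
    finally show ?thesis using V by (simp add: zero_le_mult_iff)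
  qed
  have b0: "0 \<le> b"
  proof -
    have "0 \<le> (\<integral>x. b - (v \<bullet> x - \<mu>) \<partial>lborel_on K)"
      using Km by (intro integral_nonneg_AE AE_lborel_on) (use I in \<open>fastforce+\<close>)
    also have "\<dots> = b * V" using i1 mean by (simp add: V_def)
    finally show ?thesis using V by (simp add: zero_le_mult_iff)
  qed
  show ?thesis
  proof (cases "a = 0 \<or> b = 0")
    case True
    then have "a * b * V = 0" by auto
    moreover have "0 \<le> h\<^sup>2 / 3 * V" using V by simp
    ultimately show ?thesis using up unfolding V_def by linarith
  next
    case False
    then have ab: "0 < a" "0 < b" using a0 b0 by auto
    obtain R where R: "0 \<le> R" "K \<subseteq> cball 0 R"
    proof -
      obtain B where B: "\<And>x. x \<in> K \<Longrightarrow> norm x \<le> B"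
        using compact_imp_bounded[OF K(1)] by (auto simp: bounded_iff)
      show thesis by (rule that[of "max 0 B"]) (use B in \<open>force simp: le_max_iff_disj\<close>)+
    qed
    obtain Q where Qm [measurable]: "Q \<in> borel_measurable borel" and Q0: "\<forall>s. 0 \<le> Q s" and Qb: "\<forall>s. Q s \<le> (2 * R) ^ (DIM('a) - 1)"
      and Qd: "\<forall>s. Q s \<le> (2 * sqrt (max 0 (R\<^sup>2 - (s + \<mu>)\<^sup>2))) ^ (DIM('a) - 1)"
      and Qc: "\<forall>lo hi k c. 0 < c \<longrightarrow> convex {s \<in> {lo..hi}. c * exp (k * s) \<le> Q s}"
      and Qi: "\<forall>g lo hi. g \<in> borel_measurable borel \<longrightarrow> (\<forall>x\<in>K. v \<bullet> x - \<mu> \<in> {lo..hi}) \<longrightarrow>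
       (\<integral>x. g (v \<bullet> x - \<mu>) \<partial>lborel_on K) = (\<integral>s. g s * Q s \<partial>lborel_on {lo..hi} :: real)"
      using marginal_density_real[OF K(1,2) R(2,1) v, of \<mu>] by (elim exE conjE) (rule that)
    obtain k where k: "(\<integral>s. s * exp (k * s) \<partial>lborel_on {-a..b}) = 0"
      using centering_tilt_exists[OF ab] by blast
    define E where "E = (\<integral>s. exp (k * s) \<partial>lborel_on {-a..b})"
    have E: "E > 0"
    proof -
      have "E = b * exp (k * b) + a * exp (- (k * a))"
        using exp_moments(2)[of a b k] ab k unfolding E_def by simp
      then show ?thesis using ab by (simp add: add_pos_pos)
    qed
    define c where "c = V / E"
    have c: "c > 0" using V E by (simp add: c_def)
    have q0: "(\<integral>s. Q s \<partial>lborel_on {-a..b}) = V"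
      using Qi[rule_format, of "\<lambda>_. 1" "-a" b] I by (simp add: V_def)
    have q1: "(\<integral>s. s * Q s \<partial>lborel_on {-a..b}) = 0"
      using Qi[rule_format, of "\<lambda>s. s" "-a" b] I mean by simp
    have q2: "(\<integral>s. s\<^sup>2 * Q s \<partial>lborel_on {-a..b}) = (\<integral>x. (v \<bullet> x - \<mu>)\<^sup>2 \<partial>lborel_on K)"
      using Qi[rule_format, of "\<lambda>s. s\<^sup>2" "-a" b] I by simp
    define C where "C = max ((2 * R) ^ (DIM('a) - 1)) (c * exp (\<bar>k\<bar> * (a + b)))"
    have "(\<integral>s. s\<^sup>2 * Q s \<partial>lborel_on {-a..b}) \<le> (\<integral>s. s\<^sup>2 * (c * exp (k * s)) \<partial>lborel_on {-a..b}) - 0 * ((b - b) / 2) ^ 3"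
    proof (rule second_moment_comparison)
      show "\<bar>Q s\<bar> \<le> C" for s using Q0[rule_format, of s] Qb[rule_format, of s] by (simp add: C_def)
      show "\<bar>c * exp (k * s)\<bar> \<le> C" if "s \<in> {-a..b}" for s
      proof -
        have "k * s \<le> \<bar>k\<bar> * \<bar>s\<bar>" by (metis abs_ge_self abs_mult)
        also have "\<dots> \<le> \<bar>k\<bar> * (a + b)" using that ab by (intro mult_left_mono) auto
        finally show ?thesis using c by (simp add: C_def le_max_iff_disj)
      qed
      show "convex {s \<in> {-a..b}. c * exp (k * s) \<le> Q s}" using Qc[rule_format, OF c] .
      show "(\<integral>s. Q s \<partial>lborel_on {-a..b}) = (\<integral>s. c * exp (k * s) \<partial>lborel_on {-a..b})"
        using q0 E by (simp add: E_def[symmetric] c_def)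
      have "(\<integral>s. s * (c * exp (k * s)) \<partial>lborel_on {-a..b}) = (\<integral>s. c * (s * exp (k * s)) \<partial>lborel_on {-a..b})"
        by (simp add: ac_simps)
      then show "(\<integral>s. s * Q s \<partial>lborel_on {-a..b}) = (\<integral>s. s * (c * exp (k * s)) \<partial>lborel_on {-a..b})"
        using q1 k by simp
    qed (use ab in auto)
    also have "(\<integral>s. s\<^sup>2 * (c * exp (k * s)) \<partial>lborel_on {-a..b}) = (\<integral>s. c * (s\<^sup>2 * exp (k * s)) \<partial>lborel_on {-a..b})"
      by (simp add: ac_simps)
    also have "\<dots> = c * (\<integral>s. s\<^sup>2 * exp (k * s) \<partial>lborel_on {-a..b})" by simp
    finally have "(\<integral>x. (v \<bullet> x - \<mu>)\<^sup>2 \<partial>lborel_on K) \<le> c * (\<integral>s. s\<^sup>2 * exp (k * s) \<partial>lborel_on {-a..b})"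
      using q2 by simp
    also have "\<dots> \<le> c * (((a + b) / 2)\<^sup>2 / 3 * E)"
      using truncated_exponential_variance[OF ab k] c unfolding E_def by (intro mult_left_mono) auto
    also have "\<dots> = h\<^sup>2 / 3 * V" using E by (simp add: c_def h)
    finally show ?thesis by (simp add: V_def)
  qed
qed

text \<open>The uniform density on \<open>[-r, r]\<close> has mean zero and variance \<open>r\<^sup>2 / 3\<close>, and it can serve for the
comparison. It exceeds the marginal by a fixed amount near \<open>r\<close>, where the slices of the
ball shrink to a point.\<close>

lemma variance_less_of_ball:
  fixes K :: "'a::euclidean_space set" and v :: 'a
  assumes K: "compact K" "convex K" "interior K \<noteq> {}" "K \<subseteq> cball 0 r" and r: "0 < r" and v: "norm v = 1"
    and mean: "(\<integral>x. v \<bullet> x \<partial>lborel_on K) = 0" and d: "2 \<le> DIM('a)"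
  shows "(\<integral>x. (v \<bullet> x)\<^sup>2 \<partial>lborel_on K) < r\<^sup>2 / 3 * measure (lborel_on K) UNIV"
proof -
  define V where "V = measure (lborel_on K) UNIV"
  have V: "V > 0" unfolding V_def using K by (intro measure_lborel_on_pos)
  have I: "v \<bullet> x - 0 \<in> {-r..r}" if "x \<in> K" for x
  proof -
    have "\<bar>v \<bullet> x\<bar> \<le> norm v * norm x" by (rule Cauchy_Schwarz_ineq2)
    also have "\<dots> \<le> r" using v K(4) that by auto
    finally show ?thesis by auto
  qed
  obtain Q where Qm [measurable]: "Q \<in> borel_measurable borel" and Q0: "\<forall>s. 0 \<le> Q s" and Qb: "\<forall>s. Q s \<le> (2 * r) ^ (DIM('a) - 1)"
      and Qd: "\<forall>s. Q s \<le> (2 * sqrt (max 0 (r\<^sup>2 - (s + 0)\<^sup>2))) ^ (DIM('a) - 1)"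
      and Qc: "\<forall>lo hi k c. 0 < c \<longrightarrow> convex {s \<in> {lo..hi}. c * exp (k * s) \<le> Q s}"
      and Qi: "\<forall>g lo hi. g \<in> borel_measurable borel \<longrightarrow> (\<forall>x\<in>K. v \<bullet> x - 0 \<in> {lo..hi}) \<longrightarrow>
       (\<integral>x. g (v \<bullet> x - 0) \<partial>lborel_on K) = (\<integral>s. g s * Q s \<partial>lborel_on {lo..hi} :: real)"
      using marginal_density_real[OF K(1,2,4) less_imp_le[OF r] v, of 0] by (elim exE conjE) (rule that)
  have q0: "(\<integral>s. Q s \<partial>lborel_on {-r..r}) = V"
    using Qi[rule_format, of "\<lambda>_. 1" "-r" r] I by (simp add: V_def)
  have q1: "(\<integral>s. s * Q s \<partial>lborel_on {-r..r}) = 0"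
    using Qi[rule_format, of "\<lambda>s. s" "-r" r] I mean by simp
  have q2: "(\<integral>s. s\<^sup>2 * Q s \<partial>lborel_on {-r..r}) = (\<integral>x. (v \<bullet> x)\<^sup>2 \<partial>lborel_on K)"
    using Qi[rule_format, of "\<lambda>s. s\<^sup>2" "-r" r] I by simp
  have le: "-r \<le> r" using r by simp
  have u0: "(\<integral>s. 1 \<partial>lborel_on {-r..r}) = r - (-r)"
    by (rule lborel_on_interval_FTC[OF le]) (auto intro!: derivative_eq_intros continuous_intros)
  have u1: "(\<integral>s. s \<partial>lborel_on {-r..r}) = r\<^sup>2 / 2 - (-r)\<^sup>2 / 2"
    by (rule lborel_on_interval_FTC[OF le]) (auto intro!: derivative_eq_intros continuous_intros)
  have u2: "(\<integral>s. s\<^sup>2 \<partial>lborel_on {-r..r}) = r ^ 3 / 3 - (-r) ^ 3 / 3"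
    by (rule lborel_on_interval_FTC[OF le]) (auto intro!: derivative_eq_intros continuous_intros)
  define c where "c = V / (2 * r)"
  have c: "c > 0" using V r by (simp add: c_def)
  define f where "f s = (2 * sqrt (max 0 (r\<^sup>2 - s\<^sup>2))) ^ (DIM('a) - 1)" for s
  have "isCont f r" unfolding f_def by (intro continuous_intros)
  moreover have "f r = 0" using d by (simp add: f_def zero_power)
  moreover have "0 < c / 2" using c by simp
  ultimately obtain e where e: "e > 0" "\<And>s. \<bar>s - r\<bar> < e \<Longrightarrow> \<bar>f s\<bar> < c / 2"
    unfolding continuous_at_real_range by fastforce
  define \<epsilon> where "\<epsilon> = min e r"
  have \<epsilon>: "0 < \<epsilon>" "\<epsilon> \<le> e" "\<epsilon> \<le> r" using e(1) r by (auto simp: \<epsilon>_def)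
  have "(\<integral>s. s\<^sup>2 * Q s \<partial>lborel_on {-r..r}) \<le> (\<integral>s. s\<^sup>2 * c \<partial>lborel_on {-r..r}) - c / 2 * ((r - (r - \<epsilon>)) / 2) ^ 3"
  proof (rule second_moment_comparison[where C="max c ((2 * r) ^ (DIM('a) - 1))"])
    show "\<bar>Q s\<bar> \<le> max c ((2 * r) ^ (DIM('a) - 1))" for s
      using Q0[rule_format, of s] Qb[rule_format, of s] by simp
    show "convex {s \<in> {- r..r}. c \<le> Q s}" using Qc[rule_format, OF c, of "-r" r 0] by simp
    show "(\<integral>s. Q s \<partial>lborel_on {-r..r}) = (\<integral>s. c \<partial>lborel_on {-r..r})"
      using q0 u0 r by (simp add: c_def)
    show "(\<integral>s. s * Q s \<partial>lborel_on {-r..r}) = (\<integral>s. s * c \<partial>lborel_on {-r..r})"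
      using q1 u1 by simp
    show "Q s < c \<and> Q s \<le> c - c / 2" if "r - \<epsilon> < s" "s \<le> r" for s
    proof -
      have "\<bar>f s\<bar> < c / 2" using that \<epsilon> by (intro e(2)) auto
      moreover have "Q s \<le> f s" using Qd[rule_format, of s] by (simp add: f_def)
      ultimately show ?thesis using c by auto
    qed
  qed (use \<epsilon> r c in auto)
  also have "\<dots> < (\<integral>s. s\<^sup>2 * c \<partial>lborel_on {-r..r})" using c \<epsilon> by simp
  also have "\<dots> = (r ^ 3 / 3 - (-r) ^ 3 / 3) * c" using u2 by simp
  also have "\<dots> = r\<^sup>2 / 3 * V" using r by (simp add: c_def power2_eq_square power3_eq_cube)
  finally show ?thesis using q2 by (simp add: V_def)
qed

section \<open>The lower variance bound by dilations\<close>

text \<open>The contraction \<open>x \<mapsto> (1 - l) P + l x\<close> maps \<open>L\<close> into itself and multiplies volumes by \<open>l\<^sup>d\<close>.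
Hence \<open>\<integral> f \<ge> l\<^sup>d \<integral> (f + (1 - l) \<eta>)\<close>, and dividing by \<open>1 - l\<close> and letting \<open>l\<close> tend to \<open>1\<close>
gives the claim. Here \<open>\<eta>\<close> plays the role of the derivative of \<open>f\<close> in the direction of \<open>P\<close>, and
\<open>step\<close> that of convexity along rays.\<close>

lemma dilation_inequality:
  fixes L :: "'a::euclidean_space set" and f \<eta> :: "'a \<Rightarrow> real"
  assumes L: "compact L" "convex L" "P \<in> L"
    and [measurable]: "f \<in> borel_measurable borel" and pos: "\<And>x. x \<in> L \<Longrightarrow> 0 \<le> f x" and bd: "\<And>x. x \<in> L \<Longrightarrow> f x \<le> B"
    and \<eta>: "integrable (lborel_on L) \<eta>"
    and step: "\<And>x l. x \<in> L \<Longrightarrow> 0 < l \<Longrightarrow> l < 1 \<Longrightarrow> f x + (1 - l) * \<eta> x \<le> f ((1 - l) *\<^sub>R P + l *\<^sub>R x)"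
  shows "(\<integral>x. \<eta> x \<partial>lborel_on L) \<le> DIM('a) * (\<integral>x. f x \<partial>lborel_on L)"
proof -
  interpret finite_measure "lborel_on L" using L(1) by (rule finite_measure_lborel_on)
  have [measurable]: "L \<in> sets borel" using L(1) by (rule borel_compact)
  let ?d = "DIM('a)"
  define I where "I = (\<integral>x. f x \<partial>lborel_on L)"
  define H where "H = (\<integral>x. \<eta> x \<partial>lborel_on L)"
  have intf: "integrable (lborel_on L) f"
    by (rule integrable_const_bound[where B=B]) (auto intro!: AE_lborel_on simp: pos bd)
  have I0: "0 \<le> I" unfolding I_def by (intro integral_nonneg_AE AE_lborel_on pos) simp
  have ineq: "l ^ ?d * H \<le> ?d * I" if l: "0 < l" "l < 1" for l
  proof -
    let ?T = "\<lambda>x. (1 - l) *\<^sub>R P + l *\<^sub>R x"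
    have T: "?T x \<in> L" if "x \<in> L" for x
      using convexD[OF L(2) L(3) that, of "1 - l" l] l by simp
    have Tm: "(\<lambda>x. f (?T x)) \<in> borel_measurable borel" by measurable
    have iT: "integrable (lborel_on L) (\<lambda>x. f (?T x))"
      by (rule integrable_const_bound[where B=B]) (auto intro!: AE_lborel_on simp: pos bd T)
    have "ennreal (l ^ ?d) * (\<integral>\<^sup>+x. ennreal (f (?T x)) \<partial>lborel_on L) = ennreal (l ^ ?d) * (\<integral>\<^sup>+x. ennreal (f (?T x)) * indicator L x \<partial>lborel)"
      by (subst nn_integral_lborel_on) auto
    also have "\<dots> \<le> ennreal (l ^ ?d) * (\<integral>\<^sup>+x. ennreal (f (?T x)) * indicator L (?T x) \<partial>lborel)"
      using T by (intro mult_left_mono nn_integral_mono) (auto simp: indicator_def)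
    also have "\<dots> = (\<integral>\<^sup>+y. ennreal (f y) * indicator L y \<partial>lborel)"
      using l by (subst nn_integral_lborel_affine[where c=l and t="(1 - l) *\<^sub>R P" and f="\<lambda>y. ennreal (f y) * indicator L y"]) auto
    also have "\<dots> = (\<integral>\<^sup>+y. ennreal (f y) \<partial>lborel_on L)"
      by (subst nn_integral_lborel_on) auto
    also have "(\<integral>\<^sup>+y. ennreal (f y) \<partial>lborel_on L) = ennreal I"
      unfolding I_def using intf by (rule nn_integral_eq_integral) (auto intro!: AE_lborel_on simp: pos)
    also have "(\<integral>\<^sup>+x. ennreal (f (?T x)) \<partial>lborel_on L) = ennreal (\<integral>x. f (?T x) \<partial>lborel_on L)"
      using iT by (rule nn_integral_eq_integral) (auto intro!: AE_lborel_on simp: pos T)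
    finally have 1: "l ^ ?d * (\<integral>x. f (?T x) \<partial>lborel_on L) \<le> I"
      using l I0 by (simp add: ennreal_mult'[symmetric])
    have "I + (1 - l) * H = (\<integral>x. f x + (1 - l) * \<eta> x \<partial>lborel_on L)"
      unfolding I_def H_def using intf \<eta> by simp
    also have "\<dots> \<le> (\<integral>x. f (?T x) \<partial>lborel_on L)"
      using intf \<eta> iT step l by (intro integral_mono_AE AE_lborel_on) auto
    finally have "l ^ ?d * (I + (1 - l) * H) \<le> l ^ ?d * (\<integral>x. f (?T x) \<partial>lborel_on L)"
      using l by (intro mult_left_mono) auto
    then have "(1 - l) * (l ^ ?d * H) \<le> (1 - l ^ ?d) * I"
      using 1 by (simp add: algebra_simps)
    also have "\<dots> \<le> (1 - l) * (?d * I)"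
    proof -
      have "1 + real ?d * (l - 1) \<le> (1 + (l - 1)) ^ ?d"
        using l by (intro Bernoulli_inequality) auto
      then have "1 - l ^ ?d \<le> (1 - l) * ?d" by (simp add: algebra_simps)
      then have "(1 - l ^ ?d) * I \<le> (1 - l) * ?d * I" using I0 by (rule mult_right_mono)
      then show ?thesis by (simp add: mult.assoc)
    qed
    finally show ?thesis using l by simp
  qed
  have "((\<lambda>l. l ^ ?d * H) \<longlongrightarrow> 1 ^ ?d * H) (at_left 1)"
    by (intro tendsto_intros)
  moreover have "\<forall>\<^sub>F l in at_left (1::real). l ^ ?d * H \<le> ?d * I"
    using eventually_at_left_real[of 0 1] by (rule eventually_mono) (auto intro: ineq)
  ultimately have "1 ^ ?d * H \<le> ?d * I"
    by (intro tendsto_upperbound) auto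
  then show ?thesis by (simp add: I_def H_def)
qed

text \<open>Both sides compare the convex function \<open>(s - t)\<^sub>+ (s + m)\<close> with its tangent at \<open>s\<close>; it is convex
because \<open>s + m\<close> is nonnegative at \<open>t\<close>.\<close>

lemma quadratic_cut_subgradient:
  fixes t m s s' :: real
  assumes "0 \<le> t + m"
  shows "max 0 (s - t) * (s + m) + (if t \<le> s then 2 * s + m - t else 0) * (s' - s) \<le> max 0 (s' - t) * (s' + m)"
proof (cases "t \<le> s"; cases "t \<le> s'")
  assume "t \<le> s" "t \<le> s'"
  moreover have "0 \<le> (s' - s)\<^sup>2" by simp
  ultimately show ?thesis by (simp add: max_def algebra_simps power2_eq_square)
next
  assume a: "t \<le> s" "\<not> t \<le> s'"
  then have "0 \<le> (2 * s + m - t) * (t - s')" using assms by (intro mult_nonneg_nonneg) auto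
  moreover have "0 \<le> (s - t)\<^sup>2" by simp
  ultimately show ?thesis using a by (simp add: max_def algebra_simps power2_eq_square)
next
  assume a: "\<not> t \<le> s" "t \<le> s'"
  then have "0 \<le> (s' - t) * (s' + m)" using assms by (intro mult_nonneg_nonneg) auto
  then show ?thesis using a by (simp add: max_def)
qed auto

text \<open>Apply \<open>dilation_inequality\<close> towards the highest point \<open>P\<close> with
\<open>\<phi>1 = (s - t)\<^sub>+ (s + m)\<close> and towards the lowest point \<open>Q\<close> with \<open>\<phi>2 = (t - s)\<^sub>+ (m - s)\<close>, where
\<open>s = v \<bullet> x - \<mu>\<close>, and add the results. The difference of the integrands is a quadratic polynomial in \<open>s\<close> on either side of
\<open>t\<close>, and the choices \<open>m = (a + b) / (d + 1)\<close> and \<open>t = (a - b) / (d - 1)\<close> are the ones for which the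
two polynomials coincide. Its leading coefficient is \<open>- (d + 2)\<close>, its linear term integrates to zero, and its constant
term \<open>C\<close> satisfies \<open>(d + 1) C = 2 a b + d (d - 1) t\<^sup>2\<close>.

The set \<open>W\<close> serves for the strict version. It is a union of rays issuing from \<open>P\<close>, so that subtracting
\<open>\<kappa>\<close> on \<open>W\<close> from \<open>\<phi>1\<close> keeps the hypotheses of \<open>dilation_inequality\<close>, and the measure of \<open>W\<close> is gained.\<close>

lemma variance_lower_bound_gain:
  fixes L W :: "'a::euclidean_space set" and v P Q :: 'a
  defines "d \<equiv> real DIM('a)"
  assumes L: "compact L" "convex L" "interior L \<noteq> {}" and PQ: "P \<in> L" "Q \<in> L"
    and b: "v \<bullet> P - \<mu> = b" and a: "v \<bullet> Q - \<mu> = - a"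
    and range: "\<And>x. x \<in> L \<Longrightarrow> v \<bullet> x - \<mu> \<in> {-a..b}"
    and mean: "(\<integral>x. v \<bullet> x - \<mu> \<partial>lborel_on L) = 0"
    and W [measurable]: "W \<in> sets borel" and \<kappa>: "0 \<le> \<kappa>"
    and W\<kappa>: "\<And>x. x \<in> L \<Longrightarrow> x \<in> W \<Longrightarrow> \<kappa> \<le> max 0 (v \<bullet> x - \<mu> - (a - b) / (d - 1)) * (v \<bullet> x - \<mu> + (a + b) / (d + 1))"
    and Wcone: "\<And>x l. x \<in> L \<Longrightarrow> 0 < l \<Longrightarrow> l < 1 \<Longrightarrow> (1 - l) *\<^sub>R P + l *\<^sub>R x \<in> W \<Longrightarrow> x \<in> W"
  shows "2 * a * b / (d + 1) * measure (lborel_on L) UNIV + d * \<kappa> * measure (lborel_on L) W \<le> (d + 2) * (\<integral>x. (v \<bullet> x - \<mu>)\<^sup>2 \<partial>lborel_on L)"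
proof -
  interpret finite_measure "lborel_on L" using L(1) by (rule finite_measure_lborel_on)
  have Lm [measurable]: "L \<in> sets borel" using L(1) by (rule borel_compact)
  define V where "V = measure (lborel_on L) UNIV"
  have V: "V > 0" unfolding V_def using L by (intro measure_lborel_on_pos)
  have d: "1 \<le> d" unfolding d_def by (simp add: Suc_leI)
  define s where "s x = v \<bullet> x - \<mu>" for x
  have sc: "continuous_on A s" for A unfolding s_def by (intro continuous_intros)
  have sm [measurable]: "s \<in> borel_measurable borel" using sc by (rule borel_measurable_continuous_onI)
  have int: "integrable (lborel_on L) f" if "continuous_on UNIV f" for f :: "'a \<Rightarrow> real"
    using L(1) that by (intro integrable_lborel_on) (auto intro: borel_measurable_continuous_onI continuous_on_subset)
  have is1: "integrable (lborel_on L) s" by (rule int[OF sc])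
  have is2: "integrable (lborel_on L) (\<lambda>x. (s x)\<^sup>2)" by (intro int continuous_intros sc)
  have ms: "(\<integral>x. s x \<partial>lborel_on L) = 0" using mean by (simp add: s_def)
  have sP: "s P = b" and sQ: "s Q = - a" using a b by (simp_all add: s_def)
  have sr: "- a \<le> s x" "s x \<le> b" if "x \<in> L" for x using range[OF that] by (simp_all add: s_def)
  have sT: "s ((1 - l) *\<^sub>R p + l *\<^sub>R x) = s x + (1 - l) * (s p - s x)" for l p x
    by (simp add: s_def inner_add_right algebra_simps)
  \<comment> \<open>The linear functions \<open>s + a\<close> and \<open>b - s\<close> in \<open>dilation_inequality\<close> bound the ratio of the extents.
    For \<open>d = 1\<close> this gives \<open>a = b\<close>, in agreement with the value \<open>t = 0\<close> of the division by \<open>d - 1 = 0\<close>.\<close>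
  have bda: "b \<le> d * a"
  proof -
    have "(\<integral>x. b - s x \<partial>lborel_on L) \<le> DIM('a) * (\<integral>x. s x + a \<partial>lborel_on L)"
      using L(1,2) PQ(1) by (rule dilation_inequality[where B="a + b"]) (simp_all only: sT sP, auto simp: is1 algebra_simps dest: sr)
    then have "b * V \<le> d * a * V" using is1 ms by (simp add: V_def d_def ac_simps)
    then show ?thesis using V by simp
  qed
  have adb: "a \<le> d * b"
  proof -
    have "(\<integral>x. s x + a \<partial>lborel_on L) \<le> DIM('a) * (\<integral>x. b - s x \<partial>lborel_on L)"
      using L(1,2) PQ(2) by (rule dilation_inequality[where B="a + b"]) (simp_all only: sT sQ, auto simp: is1 algebra_simps dest: sr)
    then have "a * V \<le> d * b * V" using is1 ms by (simp add: V_def d_def ac_simps)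
    then show ?thesis using V by simp
  qed
  define t where "t = (a - b) / (d - 1)"
  define m where "m = (a + b) / (d + 1)"
  have t: "(d - 1) * t = a - b"
  proof (cases "d = 1")
    case True
    then show ?thesis using bda adb by simp
  qed (simp add: t_def)
  have m: "(d + 1) * m = a + b" using d by (simp add: m_def)
  have ab: "0 \<le> a" "0 \<le> b"
  proof -
    have "0 \<le> a + b" using sr[OF PQ(1)] sP by simp
    show "0 \<le> a"
    proof (rule ccontr)
      assume "\<not> 0 \<le> a"
      then have "d * a \<le> 1 * a" using d by (intro mult_right_mono_neg) auto
      then show False using bda \<open>0 \<le> a + b\<close> \<open>\<not> 0 \<le> a\<close> by linarith
    qed
    show "0 \<le> b"
    proof (rule ccontr)
      assume "\<not> 0 \<le> b"
      then have "d * b \<le> 1 * b" using d by (intro mult_right_mono_neg) auto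
      then show False using adb \<open>0 \<le> a + b\<close> \<open>\<not> 0 \<le> b\<close> by linarith
    qed
  qed
  have nonneg_factor: "0 \<le> y" if "0 \<le> x * y" "0 < x" for x y :: real
    using that by (simp add: zero_le_mult_iff)
  have tm: "0 \<le> t + m" "t \<le> m"
  proof -
    show "0 \<le> t + m"
    proof (cases "d = 1")
      case True then show ?thesis using ab by (simp add: t_def m_def)
    next
      case False
      have "(d - 1) * (d + 1) * (t + m) = (d + 1) * ((d - 1) * t) + (d - 1) * ((d + 1) * m)" by (simp add: algebra_simps)
      also have "\<dots> = 2 * (d * a - b)" unfolding t m by (simp add: algebra_simps)
      finally have "0 \<le> (d - 1) * (d + 1) * (t + m)" using bda by simp
      moreover have "0 < (d - 1) * (d + 1)" using d False by simp
      ultimately have "0 \<le> t + m" by (rule nonneg_factor)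
      then show ?thesis by simp
    qed
    show "t \<le> m"
    proof (cases "d = 1")
      case True then show ?thesis using ab by (simp add: t_def m_def)
    next
      case False
      have "(d - 1) * (d + 1) * (m - t) = (d - 1) * ((d + 1) * m) - (d + 1) * ((d - 1) * t)" by (simp add: algebra_simps)
      also have "\<dots> = 2 * (d * b - a)" unfolding t m by (simp add: algebra_simps)
      finally have "0 \<le> (d - 1) * (d + 1) * (m - t)" using adb by simp
      moreover have "0 < (d - 1) * (d + 1)" using d False by simp
      ultimately have "0 \<le> m - t" by (rule nonneg_factor)
      then show ?thesis by simp
    qed
  qed
  define \<phi>1 where "\<phi>1 r = max 0 (r - t) * (r + m)" for r
  define \<phi>2 where "\<phi>2 r = max 0 (t - r) * (m - r)" for r
  define \<eta>1 where "\<eta>1 r = (if t \<le> r then 2 * r + m - t else 0) * (b - r)" for r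
  define \<eta>2 where "\<eta>2 r = (if t \<le> r then 0 else 2 * r - m - t) * (- a - r)" for r
  have [measurable]: "\<phi>1 \<in> borel_measurable borel" "\<phi>2 \<in> borel_measurable borel" "\<eta>1 \<in> borel_measurable borel" "\<eta>2 \<in> borel_measurable borel"
    unfolding \<phi>1_def[abs_def] \<phi>2_def[abs_def] \<eta>1_def[abs_def] \<eta>2_def[abs_def] by measurable
  have \<phi>c: "continuous_on UNIV (\<lambda>x. \<phi>1 (s x))" "continuous_on UNIV (\<lambda>x. \<phi>2 (s x))"
    unfolding \<phi>1_def \<phi>2_def by (intro continuous_intros sc)+
  have \<phi>i: "integrable (lborel_on L) (\<lambda>x. \<phi>1 (s x))" "integrable (lborel_on L) (\<lambda>x. \<phi>2 (s x))"
    using \<phi>c by (auto intro: int)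
  have bounded: "\<exists>B. \<forall>x\<in>L. f x \<le> B" if "continuous_on UNIV f" for f :: "'a \<Rightarrow> real"
  proof -
    have "compact (f ` L)" using L(1) that by (intro compact_continuous_image) (auto intro: continuous_on_subset)
    then show ?thesis by (metis bdd_above.E bounded_imp_bdd_above compact_imp_bounded image_eqI)
  qed
  have \<eta>i: "integrable (lborel_on L) (\<lambda>x. \<eta>1 (s x))" "integrable (lborel_on L) (\<lambda>x. \<eta>2 (s x))"
  proof -
    have b1: "\<bar>\<eta>1 r\<bar> \<le> \<bar>(2 * r + m - t) * (b - r)\<bar>" "\<bar>\<eta>2 r\<bar> \<le> \<bar>(2 * r - m - t) * (- a - r)\<bar>" for r
      by (simp_all add: \<eta>1_def \<eta>2_def)
    obtain B where B: "\<forall>x\<in>L. \<bar>(2 * s x + m - t) * (b - s x)\<bar> \<le> B"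
    proof -
      have "continuous_on UNIV (\<lambda>x. \<bar>(2 * s x + m - t) * (b - s x)\<bar>)" by (intro continuous_intros sc)
      from bounded[OF this] show thesis using that by blast
    qed
    show "integrable (lborel_on L) (\<lambda>x. \<eta>1 (s x))"
    proof (rule integrable_const_bound[where B=B])
      show "AE x in lborel_on L. norm (\<eta>1 (s x)) \<le> B"
      proof (rule AE_lborel_on)
        fix x assume "x \<in> L" then show "norm (\<eta>1 (s x)) \<le> B" using B b1(1)[of "s x"] by fastforce
      qed simp
    qed simp
    obtain B where B: "\<forall>x\<in>L. \<bar>(2 * s x - m - t) * (- a - s x)\<bar> \<le> B"
    proof -
      have "continuous_on UNIV (\<lambda>x. \<bar>(2 * s x - m - t) * (- a - s x)\<bar>)" by (intro continuous_intros sc)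
      from bounded[OF this] show thesis using that by blast
    qed
    show "integrable (lborel_on L) (\<lambda>x. \<eta>2 (s x))"
    proof (rule integrable_const_bound[where B=B])
      show "AE x in lborel_on L. norm (\<eta>2 (s x)) \<le> B"
      proof (rule AE_lborel_on)
        fix x assume "x \<in> L" then show "norm (\<eta>2 (s x)) \<le> B" using B b1(2)[of "s x"] by fastforce
      qed simp
    qed simp
  qed
  have up: "(\<integral>x. \<eta>1 (s x) \<partial>lborel_on L) \<le> d * ((\<integral>x. \<phi>1 (s x) \<partial>lborel_on L) - \<kappa> * measure (lborel_on L) W)"
  proof -
    obtain B where B: "\<forall>x\<in>L. \<phi>1 (s x) \<le> B" using bounded[OF \<phi>c(1)] by blast
    have "(\<integral>x. \<eta>1 (s x) \<partial>lborel_on L) \<le> DIM('a) * (\<integral>x. \<phi>1 (s x) - \<kappa> * indicator W x \<partial>lborel_on L)"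
      using L(1,2) PQ(1)
    proof (rule dilation_inequality[where B=B])
      fix x assume x: "x \<in> L"
      show "0 \<le> \<phi>1 (s x) - \<kappa> * indicator W x"
      proof (cases "x \<in> W")
        case True
        then show ?thesis using W\<kappa>[OF x] by (simp add: \<phi>1_def s_def t_def m_def)
      next
        case False
        have "0 \<le> \<phi>1 (s x)" unfolding \<phi>1_def using tm by (cases "t \<le> s x") auto
        then show ?thesis using False by simp
      qed
      show "\<phi>1 (s x) - \<kappa> * indicator W x \<le> B"
        using B x \<kappa> by (smt (verit) indicator_pos_le mult_nonneg_nonneg)
      fix l :: real assume l: "0 < l" "l < 1"
      let ?y = "(1 - l) *\<^sub>R P + l *\<^sub>R x"
      have "(indicator W ?y :: real) \<le> indicator W x"
        using Wcone[OF x l] by (auto simp: indicator_def)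
      then have "\<kappa> * indicator W ?y \<le> \<kappa> * indicator W x" using \<kappa> by (rule mult_left_mono)
      moreover have "\<phi>1 (s x) + (1 - l) * \<eta>1 (s x) \<le> \<phi>1 (s ?y)"
        using quadratic_cut_subgradient[OF tm(1), of "s x" "s ?y"] unfolding sT sP \<phi>1_def \<eta>1_def
        by (auto simp: algebra_simps)
      ultimately show "\<phi>1 (s x) - \<kappa> * indicator W x + (1 - l) * \<eta>1 (s x) \<le> \<phi>1 (s ?y) - \<kappa> * indicator W ?y" by linarith
    qed (use \<eta>i in auto)
    also have "(\<integral>x. \<phi>1 (s x) - \<kappa> * indicator W x \<partial>lborel_on L) = (\<integral>x. \<phi>1 (s x) \<partial>lborel_on L) - \<kappa> * measure (lborel_on L) W"
    proof -
      have "integrable (lborel_on L) (indicator W :: 'a \<Rightarrow> real)"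
        by (rule integrable_const_bound[where B=1]) (auto simp: indicator_def)
      then show ?thesis using \<phi>i by simp
    qed
    finally show ?thesis by (simp add: d_def)
  qed
  have lo: "(\<integral>x. \<eta>2 (s x) \<partial>lborel_on L) \<le> d * (\<integral>x. \<phi>2 (s x) \<partial>lborel_on L)"
  proof -
    obtain B where B: "\<forall>x\<in>L. \<phi>2 (s x) \<le> B" using bounded[OF \<phi>c(2)] by blast
    have "(\<integral>x. \<eta>2 (s x) \<partial>lborel_on L) \<le> DIM('a) * (\<integral>x. \<phi>2 (s x) \<partial>lborel_on L)"
      using L(1,2) PQ(2)
    proof (rule dilation_inequality[where B=B])
      fix x assume x: "x \<in> L"
      show "0 \<le> \<phi>2 (s x)" unfolding \<phi>2_def using tm by (cases "t \<le> s x") auto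
      show "\<phi>2 (s x) \<le> B" using B x by blast
      fix l :: real assume l: "0 < l" "l < 1"
      let ?y = "(1 - l) *\<^sub>R Q + l *\<^sub>R x"
      have "0 \<le> - t + m" using tm by simp
      show "\<phi>2 (s x) + (1 - l) * \<eta>2 (s x) \<le> \<phi>2 (s ?y)"
      proof (cases "t = s x")
        case True
        then show ?thesis unfolding \<phi>2_def \<eta>2_def using tm by (simp add: max_def mult_nonneg_nonneg)
      next
        case False
        with quadratic_cut_subgradient[OF \<open>0 \<le> - t + m\<close>, of "- s x" "- s ?y"]
        show ?thesis unfolding sT sQ \<phi>2_def \<eta>2_def by (auto simp: algebra_simps)
      qed
    qed (use \<eta>i in auto)
    then show ?thesis by (simp add: d_def)
  qed
  define C where "C = (m - t) * b + d * t * m"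
  define A where "A = 2 * b - (d + 1) * (m - t)"
  have C2: "C = a * (m + t) - d * t * m"
  proof -
    have "C - (a * (m + t) - d * t * m) = m * (b - a) - t * (a + b) + 2 * d * t * m"
      by (simp add: C_def algebra_simps)
    also have "\<dots> = m * ((b - a) + (d - 1) * t)" unfolding m[symmetric] by (simp add: algebra_simps)
    finally show ?thesis using t by simp
  qed
  have A2: "A = - 2 * a + (d + 1) * (m + t)"
    using m by (simp add: A_def algebra_simps)
  \<comment> \<open>The linear coefficients of the two pieces agree by the choice of \<open>m\<close>, the constant ones by that of \<open>t\<close>.\<close>
  have pt: "\<eta>1 r - d * \<phi>1 r + (\<eta>2 r - d * \<phi>2 r) = C + A * r - (d + 2) * r\<^sup>2" for r
  proof (cases "t \<le> r")
    case True
    then show ?thesis unfolding \<eta>1_def \<eta>2_def \<phi>1_def \<phi>2_def C_def A_def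
      by (simp add: max_def algebra_simps power2_eq_square)
  next
    case False
    then show ?thesis unfolding \<eta>1_def \<eta>2_def \<phi>1_def \<phi>2_def C2 A2
      by (simp add: max_def algebra_simps power2_eq_square)
  qed
  have "C * V - (d + 2) * (\<integral>x. (s x)\<^sup>2 \<partial>lborel_on L) = (\<integral>x. C + A * s x - (d + 2) * (s x)\<^sup>2 \<partial>lborel_on L)"
    using is1 is2 ms by (simp add: V_def)
  also have "\<dots> = (\<integral>x. \<eta>1 (s x) - d * \<phi>1 (s x) + (\<eta>2 (s x) - d * \<phi>2 (s x)) \<partial>lborel_on L)"
    by (simp only: pt)
  also have "\<dots> = (\<integral>x. \<eta>1 (s x) \<partial>lborel_on L) - d * (\<integral>x. \<phi>1 (s x) \<partial>lborel_on L) + ((\<integral>x. \<eta>2 (s x) \<partial>lborel_on L) - d * (\<integral>x. \<phi>2 (s x) \<partial>lborel_on L))"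
    using \<phi>i \<eta>i by simp
  also have "\<dots> \<le> - (d * \<kappa> * measure (lborel_on L) W)"
    using up lo by (simp add: algebra_simps)
  finally have main: "C * V + d * \<kappa> * measure (lborel_on L) W \<le> (d + 2) * (\<integral>x. (s x)\<^sup>2 \<partial>lborel_on L)" by simp
  have "2 * a * b / (d + 1) \<le> C"
  proof -
    have "(d + 1) * C = b * ((d + 1) * m) + t * (d * ((d + 1) * m) - (d + 1) * b)"
      by (simp add: C_def algebra_simps)
    also have "\<dots> = b * (a + b) + t * (d * a - b)" unfolding m by (simp add: algebra_simps)
    also have "\<dots> = 2 * a * b + (- b * (a - b) + t * (d * a - b))" by (simp add: algebra_simps)
    also have "- b * (a - b) + t * (d * a - b) = d * t * (a - b)"
    proof -
      have "- b * (a - b) = - b * ((d - 1) * t)" by (simp only: t)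
      then show ?thesis by (simp add: algebra_simps)
    qed
    also have "\<dots> = d * (d - 1) * t\<^sup>2" unfolding t[symmetric] by (simp add: power2_eq_square)
    finally have "(d + 1) * C = 2 * a * b + d * (d - 1) * t\<^sup>2" .
    moreover have "0 \<le> d * (d - 1) * t\<^sup>2" using d by simp
    ultimately have "2 * a * b \<le> (d + 1) * C" by linarith
    then show ?thesis using d by (simp add: divide_le_eq mult.commute)
  qed
  then have "2 * a * b / (d + 1) * V \<le> C * V" using V by (intro mult_right_mono) auto
  then show ?thesis using main by (simp add: V_def s_def)
qed

lemma variance_lower_bound:
  fixes L :: "'a::euclidean_space set" and v P Q :: 'a
  assumes L: "compact L" "convex L" "interior L \<noteq> {}" and PQ: "P \<in> L" "Q \<in> L"
    and b: "v \<bullet> P - \<mu> = b" and a: "v \<bullet> Q - \<mu> = - a"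
    and range: "\<And>x. x \<in> L \<Longrightarrow> v \<bullet> x - \<mu> \<in> {-a..b}"
    and mean: "(\<integral>x. v \<bullet> x - \<mu> \<partial>lborel_on L) = 0"
  shows "2 * a * b / (DIM('a) + 1) * measure (lborel_on L) UNIV \<le> (DIM('a) + 2) * (\<integral>x. (v \<bullet> x - \<mu>)\<^sup>2 \<partial>lborel_on L)"
  using variance_lower_bound_gain[OF L PQ b a range mean, of "{}" 0] by (simp add: add.commute)

text \<open>In the case of equality the body would be a double cone. But it contains a ball that touches the supporting
hyperplane at \<open>P = \<rho> v\<close>, so it contains rays from \<open>P\<close> that make an arbitrarily small angle with this
hyperplane. The rays of small slope fill a cone \<open>W\<close> that contains a nonempty open part of the ball and meets
\<open>L\<close> only above height \<open>\<rho> / 2\<close>.\<close>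

lemma variance_lower_bound_strict:
  fixes L :: "'a::euclidean_space set" and v :: 'a
  assumes L: "compact L" "convex L" "cball 0 \<rho> \<subseteq> L" and \<rho>: "0 < \<rho>" and v: "norm v = 1"
    and range: "\<And>x. x \<in> L \<Longrightarrow> \<bar>v \<bullet> x\<bar> \<le> \<rho>"
    and mean: "(\<integral>x. v \<bullet> x \<partial>lborel_on L) = 0" and d: "2 \<le> DIM('a)"
  shows "2 * \<rho>\<^sup>2 / (DIM('a) + 1) * measure (lborel_on L) UNIV < (DIM('a) + 2) * (\<integral>x. (v \<bullet> x)\<^sup>2 \<partial>lborel_on L)"
proof -
  interpret finite_measure "lborel_on L" using L(1) by (rule finite_measure_lborel_on)
  have Lm [measurable]: "L \<in> sets borel" using L(1) by (rule borel_compact)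
  have ball: "ball 0 \<rho> \<subseteq> L" using L(3) ball_subset_cball by blast
  have intL: "interior L \<noteq> {}" using interior_maximal[OF ball] \<rho> by auto
  define P where "P = \<rho> *\<^sub>R v"
  have vv: "v \<bullet> v = 1" using v by (simp add: dot_square_norm)
  have vP: "v \<bullet> P = \<rho>" by (simp add: P_def vv)
  have PL: "P \<in> L" "- P \<in> L" using L(3) \<rho> v by (auto simp: P_def)
  obtain D where D: "D > 0" "\<And>x. x \<in> L \<Longrightarrow> norm (x - P) \<le> D"
  proof -
    obtain B where B: "\<And>x. x \<in> L \<Longrightarrow> norm x \<le> B"
      using compact_imp_bounded[OF L(1)] by (auto simp: bounded_iff)
    show thesis
    proof (rule that[of "\<bar>B\<bar> + norm P + 1"])
      show "0 < \<bar>B\<bar> + norm P + 1" by (smt (verit) norm_ge_zero)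
      fix x assume "x \<in> L"
      have "norm (x - P) \<le> norm x + norm P" by (rule norm_triangle_ineq4)
      then show "norm (x - P) \<le> \<bar>B\<bar> + norm P + 1" using B[OF \<open>x \<in> L\<close>] by linarith
    qed
  qed
  define \<eta> where "\<eta> = \<rho> / (2 * D)"
  have \<eta>: "\<eta> > 0" using \<rho> D by (simp add: \<eta>_def)
  define W where "W = {x. \<rho> - v \<bullet> x \<le> \<eta> * norm (x - P)}"
  have Wm [measurable]: "W \<in> sets borel" unfolding W_def by measurable
  define U where "U = ball 0 \<rho> \<inter> {x. \<rho> - v \<bullet> x < \<eta> * norm (x - P)}"
  have oU: "open U" unfolding U_def by (intro open_Int open_ball open_Collect_less continuous_intros)
  have "U \<noteq> {}"
  proof -
    obtain y where y: "y \<noteq> 0" "orthogonal v y" using orthogonal_to_vector_exists[OF d] by blast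
    define w where "w = (1 / norm y) *\<^sub>R y"
    have vw: "v \<bullet> w = 0" "w \<bullet> v = 0" "w \<bullet> w = 1"
      using y by (simp_all add: w_def orthogonal_def inner_commute) (simp add: dot_square_norm power2_eq_square)
    \<comment> \<open>A point of the ball at depth \<open>\<delta>\<close> below the hyperplane can be at distance of order \<open>sqrt (\<rho> \<delta>)\<close> from \<open>P\<close>,
      so for small \<open>\<delta>\<close> it lies on a ray of slope less than \<open>\<eta>\<close>.\<close>
    define \<delta> where "\<delta> = min \<rho> (\<eta>\<^sup>2 * \<rho>) / 2"
    have \<delta>: "0 < \<delta>" "\<delta> < \<rho>" "\<delta> < \<eta>\<^sup>2 * \<rho>" using \<rho> \<eta> by (auto simp: \<delta>_def min_def)
    define x where "x = (\<rho> - \<delta>) *\<^sub>R v + sqrt (\<rho> * \<delta>) *\<^sub>R w"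
    have sq: "sqrt (\<rho> * \<delta>) * sqrt (\<rho> * \<delta>) = \<rho> * \<delta>" using \<rho> \<delta> by simp
    have "(norm x)\<^sup>2 = (\<rho> - \<delta>)\<^sup>2 + \<rho> * \<delta>"
      unfolding power2_norm_eq_inner x_def using sq by (simp add: inner_add_left inner_add_right vv vw power2_eq_square)
    also have "\<dots> < \<rho>\<^sup>2" using \<delta> mult_strict_left_mono[of \<delta> \<rho> \<delta>] by (simp add: power2_eq_square algebra_simps)
    finally have "norm x < \<rho>" using \<rho> by (simp add: power_less_imp_less_base)
    moreover have "\<rho> - v \<bullet> x < \<eta> * norm (x - P)"
    proof -
      have e: "\<rho> - v \<bullet> x = \<delta>" by (simp add: x_def inner_add_right vv vw)
      have "x - P = sqrt (\<rho> * \<delta>) *\<^sub>R w - \<delta> *\<^sub>R v" by (simp add: x_def P_def algebra_simps)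
      then have "(norm (x - P))\<^sup>2 = \<rho> * \<delta> + \<delta>\<^sup>2"
        unfolding power2_norm_eq_inner using sq by (simp add: inner_diff_left inner_diff_right vv vw power2_eq_square)
      then have "(\<eta> * norm (x - P))\<^sup>2 = \<eta>\<^sup>2 * (\<rho> * \<delta> + \<delta>\<^sup>2)" by (simp add: power_mult_distrib)
      moreover have "\<delta>\<^sup>2 < \<eta>\<^sup>2 * (\<rho> * \<delta> + \<delta>\<^sup>2)"
      proof -
        have "\<delta> * \<delta> < (\<eta>\<^sup>2 * \<rho>) * \<delta>" using \<delta> by (intro mult_strict_right_mono)
        moreover have "0 \<le> \<eta>\<^sup>2 * \<delta>\<^sup>2" by simp
        ultimately show ?thesis by (simp add: power2_eq_square algebra_simps)
      qed
      ultimately have "\<delta>\<^sup>2 < (\<eta> * norm (x - P))\<^sup>2" by simp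
      then show ?thesis unfolding e using \<eta> by (simp add: power_less_imp_less_base)
    qed
    ultimately have "x \<in> U" by (simp add: U_def)
    then show ?thesis by blast
  qed
  then obtain x e where xe: "e > 0" "ball x e \<subseteq> U" using oU open_contains_ball by blast
  have mW: "0 < measure (lborel_on L) W"
  proof -
    have "0 < emeasure lborel (ball x e)" using xe(1) by (rule emeasure_lborel_ball_positive)
    also have "\<dots> \<le> emeasure lborel (L \<inter> W)"
      using xe(2) ball by (intro emeasure_mono) (auto simp: U_def W_def)
    also have "\<dots> = emeasure (lborel_on L) W" by (simp add: emeasure_lborel_on)
    finally show ?thesis by (simp add: emeasure_eq_measure)
  qed
  have Wcone: "x \<in> W" if "0 < l" "(1 - l) *\<^sub>R P + l *\<^sub>R x \<in> W" for x l
  proof -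
    have "\<rho> - v \<bullet> ((1 - l) *\<^sub>R P + l *\<^sub>R x) = l * (\<rho> - v \<bullet> x)" by (simp add: inner_add_right vP algebra_simps)
    moreover have "(1 - l) *\<^sub>R P + l *\<^sub>R x - P = l *\<^sub>R (x - P)" by (simp add: algebra_simps)
    ultimately have "l * (\<rho> - v \<bullet> x) \<le> l * (\<eta> * norm (x - P))" using that by (simp add: W_def)
    then show ?thesis using that(1) by (simp add: W_def)
  qed
  have Wk: "(\<rho> / 2) * (\<rho> / 2) \<le> max 0 (v \<bullet> x - 0 - (\<rho> - \<rho>) / (real DIM('a) - 1)) * (v \<bullet> x - 0 + (\<rho> + \<rho>) / (real DIM('a) + 1))"
    if "x \<in> L" "x \<in> W" for x
  proof -
    have "\<rho> - v \<bullet> x \<le> \<eta> * D"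
      using that(2) D(2)[OF that(1)] \<eta> unfolding W_def by (smt (verit) mem_Collect_eq mult_left_mono)
    then have "\<rho> / 2 \<le> v \<bullet> x" using D(1) by (simp add: \<eta>_def)
    moreover have "0 \<le> (\<rho> + \<rho>) / (real DIM('a) + 1)" using \<rho> by simp
    ultimately have "\<rho> / 2 \<le> v \<bullet> x - 0 + (\<rho> + \<rho>) / (real DIM('a) + 1)" by linarith
    moreover have "\<rho> / 2 \<le> max 0 (v \<bullet> x - 0 - (\<rho> - \<rho>) / (real DIM('a) - 1))"
      using \<open>\<rho> / 2 \<le> v \<bullet> x\<close> by simp
    ultimately show ?thesis using \<rho> by (intro mult_mono) simp_all
  qed
  have "2 * \<rho> * \<rho> / (real DIM('a) + 1) * measure (lborel_on L) UNIV + real DIM('a) * ((\<rho> / 2) * (\<rho> / 2)) * measure (lborel_on L) W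
      \<le> (real DIM('a) + 2) * (\<integral>x. (v \<bullet> x - 0)\<^sup>2 \<partial>lborel_on L)"
  proof (rule variance_lower_bound_gain[OF L(1,2) intL PL _ _ _ _ Wm])
    show "v \<bullet> x - 0 \<in> {-\<rho>..\<rho>}" if "x \<in> L" for x using range[OF that] by auto
    show "v \<bullet> P - 0 = \<rho>" "v \<bullet> - P - 0 = - \<rho>" using vP by simp_all
    show "(\<integral>x. v \<bullet> x - 0 \<partial>lborel_on L) = 0" using mean by simp
    show "0 \<le> \<rho> / 2 * (\<rho> / 2)" by simp
  qed (fact Wk, rule Wcone)
  moreover have "0 < real DIM('a) * ((\<rho> / 2) * (\<rho> / 2)) * measure (lborel_on L) W"
    using \<rho> mW by simp
  ultimately show ?thesis by (simp add: power2_eq_square algebra_simps)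
qed

section \<open>Moments along a line of perspective maps\<close>

text \<open>The mean value theorem bounds the difference quotients by \<open>B\<close>, so dominated convergence applies.\<close>

lemma has_real_derivative_integral:
  fixes f f' :: "real \<Rightarrow> 'a \<Rightarrow> real"
  assumes M: "finite_measure M" and \<tau>: "\<tau> \<in> {a<..<b}"
    and int: "\<And>t. t \<in> {a<..<b} \<Longrightarrow> integrable M (f t)" and int': "integrable M (f' \<tau>)"
    and der: "AE x in M. \<forall>t\<in>{a<..<b}. ((\<lambda>t. f t x) has_real_derivative f' t x) (at t) \<and> \<bar>f' t x\<bar> \<le> B"
  shows "((\<lambda>t. \<integral>x. f t x \<partial>M) has_real_derivative (\<integral>x. f' \<tau> x \<partial>M)) (at \<tau>)"
proof -
  interpret finite_measure M by (rule M)
  have "((\<lambda>t. ((\<integral>x. f t x \<partial>M) - (\<integral>x. f \<tau> x \<partial>M)) / (t - \<tau>)) \<longlongrightarrow> (\<integral>x. f' \<tau> x \<partial>M)) (at \<tau> within {a<..<b})"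
    unfolding tendsto_at_iff_sequentially comp_def
  proof (intro allI impI)
    fix X :: "nat \<Rightarrow> real" assume X: "\<forall>i. X i \<in> {a<..<b} - {\<tau>}" "X \<longlonglongrightarrow> \<tau>"
    have "(\<lambda>i. \<integral>x. (f (X i) x - f \<tau> x) / (X i - \<tau>) \<partial>M) \<longlonglongrightarrow> (\<integral>x. f' \<tau> x \<partial>M)"
    proof (rule integral_dominated_convergence[where w="\<lambda>_. B"])
      show "f' \<tau> \<in> borel_measurable M" using int' by simp
      show "(\<lambda>x. (f (X i) x - f \<tau> x) / (X i - \<tau>)) \<in> borel_measurable M" for i
        using int[of "X i"] int[OF \<tau>] X(1) by (auto intro!: borel_measurable_divide borel_measurable_diff)
      show "AE x in M. (\<lambda>i. (f (X i) x - f \<tau> x) / (X i - \<tau>)) \<longlonglongrightarrow> f' \<tau> x"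
        using der
      proof eventually_elim
        case (elim x)
        then have "((\<lambda>t. f t x) has_real_derivative f' \<tau> x) (at \<tau>)" using \<tau> by blast
        then have "((\<lambda>t. (f t x - f \<tau> x) / (t - \<tau>)) \<longlongrightarrow> f' \<tau> x) (at \<tau>)"
          by (simp add: has_field_derivative_iff)
        from this[unfolded tendsto_at_iff_sequentially comp_def, rule_format, of X]
        show ?case using X by simp
      qed
      show "AE x in M. norm ((f (X i) x - f \<tau> x) / (X i - \<tau>)) \<le> B" for i
        using der
      proof eventually_elim
        case (elim x)
        have "norm (f (X i) x - f \<tau> x) \<le> B * norm (X i - \<tau>)"
        proof (rule field_differentiable_bound[of "{a<..<b}"])
          show "((\<lambda>t. f t x) has_real_derivative f' t x) (at t within {a<..<b})" if "t \<in> {a<..<b}" for t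
            using elim that has_field_derivative_at_within by blast
          show "norm (f' t x) \<le> B" if "t \<in> {a<..<b}" for t using elim that by auto
        qed (use X \<tau> in auto)
        moreover have "norm (X i - \<tau>) > 0" using X by auto
        ultimately show ?case by (simp add: norm_divide divide_le_eq)
      qed
    qed simp
    moreover have "(\<integral>x. (f (X i) x - f \<tau> x) / (X i - \<tau>) \<partial>M) = ((\<integral>x. f (X i) x \<partial>M) - (\<integral>x. f \<tau> x \<partial>M)) / (X i - \<tau>)" for i
      using int[of "X i"] int[OF \<tau>] X(1) by simp
    ultimately show "(\<lambda>i. ((\<integral>x. f (X i) x \<partial>M) - (\<integral>x. f \<tau> x \<partial>M)) / (X i - \<tau>)) \<longlonglongrightarrow> (\<integral>x. f' \<tau> x \<partial>M)"
      by (simp only:)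
  qed
  then have "((\<lambda>t. \<integral>x. f t x \<partial>M) has_real_derivative (\<integral>x. f' \<tau> x \<partial>M)) (at \<tau> within {a<..<b})"
    by (simp add: has_field_derivative_iff)
  moreover have "at \<tau> within {a<..<b} = at \<tau>"
    using \<tau> by (intro at_within_open) auto
  ultimately show ?thesis by simp
qed

text \<open>By compactness \<open>v \<bullet> x\<close> stays away from \<open>1\<close> on \<open>L\<close>, which makes the integrand and its derivative
bounded for \<open>t\<close> in an open interval that contains \<open>[0, 1]\<close>.\<close>

lemma moment_has_derivative:
  fixes L :: "'a::euclidean_space set"
  assumes L: "compact L" and v: "\<And>x. x \<in> L \<Longrightarrow> v \<bullet> x < 1" and \<tau>: "0 \<le> \<tau>" "\<tau> \<le> 1"
  shows "((\<lambda>t. \<integral>x. (v \<bullet> x) ^ j / (1 - t * (v \<bullet> x)) ^ m \<partial>lborel_on L) has_real_derivative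
     real m * (\<integral>x. (v \<bullet> x) ^ Suc j / (1 - \<tau> * (v \<bullet> x)) ^ Suc m \<partial>lborel_on L)) (at \<tau>)"
proof (cases "L = {}")
  case True
  then have "lborel_on L = null_measure borel" by (intro measure_eqI) (simp_all add: emeasure_lborel_on)
  then show ?thesis by (simp add: integral_null_measure)
next
  case False
  have Lm: "L \<in> sets borel" using L by (rule borel_compact)
  have cv: "continuous_on L (\<lambda>x. v \<bullet> x)" by (intro continuous_intros)
  obtain x0 where x0: "x0 \<in> L" "\<And>x. x \<in> L \<Longrightarrow> v \<bullet> x \<le> v \<bullet> x0"
    using continuous_attains_sup[OF L False cv] by blast
  have "bounded ((\<lambda>x. v \<bullet> x) ` L)" using L cv compact_continuous_image compact_imp_bounded by blast
  then obtain S0 where S0: "\<And>x. x \<in> L \<Longrightarrow> \<bar>v \<bullet> x\<bar> \<le> S0" by (auto simp: bounded_iff)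
  define S where "S = \<bar>S0\<bar> + 1"
  have S: "\<And>x. x \<in> L \<Longrightarrow> \<bar>v \<bullet> x\<bar> \<le> S" "1 \<le> S" using S0 unfolding S_def by fastforce+
  define e where "e = 1 - v \<bullet> x0"
  have e: "0 < e" using v x0 by (simp add: e_def)
  define \<delta> where "\<delta> = min (e / 2) (1 / (2 * S))"
  have \<delta>: "0 < \<delta>" "\<delta> \<le> e / 2" "\<delta> * S \<le> 1 / 2"
  proof -
    show "0 < \<delta>" using e S by (simp add: \<delta>_def)
    show "\<delta> \<le> e / 2" by (simp add: \<delta>_def)
    have "\<delta> * S \<le> 1 / (2 * S) * S" using S(2) by (intro mult_right_mono) (auto simp: \<delta>_def)
    then show "\<delta> * S \<le> 1 / 2" using S(2) by simp
  qed
  define c where "c = min (e / 2) (1 / 2)"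
  have c: "0 < c" using e by (simp add: c_def)
  have low: "c \<le> 1 - t * (v \<bullet> x)" if x: "x \<in> L" and t: "t \<in> {-\<delta><..<1 + \<delta>}" for x t
  proof (cases "0 \<le> v \<bullet> x")
    case True
    have "v \<bullet> x \<le> 1 - e" using x0(2)[OF x] by (simp add: e_def)
    have "v \<bullet> x \<le> 1" using v[OF x] by simp
    have "t * (v \<bullet> x) \<le> (1 + \<delta>) * (v \<bullet> x)" using t True by (intro mult_right_mono) auto
    also have "\<dots> \<le> v \<bullet> x + \<delta>" using \<delta>(1) \<open>v \<bullet> x \<le> 1\<close> by (simp add: algebra_simps mult_left_le)
    also have "\<dots> \<le> 1 - e / 2" using \<open>v \<bullet> x \<le> 1 - e\<close> \<delta>(2) by simp
    finally show ?thesis unfolding c_def by linarith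
  next
    case False
    have "t * (v \<bullet> x) \<le> - \<delta> * (v \<bullet> x)" using t False by (intro mult_right_mono_neg) auto
    also have "\<dots> = \<delta> * (- (v \<bullet> x))" by simp
    also have "\<dots> \<le> \<delta> * S" by (rule mult_left_mono) (use S(1)[OF x] \<delta>(1) in auto)
    finally show ?thesis using \<delta>(3) unfolding c_def by linarith
  qed
  have meas: "(\<lambda>x. (v \<bullet> x) ^ i / (1 - t * (v \<bullet> x)) ^ n) \<in> borel_measurable borel" for t i n
    by measurable
  have int: "integrable (lborel_on L) (\<lambda>x. (v \<bullet> x) ^ i / (1 - t * (v \<bullet> x)) ^ n)" if "t \<in> {-\<delta><..<1 + \<delta>}" for t i n
  proof (rule integrable_lborel_on[OF L meas])
    show "continuous_on L (\<lambda>x. (v \<bullet> x) ^ i / (1 - t * (v \<bullet> x)) ^ n)"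
      using low[OF _ that] c by (intro continuous_intros) force
  qed
  have \<tau>': "\<tau> \<in> {-\<delta><..<1 + \<delta>}" using \<tau> \<delta> by auto
  have "((\<lambda>t. \<integral>x. (v \<bullet> x) ^ j / (1 - t * (v \<bullet> x)) ^ m \<partial>lborel_on L) has_real_derivative
     (\<integral>x. real m * ((v \<bullet> x) ^ Suc j / (1 - \<tau> * (v \<bullet> x)) ^ Suc m) \<partial>lborel_on L)) (at \<tau>)"
  proof (rule has_real_derivative_integral[OF finite_measure_lborel_on[OF L] \<tau>' int, where B="real m * (S ^ Suc j / c ^ Suc m)"])
    show "integrable (lborel_on L) (\<lambda>x. real m * ((v \<bullet> x) ^ Suc j / (1 - \<tau> * (v \<bullet> x)) ^ Suc m))"
      using int[OF \<tau>', of "Suc j" "Suc m"] by (rule integrable_mult_right)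
    show "AE x in lborel_on L. \<forall>t\<in>{-\<delta><..<1 + \<delta>}. ((\<lambda>t. (v \<bullet> x) ^ j / (1 - t * (v \<bullet> x)) ^ m) has_real_derivative
        real m * ((v \<bullet> x) ^ Suc j / (1 - t * (v \<bullet> x)) ^ Suc m)) (at t) \<and> \<bar>real m * ((v \<bullet> x) ^ Suc j / (1 - t * (v \<bullet> x)) ^ Suc m)\<bar> \<le> real m * (S ^ Suc j / c ^ Suc m)"
      using Lm
    proof (rule AE_lborel_on, intro ballI conjI)
      fix x t assume x: "x \<in> L" and t: "t \<in> {-\<delta><..<1 + \<delta>}"
      note lo = low[OF x t]
      have pos: "0 < 1 - t * (v \<bullet> x)" using lo c by linarith
      let ?u = "1 - t * (v \<bullet> x)"
      have "((\<lambda>t. (v \<bullet> x) ^ j * inverse (1 - t * (v \<bullet> x)) ^ m) has_real_derivative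
         (v \<bullet> x) ^ j * (real m * inverse ?u ^ (m - 1) * ((v \<bullet> x) * inverse ?u ^ 2))) (at t)"
        using pos by (auto intro!: derivative_eq_intros simp: power2_eq_square)
      moreover have "(v \<bullet> x) ^ j * (real m * inverse ?u ^ (m - 1) * ((v \<bullet> x) * inverse ?u ^ 2)) = real m * ((v \<bullet> x) ^ Suc j / ?u ^ Suc m)"
        by (cases m) (simp_all add: divide_inverse power_inverse power2_eq_square ac_simps)
      moreover have "(\<lambda>t. (v \<bullet> x) ^ j * inverse (1 - t * (v \<bullet> x)) ^ m) = (\<lambda>t. (v \<bullet> x) ^ j / (1 - t * (v \<bullet> x)) ^ m)"
        by (simp add: divide_inverse power_inverse)
      ultimately show "((\<lambda>t. (v \<bullet> x) ^ j / (1 - t * (v \<bullet> x)) ^ m) has_real_derivative real m * ((v \<bullet> x) ^ Suc j / ?u ^ Suc m)) (at t)"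
        by simp
      have "\<bar>v \<bullet> x\<bar> ^ Suc j / ?u ^ Suc m \<le> S ^ Suc j / c ^ Suc m"
      proof (rule frac_le)
        show "\<bar>v \<bullet> x\<bar> ^ Suc j \<le> S ^ Suc j" by (rule power_mono[OF S(1)[OF x]]) simp
        show "c ^ Suc m \<le> ?u ^ Suc m" by (rule power_mono[OF lo]) (use c in simp)
      qed (use S(2) c in simp_all)
      then have "real m * (\<bar>v \<bullet> x\<bar> ^ Suc j / ?u ^ Suc m) \<le> real m * (S ^ Suc j / c ^ Suc m)"
        by (rule mult_left_mono) simp
      moreover have "\<bar>real m * ((v \<bullet> x) ^ Suc j / ?u ^ Suc m)\<bar> = real m * (\<bar>v \<bullet> x\<bar> ^ Suc j / ?u ^ Suc m)"
        using pos by (simp add: abs_mult power_abs)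
      ultimately show "\<bar>real m * ((v \<bullet> x) ^ Suc j / ?u ^ Suc m)\<bar> \<le> real m * (S ^ Suc j / c ^ Suc m)" by simp
    qed
  qed
  then show ?thesis by (simp only: integral_mult_right_zero)
qed

lemma persp_moment:
  fixes L :: "'a::euclidean_space set"
  assumes L: "compact L" and v: "\<And>x. x \<in> L \<Longrightarrow> v \<bullet> x < 1" and \<tau>: "0 \<le> \<tau>" "\<tau> \<le> 1"
  shows "(\<integral>z. (v \<bullet> z) ^ j \<partial>lborel_on (persp (\<tau> *\<^sub>R v) ` L)) = (\<integral>x. (v \<bullet> x) ^ j / (1 - \<tau> * (v \<bullet> x)) ^ (DIM('a) + 1 + j) \<partial>lborel_on L)"
proof -
  have lt: "(\<tau> *\<^sub>R v) \<bullet> x < 1" if "x \<in> L" for x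
  proof (cases "0 \<le> v \<bullet> x")
    case True
    then have "\<tau> * (v \<bullet> x) \<le> v \<bullet> x" using \<tau> by (simp add: mult_left_le_one_le)
    then show ?thesis using v[OF that] by simp
  next
    case False
    then have "\<tau> * (v \<bullet> x) \<le> 0" using \<tau> by (simp add: mult_nonneg_nonpos)
    then show ?thesis by simp
  qed
  have "(\<integral>z. (v \<bullet> z) ^ j \<partial>lborel_on (persp (\<tau> *\<^sub>R v) ` L))
     = (\<integral>x. (1 / (1 - (\<tau> *\<^sub>R v) \<bullet> x) ^ (DIM('a) + 1)) *\<^sub>R (v \<bullet> persp (\<tau> *\<^sub>R v) x) ^ j \<partial>lborel_on L)"
    using lt L by (rule integral_persp_image) measurable
  also have "\<dots> = (\<integral>x. (v \<bullet> x) ^ j / (1 - \<tau> * (v \<bullet> x)) ^ (DIM('a) + 1 + j) \<partial>lborel_on L)"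
    by (intro Bochner_Integration.integral_cong) (simp_all add: persp_def power_add power_divide)
  finally show ?thesis .
qed

text \<open>A function that is strictly increasing at its zeros is positive just after \<open>0\<close>; at its first zero after
that it would have to arrive from above.\<close>

lemma no_two_increasing_zeros:
  fixes g g' :: "real \<Rightarrow> real"
  assumes der: "\<And>t. 0 \<le> t \<Longrightarrow> t \<le> 1 \<Longrightarrow> (g has_real_derivative g' t) (at t)"
    and pos: "\<And>t. 0 \<le> t \<Longrightarrow> t \<le> 1 \<Longrightarrow> g t = 0 \<Longrightarrow> 0 < g' t"
    and zeros: "g 0 = 0" "g 1 = 0"
  shows False
proof -
  obtain d where d: "d > 0" "\<And>h. 0 < h \<Longrightarrow> h < d \<Longrightarrow> g 0 < g (0 + h)"
    using DERIV_pos_inc_right[OF der[of 0] pos[of 0]] zeros by auto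
  define e where "e = min (d / 2) 1"
  have e: "0 < e" "e < d" "e \<le> 1" using d by (auto simp: e_def min_def)
  have right: "0 < g t" if "0 < t" "t \<le> e" for t using d(2)[of t] that e zeros by simp
  define Z where "Z = {t\<in>{e..1}. g t \<le> 0}"
  have cont: "continuous_on {e..1} g"
  proof (rule continuous_at_imp_continuous_on, rule ballI)
    fix t assume "t \<in> {e..1}"
    then show "isCont g t" using e by (intro DERIV_isCont[OF der]) auto
  qed
  have "closed ({e..1} \<inter> g -` {..0})"
    using cont by (rule continuous_closed_preimage) auto
  moreover have "{e..1} \<inter> g -` {..0} = Z" by (auto simp: Z_def)
  ultimately have "closed Z" by simp
  moreover have "1 \<in> Z" using e zeros by (simp add: Z_def)
  moreover have bdd: "bdd_below Z" by (rule bdd_belowI[of _ e]) (simp add: Z_def)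
  ultimately have "Inf Z \<in> Z" by (intro closed_contains_Inf) auto
  define z where "z = Inf Z"
  have z: "e \<le> z" "z \<le> 1" "g z \<le> 0" using \<open>Inf Z \<in> Z\<close> by (auto simp: Z_def z_def)
  have before: "0 < g t" if "0 < t" "t < z" for t
  proof (cases "t \<le> e")
    case False
    show ?thesis
    proof (rule ccontr)
      assume "\<not> 0 < g t"
      then have "t \<in> Z" using False that z by (simp add: Z_def)
      then have "z \<le> t" unfolding z_def using bdd by (rule cInf_lower)
      then show False using that by simp
    qed
  qed (use right that in auto)
  have "e < z" using right[of e] e z by (cases "e = z") auto
  have "0 \<le> g z"
  proof (rule ccontr)
    assume "\<not> 0 \<le> g z"
    moreover have "continuous_on {e..z} g" using cont z by (auto intro: continuous_on_subset)
    moreover have "0 < g e" using right e by auto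
    ultimately obtain t where "e \<le> t" "t \<le> z" "g t = 0"
      using IVT2'[of g z 0 e] z by auto
    then show False using before[of t] e \<open>\<not> 0 \<le> g z\<close> by (cases "t = z") auto
  qed
  then have gz: "g z = 0" using z by simp
  have z01: "0 \<le> z" "z \<le> 1" using z e by auto
  obtain d' where d': "d' > 0" "\<And>h. 0 < h \<Longrightarrow> h < d' \<Longrightarrow> g (z - h) < g z"
    using DERIV_pos_inc_left[OF der[OF z01] pos[OF z01 gz]] by auto
  define h where "h = min (d' / 2) (z / 2)"
  have h: "0 < h" "h < d'" "h < z" using d' z e by (auto simp: h_def min_def)
  have "g (z - h) < 0" using d'(2)[OF h(1,2)] gz by simp
  moreover have "0 < g (z - h)" using h by (intro before) auto
  ultimately show False by simp
qed

text \<open>Let \<open>w = y + t v\<close> and \<open>s = v \<bullet> w / (1 - \<bar>w\<bar>\<^sup>2)\<close>. The directional critical equation at \<open>w\<close> is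
\<open>N 1 t / N 0 t = s\<close>. Since the derivative of \<open>N j\<close> is \<open>(d + 1 + j) N (j + 1)\<close>, and that of \<open>s\<close> is
\<open>\<bar>v\<bar>\<^sup>2 / (1 - \<bar>w\<bar>\<^sup>2) + 2 s\<^sup>2\<close>, the expression in \<open>sgn\<close> is the derivative of the difference of the two sides.
The factor \<open>\<sigma>\<close> allows both signs.\<close>

lemma not_two_critical_points:
  fixes L :: "'a::euclidean_space set" and y v :: 'a and \<sigma> :: real
  defines "N \<equiv> \<lambda>j t. \<integral>z. (v \<bullet> z) ^ j \<partial>lborel_on (persp (t *\<^sub>R v) ` L)"
  assumes L: "compact L" "interior L \<noteq> {}" and v: "\<And>x. x \<in> L \<Longrightarrow> v \<bullet> x < 1"
    and y: "norm y < 1" "norm (y + v) < 1"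
    and sgn: "\<And>t. 0 \<le> t \<Longrightarrow> t \<le> 1 \<Longrightarrow> N 1 t / N 0 t = v \<bullet> (y + t *\<^sub>R v) / (1 - (norm (y + t *\<^sub>R v))\<^sup>2) \<Longrightarrow>
       0 < \<sigma> * ((DIM('a) + 2) * (N 2 t / N 0 t) - (DIM('a) + 1) * (N 1 t / N 0 t)\<^sup>2
          - ((norm v)\<^sup>2 / (1 - (norm (y + t *\<^sub>R v))\<^sup>2) + 2 * (v \<bullet> (y + t *\<^sub>R v) / (1 - (norm (y + t *\<^sub>R v))\<^sup>2))\<^sup>2))"
    and zeros: "N 1 0 / N 0 0 = v \<bullet> y / (1 - (norm y)\<^sup>2)" "N 1 1 / N 0 1 = v \<bullet> (y + v) / (1 - (norm (y + v))\<^sup>2)"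
  shows False
proof -
  let ?d = "DIM('a)"
  define n where "n j t = (\<integral>x. (v \<bullet> x) ^ j / (1 - t * (v \<bullet> x)) ^ (?d + 1 + j) \<partial>lborel_on L)" for j t
  have Nn: "N j t = n j t" if "0 \<le> t" "t \<le> 1" for j t
    unfolding N_def n_def using L(1) v that by (rule persp_moment)
  have n': "(n j has_real_derivative real (?d + 1 + j) * n (Suc j) t) (at t)" if "0 \<le> t" "t \<le> 1" for j t
    using moment_has_derivative[OF L(1) v that, of j "?d + 1 + j"] unfolding n_def by simp
  have n0: "0 < n 0 t" if t: "0 \<le> t" "t \<le> 1" for t
  proof -
    have lt: "(t *\<^sub>R v) \<bullet> x < 1" if "x \<in> L" for x
    proof (cases "0 \<le> v \<bullet> x")
      case True
      then have "t * (v \<bullet> x) \<le> v \<bullet> x" using t by (simp add: mult_left_le_one_le)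
      then show ?thesis using v[OF that] by simp
    next
      case False
      then have "t * (v \<bullet> x) \<le> 0" using t by (simp add: mult_nonneg_nonpos)
      then show ?thesis by simp
    qed
    have "0 < measure (lborel_on (persp (t *\<^sub>R v) ` L)) UNIV"
      using compact_persp_image[OF L(1) lt] interior_persp_image[OF L(2) lt] by (intro measure_lborel_on_pos) auto
    then show ?thesis using Nn[OF t, of 0] by (simp add: N_def)
  qed
  define w where "w t = y + t *\<^sub>R v" for t
  define s where "s t = v \<bullet> w t / (1 - (norm (w t))\<^sup>2)" for t
  have wlt: "norm (w t) < 1" if "0 \<le> t" "t \<le> 1" for t
  proof -
    have "w t = (1 - t) *\<^sub>R y + t *\<^sub>R (y + v)" by (simp add: w_def algebra_simps)
    moreover have "y \<in> ball 0 1" "y + v \<in> ball 0 1" using y by auto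
    ultimately have "w t \<in> ball 0 1" using convexD[OF convex_ball, of y 0 1 "y + v" "1 - t" t] that by simp
    then show ?thesis by simp
  qed
  have q1: "0 < 1 - (norm (w t))\<^sup>2" if "0 \<le> t" "t \<le> 1" for t
    using wlt[OF that] by (simp add: power_less_one_iff abs_square_less_1)
  have wn: "(norm (w t))\<^sup>2 = (norm y)\<^sup>2 + 2 * t * (v \<bullet> y) + t\<^sup>2 * (norm v)\<^sup>2" for t
    unfolding w_def power2_norm_eq_inner by (simp add: inner_add_left inner_add_right inner_commute power2_eq_square)
  have vw: "v \<bullet> w t = v \<bullet> y + t * (norm v)\<^sup>2" for t
    by (simp add: w_def inner_add_right power2_norm_eq_inner)
  have s': "(s has_real_derivative (norm v)\<^sup>2 / (1 - (norm (w t))\<^sup>2) + 2 * (s t)\<^sup>2) (at t)" if t: "0 \<le> t" "t \<le> 1" for t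
  proof -
    have nz: "1 - ((norm y)\<^sup>2 + 2 * t * (v \<bullet> y) + t\<^sup>2 * (norm v)\<^sup>2) \<noteq> 0" using q1[OF t] wn[of t] by simp
    have "((\<lambda>t. (v \<bullet> y + t * (norm v)\<^sup>2) / (1 - ((norm y)\<^sup>2 + 2 * t * (v \<bullet> y) + t\<^sup>2 * (norm v)\<^sup>2))) has_real_derivative
      ((norm v)\<^sup>2 * (1 - ((norm y)\<^sup>2 + 2 * t * (v \<bullet> y) + t\<^sup>2 * (norm v)\<^sup>2)) + (v \<bullet> y + t * (norm v)\<^sup>2) * (2 * (v \<bullet> y + t * (norm v)\<^sup>2)))
        / (1 - ((norm y)\<^sup>2 + 2 * t * (v \<bullet> y) + t\<^sup>2 * (norm v)\<^sup>2))\<^sup>2) (at t)"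
      using nz by (auto intro!: derivative_eq_intros simp: power2_eq_square) (simp add: algebra_simps)
    moreover have "s = (\<lambda>t. (v \<bullet> y + t * (norm v)\<^sup>2) / (1 - ((norm y)\<^sup>2 + 2 * t * (v \<bullet> y) + t\<^sup>2 * (norm v)\<^sup>2)))"
      by (simp add: s_def[abs_def] vw wn)
    moreover have "((norm v)\<^sup>2 * (1 - (norm (w t))\<^sup>2) + v \<bullet> w t * (2 * (v \<bullet> w t))) / (1 - (norm (w t))\<^sup>2)\<^sup>2
       = (norm v)\<^sup>2 / (1 - (norm (w t))\<^sup>2) + 2 * (s t)\<^sup>2"
      using q1[OF t] by (simp add: s_def power2_eq_square add_divide_distrib)
    ultimately show ?thesis unfolding vw wn by simp
  qed
  define g where "g t = \<sigma> * (n 1 t / n 0 t - s t)" for t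
  have g': "(g has_real_derivative \<sigma> * ((?d + 2) * (n 2 t / n 0 t) - (?d + 1) * (n 1 t / n 0 t)\<^sup>2 - ((norm v)\<^sup>2 / (1 - (norm (w t))\<^sup>2) + 2 * (s t)\<^sup>2))) (at t)"
    if t: "0 \<le> t" "t \<le> 1" for t
  proof -
    have d0: "(n 0 has_real_derivative (real ?d + 1) * n 1 t) (at t)" using n'[OF t, of 0] by (simp add: add.commute)
    have d1: "(n 1 has_real_derivative (real ?d + 2) * n 2 t) (at t)" using n'[OF t, of 1] by (simp add: add.commute numeral_2_eq_2)
    have "((\<lambda>t. n 1 t / n 0 t) has_real_derivative (((real ?d + 2) * n 2 t) * n 0 t - n 1 t * ((real ?d + 1) * n 1 t)) / (n 0 t * n 0 t)) (at t)"
      using n0[OF t] by (intro DERIV_divide d0 d1) simp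
    moreover have "(((real ?d + 2) * n 2 t) * n 0 t - n 1 t * ((real ?d + 1) * n 1 t)) / (n 0 t * n 0 t)
       = (?d + 2) * (n 2 t / n 0 t) - (?d + 1) * (n 1 t / n 0 t)\<^sup>2"
      using n0[OF t] by (simp add: diff_divide_distrib power2_eq_square add.commute ac_simps)
    ultimately have "((\<lambda>t. n 1 t / n 0 t) has_real_derivative (?d + 2) * (n 2 t / n 0 t) - (?d + 1) * (n 1 t / n 0 t)\<^sup>2) (at t)" by simp
    from DERIV_cmult[OF DERIV_diff[OF this s'[OF t]], of \<sigma>] show ?thesis unfolding g_def[abs_def] by simp
  qed
  show False
  proof (rule no_two_increasing_zeros[OF g'])
    fix t :: real assume t: "0 \<le> t" "t \<le> 1" and gt: "g t = 0"
    show "0 < \<sigma> * ((?d + 2) * (n 2 t / n 0 t) - (?d + 1) * (n 1 t / n 0 t)\<^sup>2 - ((norm v)\<^sup>2 / (1 - (norm (w t))\<^sup>2) + 2 * (s t)\<^sup>2))"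
    proof (cases "\<sigma> = 0")
      case True
      have "0 < (0::real)" using sgn[of 0] zeros True by simp
      then show ?thesis by simp
    next
      case False
      then have "n 1 t / n 0 t = s t" using gt by (simp add: g_def)
      then show ?thesis using sgn[OF t] Nn[OF t] unfolding s_def w_def by simp
    qed
  next
    show "g 0 = 0" using zeros(1) Nn[of 0] by (simp add: g_def s_def w_def)
    show "g 1 = 0" using zeros(2) Nn[of 1] by (simp add: g_def s_def w_def)
  qed auto
qed

section \<open>Second moments at critical points\<close>

lemma variance_le_of_slab_scaled:
  fixes K :: "'a::euclidean_space set" and v :: 'a
  assumes K: "compact K" "convex K" "interior K \<noteq> {}" and v: "v \<noteq> 0"
    and slab: "\<And>x. x \<in> K \<Longrightarrow> \<bar>v \<bullet> x - m\<bar> \<le> h"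
    and mean: "(\<integral>x. v \<bullet> x - \<mu> \<partial>lborel_on K) = 0"
  shows "(\<integral>x. (v \<bullet> x - \<mu>)\<^sup>2 \<partial>lborel_on K) \<le> h\<^sup>2 / 3 * measure (lborel_on K) UNIV"
proof -
  define n where "n = norm v"
  have n: "n > 0" using v by (simp add: n_def)
  define u where "u = (1 / n) *\<^sub>R v"
  have u: "norm u = 1" using n by (simp add: u_def n_def)
  have ux: "u \<bullet> x - c / n = (1 / n) * (v \<bullet> x - c)" for x c
    by (simp add: u_def diff_divide_distrib)
  have "(\<integral>x. (u \<bullet> x - \<mu> / n)\<^sup>2 \<partial>lborel_on K) \<le> (h / n)\<^sup>2 / 3 * measure (lborel_on K) UNIV"
  proof (rule variance_le_of_slab[OF K u])
    show "\<bar>u \<bullet> x - m / n\<bar> \<le> h / n" if "x \<in> K" for x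
      unfolding ux using slab[OF that] n by (simp add: abs_mult divide_right_mono)
    show "(\<integral>x. u \<bullet> x - \<mu> / n \<partial>lborel_on K) = 0" unfolding ux using mean by simp
  qed
  then have "(1 / n)\<^sup>2 * (\<integral>x. (v \<bullet> x - \<mu>)\<^sup>2 \<partial>lborel_on K) \<le> (1 / n)\<^sup>2 * (h\<^sup>2 / 3 * measure (lborel_on K) UNIV)"
    unfolding ux by (simp add: power_mult_distrib power_divide)
  then show ?thesis using n by simp
qed

lemma second_moment_about_mean:
  fixes K :: "'a::euclidean_space set" and v :: 'a
  assumes K: "compact K" and V: "measure (lborel_on K) UNIV = V" "V > 0" and s: "(\<integral>x. v \<bullet> x \<partial>lborel_on K) / V = s"
  shows "(\<integral>x. v \<bullet> x - s \<partial>lborel_on K) = 0"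
    and "(\<integral>x. (v \<bullet> x)\<^sup>2 \<partial>lborel_on K) = (\<integral>x. (v \<bullet> x - s)\<^sup>2 \<partial>lborel_on K) + s\<^sup>2 * V"
proof -
  interpret finite_measure "lborel_on K" using K by (rule finite_measure_lborel_on)
  have int: "integrable (lborel_on K) f" if "continuous_on UNIV f" for f :: "'a \<Rightarrow> real"
    using K that by (intro integrable_lborel_on) (auto intro: borel_measurable_continuous_onI continuous_on_subset)
  have i: "integrable (lborel_on K) (\<lambda>x. v \<bullet> x)" "integrable (lborel_on K) (\<lambda>x. (v \<bullet> x)\<^sup>2)"
    by (intro int continuous_intros)+
  have m: "(\<integral>x. v \<bullet> x \<partial>lborel_on K) = s * V" using s V(2) by (simp add: field_simps)
  show "(\<integral>x. v \<bullet> x - s \<partial>lborel_on K) = 0" using i m V(1) by simp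
  have "(\<integral>x. (v \<bullet> x - s)\<^sup>2 \<partial>lborel_on K) = (\<integral>x. (v \<bullet> x)\<^sup>2 - 2 * s * (v \<bullet> x) + s\<^sup>2 \<partial>lborel_on K)"
    by (intro Bochner_Integration.integral_cong) (auto simp: power2_eq_square algebra_simps)
  also have "\<dots> = (\<integral>x. (v \<bullet> x)\<^sup>2 \<partial>lborel_on K) - 2 * s * (s * V) + s\<^sup>2 * V"
    using i m V(1) by simp
  finally show "(\<integral>x. (v \<bullet> x)\<^sup>2 \<partial>lborel_on K) = (\<integral>x. (v \<bullet> x - s)\<^sup>2 \<partial>lborel_on K) + s\<^sup>2 * V"
    by (simp add: power2_eq_square)
qed

text \<open>The condition on \<open>z\<close> describes an ellipsoid with center \<open>k p\<close>. For the form \<open>B\<close> below, which is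
positive semidefinite as \<open>r \<bar>p\<bar> < 1\<close>, it says \<open>B w w \<le> k\<close> with \<open>w = z - k p\<close>. The vector \<open>u\<close>
represents \<open>v\<close> with respect to \<open>B\<close>, and the Cauchy-Schwarz inequality for \<open>B\<close> gives the width.\<close>

lemma ellipsoid_width:
  fixes p v z :: "'a::euclidean_space" and r :: real
  defines "k \<equiv> r\<^sup>2 / (1 - r\<^sup>2 * (norm p)\<^sup>2)"
  assumes z: "norm z \<le> r * (1 + p \<bullet> z)" and r: "0 < r" and rp: "r\<^sup>2 * (norm p)\<^sup>2 < 1"
  shows "(v \<bullet> z - k * (v \<bullet> p))\<^sup>2 \<le> k * (norm v)\<^sup>2 + k\<^sup>2 * (v \<bullet> p)\<^sup>2"
proof -
  define q where "q = (norm p)\<^sup>2"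
  define Y where "Y = v \<bullet> p"
  define w where "w = z - k *\<^sub>R p"
  define u where "u = v + (k * Y) *\<^sub>R p"
  define B where "B x y = x \<bullet> y - r\<^sup>2 * ((p \<bullet> x) * (p \<bullet> y))" for x y :: 'a
  have pp: "p \<bullet> p = q" by (simp add: q_def power2_norm_eq_inner)
  have kq: "k * (1 - r\<^sup>2 * q) = r\<^sup>2" using rp by (simp add: k_def q_def)
  have k: "k > 0" using r rp by (simp add: k_def)
  have kr: "k = r\<^sup>2 * (1 + k * q)" using kq by (simp add: algebra_simps)
  have Bnn: "0 \<le> B x x" for x
  proof -
    have "(p \<bullet> x)\<^sup>2 \<le> q * (x \<bullet> x)" using Cauchy_Schwarz_ineq[of p x] pp by simp
    then have "r\<^sup>2 * (p \<bullet> x)\<^sup>2 \<le> r\<^sup>2 * (q * (x \<bullet> x))" by (rule mult_left_mono) simp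
    also have "\<dots> = (r\<^sup>2 * q) * (x \<bullet> x)" by simp
    also have "\<dots> \<le> 1 * (x \<bullet> x)" using rp by (intro mult_right_mono) (auto simp: q_def)
    finally show ?thesis by (simp add: B_def power2_eq_square)
  qed
  have Bwu: "B w u = v \<bullet> w"
  proof -
    have "B w u = w \<bullet> v + (p \<bullet> w) * (k * Y - r\<^sup>2 * (Y + k * Y * q))"
      by (simp add: B_def u_def inner_add_right pp inner_commute Y_def algebra_simps)
    also have "k * Y - r\<^sup>2 * (Y + k * Y * q) = Y * (k - r\<^sup>2 * (1 + k * q))" by (simp add: algebra_simps)
    also have "\<dots> = 0" using kr by simp
    finally show ?thesis by (simp add: inner_commute)
  qed
  have Buu: "B u u = (norm v)\<^sup>2 + k * Y\<^sup>2"
  proof -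
    have "B u u = v \<bullet> v + 2 * (k * Y) * Y + (k * Y)\<^sup>2 * q - r\<^sup>2 * (Y + k * Y * q)\<^sup>2"
      by (simp add: B_def u_def inner_add_right inner_add_left pp inner_commute[of p v] Y_def[symmetric] power2_eq_square algebra_simps)
    also have "Y + k * Y * q = Y * (1 + k * q)" by (simp add: algebra_simps)
    also have "r\<^sup>2 * (Y * (1 + k * q))\<^sup>2 = (r\<^sup>2 * (1 + k * q)) * (1 + k * q) * Y\<^sup>2" by (simp add: power2_eq_square)
    also have "\<dots> = k * (1 + k * q) * Y\<^sup>2" using kr by simp
    finally have "B u u = v \<bullet> v + k * Y\<^sup>2" by (simp add: power2_eq_square algebra_simps)
    then show ?thesis by (simp only: power2_norm_eq_inner)
  qed
  have Bww: "B w w \<le> k"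
  proof -
    have "(norm z)\<^sup>2 \<le> (r * (1 + p \<bullet> z))\<^sup>2" using z by (intro power_mono) auto
    then have zz: "z \<bullet> z - r\<^sup>2 * (1 + p \<bullet> z)\<^sup>2 \<le> 0" by (simp add: power2_norm_eq_inner power_mult_distrib)
    have "B w w = z \<bullet> z - r\<^sup>2 * (p \<bullet> z)\<^sup>2 - 2 * (k * (1 - r\<^sup>2 * q)) * (p \<bullet> z) + k * q * (k * (1 - r\<^sup>2 * q))"
      by (simp add: B_def w_def inner_diff_right inner_diff_left pp inner_commute[of z p] power2_eq_square algebra_simps)
    also have "\<dots> = (z \<bullet> z - r\<^sup>2 * (1 + p \<bullet> z)\<^sup>2) + r\<^sup>2 * (1 + k * q)"
      unfolding kq by (simp add: power2_eq_square algebra_simps)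
    also have "\<dots> \<le> k" using zz kr by simp
    finally show ?thesis .
  qed
  have CS: "(B w u)\<^sup>2 \<le> B w w * B u u"
  proof (cases "B u u = 0")
    case True
    then have "(norm v)\<^sup>2 + k * Y\<^sup>2 = 0" using Buu by simp
    moreover have "0 \<le> (norm v)\<^sup>2" "0 \<le> k * Y\<^sup>2" using k by auto
    ultimately have "v = 0" by (simp add: add_nonneg_eq_0_iff)
    then show ?thesis using True Bwu by simp
  next
    case False
    then have pos: "0 < B u u" using Bnn[of u] by simp
    define l where "l = B w u / B u u"
    have "B (w - l *\<^sub>R u) (w - l *\<^sub>R u) = B w w - 2 * l * B w u + l\<^sup>2 * B u u"
      by (simp add: B_def inner_diff_right inner_diff_left inner_commute power2_eq_square algebra_simps)
    also have "\<dots> = B w w - (B w u)\<^sup>2 / B u u" using pos by (simp add: l_def power2_eq_square field_simps)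
    finally have "0 \<le> B w w - (B w u)\<^sup>2 / B u u" using Bnn by metis
    then show ?thesis using pos by (simp add: field_simps)
  qed
  have "(v \<bullet> z - k * (v \<bullet> p))\<^sup>2 = (B w u)\<^sup>2" unfolding Bwu by (simp add: w_def inner_diff_right)
  also have "\<dots> \<le> k * B u u" using CS Bww Bnn[of u] mult_right_mono[of "B w w" k "B u u"] by linarith
  also have "\<dots> = k * (norm v)\<^sup>2 + k\<^sup>2 * (v \<bullet> p)\<^sup>2" unfolding Buu Y_def by (simp add: power2_eq_square algebra_simps)
  finally show ?thesis .
qed

lemma norm_persp_image_le:
  assumes "norm x \<le> r" "p \<bullet> x < 1"
  shows "norm (persp p x) \<le> r * (1 + p \<bullet> persp p x)"
proof -
  have "1 + p \<bullet> persp p x = 1 / (1 - p \<bullet> x)" using persp_denominator[of p x "- p"] assms by simp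
  then show ?thesis using assms by (simp add: persp_def divide_right_mono)
qed

lemma radius_term_less:
  fixes r q N :: real
  assumes "0 < r" "r < 1" "0 < q" "q < 1" "0 < N"
  shows "N / (1 - r\<^sup>2 * q) < N / (1 - q)"
proof -
  have "r\<^sup>2 < 1" using assms by (simp add: power_less_one_iff)
  then have "r\<^sup>2 * q < 1 * q" using assms by (intro mult_strict_right_mono) auto
  moreover from this have "0 < (1 - r\<^sup>2 * q) * (1 - q)" using assms by (intro mult_pos_pos) linarith+
  ultimately show ?thesis using assms by (intro divide_strict_left_mono) auto
qed

text \<open>The derivative in \<open>not_two_critical_points\<close> is negative. The half-width from \<open>ellipsoid_width\<close>
gives \<open>(d + 2) Var \<le> ((d + 2) r\<^sup>2 / 3) X\<close>, where \<open>X\<close> is \<open>\<bar>v\<bar>\<^sup>2 / (1 - \<bar>p\<bar>\<^sup>2) + s\<^sup>2\<close> with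
\<open>\<bar>p\<bar>\<^sup>2\<close> replaced by \<open>r\<^sup>2 \<bar>p\<bar>\<^sup>2\<close> and a factor \<open>r\<^sup>2\<close> at the second term. The inequality is strict
unless \<open>p = 0\<close> and \<open>(d + 2) r\<^sup>2 = 3\<close>; in this case \<open>d \<ge> 2\<close>, and \<open>variance_less_of_ball\<close> applies.\<close>

lemma ball_body_second_moment:
  fixes K :: "'a::euclidean_space set" and p v :: 'a and r s V :: real
  defines "Z \<equiv> persp p ` K"
  assumes K: "compact K" "convex K" "interior K \<noteq> {}" "K \<subseteq> cball 0 r" and r: "0 < r" "r < 1"
    and dr: "(DIM('a) + 2) * r\<^sup>2 \<le> 3" "(DIM('a) + 2) * r\<^sup>2 < 3 \<or> 2 \<le> DIM('a)"
    and p: "norm p < 1" and v: "v \<noteq> 0"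
    and V: "measure (lborel_on Z) UNIV = V"
    and s: "(\<integral>z. v \<bullet> z \<partial>lborel_on Z) / V = s" "s = v \<bullet> p / (1 - (norm p)\<^sup>2)"
  shows "(DIM('a) + 2) * ((\<integral>z. (v \<bullet> z)\<^sup>2 \<partial>lborel_on Z) / V) - (DIM('a) + 1) * s\<^sup>2 < (norm v)\<^sup>2 / (1 - (norm p)\<^sup>2) + 2 * s\<^sup>2"
proof -
  define d where "d = real DIM('a)"
  define q where "q = (norm p)\<^sup>2"
  define Y where "Y = v \<bullet> p"
  define N where "N = (norm v)\<^sup>2"
  have N: "0 < N" using v by (simp add: N_def)
  have q: "0 \<le> q" "q < 1" using p by (simp_all add: q_def power_less_one_iff)
  have r2: "0 < r\<^sup>2" "r\<^sup>2 < 1" using r by (simp_all add: power_less_one_iff)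
  have rq: "r\<^sup>2 * q < 1" using r2 q by (smt (verit) mult_left_le_one_le)
  have lt: "p \<bullet> x < 1" if "x \<in> K" for x
  proof -
    have "p \<bullet> x \<le> norm p * norm x" by (rule norm_cauchy_schwarz)
    also have "\<dots> \<le> norm p * r" using K(4) that by (intro mult_left_mono) auto
    also have "\<dots> \<le> norm p" using r by (simp add: mult_left_le)
    finally show ?thesis using p by simp
  qed
  have Z: "compact Z" "convex Z" "interior Z \<noteq> {}"
    unfolding Z_def using compact_persp_image[OF K(1) lt] convex_persp_image[OF K(2) lt] interior_persp_image[OF K(3) lt] by auto
  have Vp: "V > 0" using measure_lborel_on_pos[OF Z(1,3)] V by simp
  note mom = second_moment_about_mean[OF Z(1) V Vp s(1)]
  define M where "M = (\<integral>z. (v \<bullet> z - s)\<^sup>2 \<partial>lborel_on Z)"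
  have goal: "(d + 2) * M < (N / (1 - q) + s\<^sup>2) * V"
  proof (cases "p = 0 \<and> 2 \<le> DIM('a)")
    case True
    have ZK: "Z = K" and s0: "s = 0" using True by (simp_all add: Z_def s(2))
    define n where "n = norm v"
    have n: "n > 0" using v by (simp add: n_def)
    define u where "u = (1 / n) *\<^sub>R v"
    have ux: "u \<bullet> x = (1 / n) * (v \<bullet> x)" for x by (simp add: u_def)
    have "(\<integral>x. (u \<bullet> x)\<^sup>2 \<partial>lborel_on K) < r\<^sup>2 / 3 * measure (lborel_on K) UNIV"
    proof (rule variance_less_of_ball[OF K r(1)])
      show "norm u = 1" using n by (simp add: u_def n_def)
      show "(\<integral>x. u \<bullet> x \<partial>lborel_on K) = 0" unfolding ux using mom(1) s0 ZK by simp
    qed (use True in simp)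
    then have "(1 / n)\<^sup>2 * M < r\<^sup>2 / 3 * V"
      unfolding ux M_def s0 using V ZK by (simp add: power_mult_distrib power_divide)
    then have "M < N * (r\<^sup>2 / 3 * V)" using n by (simp add: N_def n_def[symmetric] power_divide field_simps)
    then have "(d + 2) * M < (d + 2) * (N * (r\<^sup>2 / 3 * V))" by (intro mult_strict_left_mono) (auto simp: d_def add.commute)
    also have "\<dots> = ((d + 2) * r\<^sup>2) / 3 * (N * V)" by simp
    also have "\<dots> \<le> 1 * (N * V)" using dr(1) N Vp by (intro mult_right_mono) (auto simp: d_def add.commute)
    finally show ?thesis using True s0 by (simp add: q_def)
  next
    case False
    define k where "k = r\<^sup>2 / (1 - r\<^sup>2 * q)"
    have k: "k > 0" using r2 rq by (simp add: k_def)
    define H where "H = sqrt (k * N + k\<^sup>2 * Y\<^sup>2)"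
    have H2: "H\<^sup>2 = k * N + k\<^sup>2 * Y\<^sup>2" unfolding H_def using k N by (intro real_sqrt_pow2) auto
    have H2': "H\<^sup>2 = r\<^sup>2 * (N / (1 - r\<^sup>2 * q) + r\<^sup>2 * (Y / (1 - r\<^sup>2 * q))\<^sup>2)"
      unfolding H2 k_def by (simp add: power_divide power2_eq_square algebra_simps)
    have slab: "\<bar>v \<bullet> z - k * Y\<bar> \<le> H" if zZ: "z \<in> Z" for z
    proof -
      obtain x where x: "x \<in> K" "z = persp p x" using zZ by (auto simp: Z_def)
      have "norm z \<le> r * (1 + p \<bullet> z)"
        unfolding x(2) using K(4) x(1) lt by (intro norm_persp_image_le) auto
      from ellipsoid_width[OF this r(1), of v] rq
      have "(v \<bullet> z - k * Y)\<^sup>2 \<le> k * N + k\<^sup>2 * Y\<^sup>2" by (simp add: k_def q_def N_def Y_def)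
      then have "sqrt ((v \<bullet> z - k * Y)\<^sup>2) \<le> H" unfolding H_def by (rule real_sqrt_le_mono)
      then show ?thesis by simp
    qed
    have "M \<le> H\<^sup>2 / 3 * V"
      unfolding M_def V[symmetric] using Z v slab mom(1) by (rule variance_le_of_slab_scaled)
    then have "(d + 2) * M \<le> (d + 2) * (H\<^sup>2 / 3 * V)" by (intro mult_left_mono) (auto simp: d_def add.commute)
    also have "\<dots> = ((d + 2) * r\<^sup>2 / 3) * ((N / (1 - r\<^sup>2 * q) + r\<^sup>2 * (Y / (1 - r\<^sup>2 * q))\<^sup>2) * V)"
      unfolding H2' by simp
    also have "\<dots> < (N / (1 - q) + s\<^sup>2) * V"
    proof -
      have sY: "s = Y / (1 - q)" by (simp add: s(2) Y_def q_def)
      have a1: "N / (1 - r\<^sup>2 * q) \<le> N / (1 - q)"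
        using q r2 N rq by (intro divide_left_mono) (auto simp: mult_left_le_one_le)
      have rq': "r\<^sup>2 * q \<le> q" using q r2 by (simp add: mult_left_le_one_le)
      have "(1 - q)\<^sup>2 \<le> (1 - r\<^sup>2 * q)\<^sup>2" using rq' q by (intro power_mono) auto
      then have "Y\<^sup>2 / (1 - r\<^sup>2 * q)\<^sup>2 \<le> Y\<^sup>2 / (1 - q)\<^sup>2" using q rq by (intro divide_left_mono) auto
      then have b: "(Y / (1 - r\<^sup>2 * q))\<^sup>2 \<le> s\<^sup>2" unfolding sY by (simp add: power_divide)
      have "r\<^sup>2 * (Y / (1 - r\<^sup>2 * q))\<^sup>2 \<le> 1 * s\<^sup>2" using b r2 by (intro mult_mono) auto
      then have a2: "r\<^sup>2 * (Y / (1 - r\<^sup>2 * q))\<^sup>2 \<le> s\<^sup>2" by simp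
      let ?X = "N / (1 - r\<^sup>2 * q) + r\<^sup>2 * (Y / (1 - r\<^sup>2 * q))\<^sup>2" and ?R = "N / (1 - q) + s\<^sup>2"
      have X0: "0 < ?X" using N rq by (intro add_pos_nonneg) auto
      have XR: "?X \<le> ?R" using a1 a2 by simp
      have "((d + 2) * r\<^sup>2 / 3) * ?X < ?R"
      proof (cases "(d + 2) * r\<^sup>2 < 3")
        case True
        then have "((d + 2) * r\<^sup>2 / 3) * ?X < 1 * ?X" using X0 by (intro mult_strict_right_mono) auto
        then show ?thesis using XR unfolding mult_1 by (rule less_le_trans)
      next
        case False2: False
        then have "2 \<le> DIM('a)" using dr(2) by (simp add: d_def add.commute)
        then have "p \<noteq> 0" using False by simp
        then have "0 < q" by (simp add: q_def)
        then have "N / (1 - r\<^sup>2 * q) < N / (1 - q)" using radius_term_less r q N by blast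
        then have "?X < ?R" using a2 by simp
        moreover have "((d + 2) * r\<^sup>2 / 3) * ?X \<le> 1 * ?X" using dr(1) X0 by (intro mult_right_mono) (auto simp: d_def add.commute)
        ultimately show ?thesis unfolding mult_1 by (rule le_less_trans[rotated])
      qed
      then have "((d + 2) * r\<^sup>2 / 3) * ?X * V < ?R * V" using Vp by (rule mult_strict_right_mono)
      then show ?thesis by (simp only: mult.assoc)
    qed
    finally show ?thesis .
  qed
  have "(\<integral>z. (v \<bullet> z)\<^sup>2 \<partial>lborel_on Z) / V = M / V + s\<^sup>2"
    using mom(2) Vp by (simp add: M_def add_divide_distrib)
  moreover have "(d + 2) * (M / V) < N / (1 - q) + s\<^sup>2"
    using goal Vp by (simp add: divide_less_eq)
  ultimately have "(d + 2) * ((\<integral>z. (v \<bullet> z)\<^sup>2 \<partial>lborel_on Z) / V) - (d + 1) * s\<^sup>2 < N / (1 - q) + 2 * s\<^sup>2"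
    by (simp add: algebra_simps)
  then show ?thesis by (simp add: d_def q_def N_def add.commute)
qed

text \<open>The derivative in \<open>not_two_critical_points\<close> is positive. Let \<open>\<beta>\<close> and \<open>\<alpha>\<close> be the maximum and the
negative minimum of \<open>v \<bullet> u\<close> on the polar body \<open>D\<close>. Then \<open>v / \<beta>\<close> and \<open>- v / \<alpha>\<close> belong to the polar of \<open>D\<close>, so
\<open>y + v / \<beta>\<close> and \<open>y - v / \<alpha>\<close> lie in the ball of radius \<open>r\<close>. Solving these two quadratic
inequalities bounds the product \<open>a b\<close> of the extents of \<open>D\<close> about its mean \<open>s\<close> from below, and
\<open>variance_lower_bound\<close> applies.

Equality is possible only if \<open>y = 0\<close>, \<open>(d + 1) r\<^sup>2 = 2\<close> and \<open>\<alpha> = \<beta> = \<bar>v\<bar> / r\<close>. In this case \<open>D\<close>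
contains the ball of radius \<open>1 / r\<close>, which touches both supporting hyperplanes, and \<open>variance_lower_bound_strict\<close> applies.\<close>

lemma dual_body_second_moment:
  fixes D :: "'a::euclidean_space set" and y v :: 'a and r s V :: real
  assumes D: "compact D" "convex D" "0 \<in> interior D"
    and r: "0 < r" "r < 1" and dr: "(DIM('a) + 1) * r\<^sup>2 \<le> 2" "(DIM('a) + 1) * r\<^sup>2 < 2 \<or> 2 \<le> DIM('a)"
    and y: "norm y < r" and v: "v \<noteq> 0"
    and dual: "\<And>w. (\<And>u. u \<in> D \<Longrightarrow> w \<bullet> u \<le> 1) \<Longrightarrow> norm (y + w) \<le> r"
    and inball: "y = 0 \<Longrightarrow> cball 0 (1 / r) \<subseteq> D"
    and V: "measure (lborel_on D) UNIV = V"
    and s: "(\<integral>u. v \<bullet> u \<partial>lborel_on D) / V = s" "s = v \<bullet> y / (1 - (norm y)\<^sup>2)"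
  shows "(norm v)\<^sup>2 / (1 - (norm y)\<^sup>2) + 2 * s\<^sup>2 < (DIM('a) + 2) * ((\<integral>u. (v \<bullet> u)\<^sup>2 \<partial>lborel_on D) / V) - (DIM('a) + 1) * s\<^sup>2"
proof -
  define d where "d = real DIM('a)"
  define q where "q = (norm y)\<^sup>2"
  define Y where "Y = v \<bullet> y"
  define N where "N = (norm v)\<^sup>2"
  have N: "0 < N" using v by (simp add: N_def)
  have d1: "1 \<le> d" unfolding d_def by (simp add: Suc_leI)
  have r2: "0 < r\<^sup>2" "r\<^sup>2 < 1" using r by (simp_all add: power_less_one_iff)
  have q: "0 \<le> q" "q < r\<^sup>2" using y by (simp_all add: q_def power_strict_mono)
  have q1: "q < 1" using q r2 by simp
  define R where "R = r\<^sup>2 - q"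
  have R: "0 < R" using q by (simp add: R_def)
  have intD: "interior D \<noteq> {}" using D(3) by blast
  have Vp: "V > 0" using measure_lborel_on_pos[OF D(1) intD] V by simp
  note mom = second_moment_about_mean[OF D(1) V Vp s(1)]
  define M where "M = (\<integral>u. (v \<bullet> u - s)\<^sup>2 \<partial>lborel_on D)"
  have D0: "D \<noteq> {}" using intD interior_subset by auto
  have cv: "continuous_on D (\<lambda>u. v \<bullet> u)" by (intro continuous_intros)
  obtain P where P: "P \<in> D" "\<And>u. u \<in> D \<Longrightarrow> v \<bullet> u \<le> v \<bullet> P"
    using continuous_attains_sup[OF D(1) D0 cv] by blast
  obtain Q where Q: "Q \<in> D" "\<And>u. u \<in> D \<Longrightarrow> v \<bullet> Q \<le> v \<bullet> u"
    using continuous_attains_inf[OF D(1) D0 cv] by blast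
  define \<beta> where "\<beta> = v \<bullet> P"
  define \<alpha> where "\<alpha> = - (v \<bullet> Q)"
  obtain e where e: "e > 0" "ball 0 e \<subseteq> D" using D(3) mem_interior by blast
  define u0 where "u0 = (e / (2 * norm v)) *\<^sub>R v"
  have "norm u0 < e" using v e by (simp add: u0_def)
  then have u0: "u0 \<in> D" "- u0 \<in> D" using e(2) by auto
  have "0 < v \<bullet> u0" using v e by (simp add: u0_def dot_square_norm)
  then have \<beta>: "0 < \<beta>" and \<alpha>: "0 < \<alpha>" using P(2)[OF u0(1)] Q(2)[OF u0(2)] by (auto simp: \<beta>_def \<alpha>_def)
  have yw: "(norm (y + c *\<^sub>R v))\<^sup>2 = q + 2 * c * Y + c\<^sup>2 * N" for c
    unfolding power2_norm_eq_inner q_def Y_def N_def by (simp add: inner_add_left inner_add_right inner_commute power2_eq_square)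
  have b1: "N + 2 * Y * \<beta> \<le> R * \<beta>\<^sup>2"
  proof -
    have "norm (y + (1 / \<beta>) *\<^sub>R v) \<le> r"
      using P(2) \<beta> by (intro dual) (simp add: divide_le_eq \<beta>_def[symmetric])
    then have "(norm (y + (1 / \<beta>) *\<^sub>R v))\<^sup>2 \<le> r\<^sup>2" by (intro power_mono) auto
    then have "\<beta>\<^sup>2 * (q + 2 * (1 / \<beta>) * Y + (1 / \<beta>)\<^sup>2 * N) \<le> \<beta>\<^sup>2 * r\<^sup>2" unfolding yw by (intro mult_left_mono) auto
    moreover have "\<beta>\<^sup>2 * (q + 2 * (1 / \<beta>) * Y + (1 / \<beta>)\<^sup>2 * N) = \<beta>\<^sup>2 * q + 2 * \<beta> * Y + N"
      using \<beta> by (simp add: power2_eq_square field_simps)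
    ultimately show ?thesis by (simp add: R_def algebra_simps)
  qed
  have a1: "N - 2 * Y * \<alpha> \<le> R * \<alpha>\<^sup>2"
  proof -
    have "norm (y + (- (1 / \<alpha>)) *\<^sub>R v) \<le> r"
    proof (rule dual)
      fix u assume "u \<in> D"
      then have "- (v \<bullet> u) \<le> \<alpha>" using Q(2) by (simp add: \<alpha>_def)
      then show "(- (1 / \<alpha>)) *\<^sub>R v \<bullet> u \<le> 1" using \<alpha> by (simp add: field_simps)
    qed
    then have "(norm (y + (- (1 / \<alpha>)) *\<^sub>R v))\<^sup>2 \<le> r\<^sup>2" by (intro power_mono) auto
    then have "\<alpha>\<^sup>2 * (q + 2 * (- (1 / \<alpha>)) * Y + (- (1 / \<alpha>))\<^sup>2 * N) \<le> \<alpha>\<^sup>2 * r\<^sup>2" unfolding yw by (intro mult_left_mono) auto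
    moreover have "\<alpha>\<^sup>2 * (q + 2 * (- (1 / \<alpha>)) * Y + (- (1 / \<alpha>))\<^sup>2 * N) = \<alpha>\<^sup>2 * q - 2 * \<alpha> * Y + N"
      using \<alpha> by (simp add: power2_eq_square field_simps)
    ultimately show ?thesis by (simp add: R_def algebra_simps)
  qed
  define h where "h = sqrt (N / R + (Y / R)\<^sup>2)"
  have h2: "h\<^sup>2 = N / R + (Y / R)\<^sup>2" unfolding h_def using N R by (intro real_sqrt_pow2) auto
  have hY: "\<bar>Y / R\<bar> < h"
  proof -
    have "sqrt ((Y / R)\<^sup>2) < h" unfolding h_def using N R by (intro real_sqrt_less_mono) simp
    then show ?thesis by simp
  qed
  \<comment> \<open>The positive solutions of the quadratic inequality lie above its larger root \<open>c + h\<close>.\<close>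
  have root: "h \<le> x - c" if "0 < x" "N + 2 * (c * R) * x \<le> R * x\<^sup>2" "c\<^sup>2 = (Y / R)\<^sup>2" for x c
  proof -
    have ch: "\<bar>c\<bar> < h" using hY that(3) by (metis power2_eq_iff abs_minus_cancel)
    have "N / R + 2 * c * x \<le> x\<^sup>2"
      using that(2) R by (simp add: field_simps)
    then have "h\<^sup>2 \<le> (x - c)\<^sup>2" unfolding h2 that(3)[symmetric] by (simp add: power2_eq_square algebra_simps)
    then have "\<bar>h\<bar> \<le> \<bar>x - c\<bar>" by (simp add: abs_le_square_iff)
    moreover have "- h < x - c" using that(1) ch by linarith
    ultimately show ?thesis using ch by linarith
  qed
  have hb: "h \<le> \<beta> - Y / R" using b1 R by (intro root \<beta>) simp_all
  have ha: "h \<le> \<alpha> + Y / R" using root[of \<alpha> "- (Y / R)"] a1 R \<alpha> by simp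
  define a where "a = \<alpha> + s"
  define b where "b = \<beta> - s"
  have sY: "s = Y / (1 - q)" by (simp add: s(2) Y_def q_def)
  define c where "c = Y / R - s"
  \<comment> \<open>The mean \<open>s\<close> lies between \<open>0\<close> and \<open>Y / R\<close>.\<close>
  have cY: "\<bar>c\<bar> \<le> \<bar>Y / R\<bar>"
  proof -
    have "0 \<le> s * (Y / R)" using q1 R unfolding sY by (simp add: zero_le_divide_iff zero_le_mult_iff)
    moreover have "\<bar>s\<bar> \<le> \<bar>Y / R\<bar>"
    proof -
      have "\<bar>Y\<bar> / (1 - q) \<le> \<bar>Y\<bar> / R" using R r2 by (intro divide_left_mono) (auto simp: R_def)
      then show ?thesis using q1 R by (simp add: sY)
    qed
    ultimately show ?thesis unfolding c_def by (smt (verit) mult_neg_pos mult_pos_neg)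
  qed
  have bh: "h + c \<le> b" and ah: "h - c \<le> a" using ha hb by (simp_all add: a_def b_def c_def)
  have hc: "0 < h + c" "0 < h - c" using cY hY by linarith+
  have ab: "h\<^sup>2 - c\<^sup>2 \<le> a * b"
  proof -
    have "(h - c) * (h + c) \<le> a * b" using ah bh hc by (intro mult_mono) auto
    then show ?thesis by (simp add: power2_eq_square algebra_simps)
  qed
  have hc2: "h\<^sup>2 - c\<^sup>2 = N / R + 2 * s * (Y / R) - s\<^sup>2"
    unfolding h2 c_def by (simp add: power2_eq_square algebra_simps)
  have ab0: "0 < a * b" using ah bh hc by (intro mult_pos_pos) auto
  have var: "2 * a * b / (d + 1) * V \<le> (d + 2) * M"
  proof -
    have "v \<bullet> u - s \<in> {-a..b}" if "u \<in> D" for u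
      using P(2)[OF that] Q(2)[OF that] by (simp add: a_def b_def \<alpha>_def \<beta>_def)
    then show ?thesis
      using variance_lower_bound[OF D(1,2) intD P(1) Q(1), of v s b a] mom(1)
      unfolding M_def V d_def by (simp add: a_def b_def \<alpha>_def \<beta>_def add.commute)
  qed
  have main: "r\<^sup>2 * (h\<^sup>2 - c\<^sup>2) = r\<^sup>2 / R * N + 2 * (r\<^sup>2 / R) * (s * Y) - r\<^sup>2 * s\<^sup>2"
    unfolding hc2 by (simp add: algebra_simps)
  have ss: "s\<^sup>2 = (s * Y) / (1 - q)" unfolding sY by (simp add: power2_eq_square)
  have sYn: "0 \<le> s * Y" unfolding sY using q1 by (simp add: zero_le_divide_iff zero_le_mult_iff)
  have rR: "1 / (1 - q) \<le> r\<^sup>2 / R"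
  proof -
    have "R \<le> r\<^sup>2 * (1 - q)" using r2 q mult_left_le_one_le[of q "r\<^sup>2"] by (simp add: R_def algebra_simps)
    then show ?thesis using R q1 by (simp add: field_simps)
  qed
  have rest: "s\<^sup>2 \<le> 2 * (r\<^sup>2 / R) * (s * Y) - r\<^sup>2 * s\<^sup>2"
  proof -
    have "2 * s\<^sup>2 \<le> 2 * (r\<^sup>2 / R) * (s * Y)"
      using mult_right_mono[OF rR sYn] by (simp add: ss)
    moreover have "r\<^sup>2 * s\<^sup>2 \<le> 1 * s\<^sup>2" using r2 by (intro mult_right_mono) auto
    ultimately show ?thesis by simp
  qed
  have weak: "N / (1 - q) + s\<^sup>2 \<le> r\<^sup>2 * (h\<^sup>2 - c\<^sup>2)"
    using main rest mult_right_mono[OF rR, of N] N by simp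
  have goal: "(N / (1 - q) + s\<^sup>2) * V < (d + 2) * M"
  proof (cases "(d + 1) * r\<^sup>2 < 2")
    case True
    have "N / (1 - q) + s\<^sup>2 \<le> r\<^sup>2 * (a * b)" using weak ab r2 by (smt (verit) mult_left_mono)
    also have "\<dots> < 2 / (d + 1) * (a * b)"
      using True ab0 d1 by (intro mult_strict_right_mono) (auto simp: field_simps)
    finally have "(N / (1 - q) + s\<^sup>2) * V < 2 / (d + 1) * (a * b) * V" using Vp by (rule mult_strict_right_mono)
    then show ?thesis using var by simp
  next
    case False
    then have d2: "2 \<le> DIM('a)" using dr(2) by (simp add: d_def add.commute)
    have r2d: "r\<^sup>2 = 2 / (d + 1)" using False dr(1) d1 by (simp add: d_def field_simps)
    have rv: "r\<^sup>2 * (a * b) * V \<le> (d + 2) * M" using var unfolding r2d by simp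
    show ?thesis
    proof (cases "y = 0")
      case False
      have "0 < q" using False by (simp add: q_def)
      then have "1 / (1 - q) < r\<^sup>2 / R"
      proof -
        have "r\<^sup>2 * q < 1 * q" using r2 \<open>0 < q\<close> by (intro mult_strict_right_mono) auto
        then have "R < r\<^sup>2 * (1 - q)" by (simp add: R_def algebra_simps)
        then show ?thesis using R q1 by (simp add: field_simps)
      qed
      then have "N / (1 - q) + s\<^sup>2 < r\<^sup>2 * (h\<^sup>2 - c\<^sup>2)"
        using main rest mult_strict_right_mono[OF _ N, of "1 / (1 - q)" "r\<^sup>2 / R"] by simp
      also have "\<dots> \<le> r\<^sup>2 * (a * b)" using ab r2 by (intro mult_left_mono) auto
      finally have "(N / (1 - q) + s\<^sup>2) * V < r\<^sup>2 * (a * b) * V" using Vp by (rule mult_strict_right_mono)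
      then show ?thesis using rv by simp
    next
      case True
      have z: "s = 0" "q = 0" "Y = 0" using True by (simp_all add: s(2) q_def Y_def)
      have ab': "a = \<alpha>" "b = \<beta>" using z by (simp_all add: a_def b_def)
      define n where "n = norm v"
      have n: "n > 0" using v by (simp add: n_def)
      have Nn: "N = n\<^sup>2" by (simp add: N_def n_def)
      have hn: "h = n / r" unfolding h_def using z n r by (simp add: R_def Nn real_sqrt_divide)
      have ge: "n / r \<le> \<alpha>" "n / r \<le> \<beta>" using ha hb z hn by simp_all
      show ?thesis
      proof (cases "\<alpha> = n / r \<and> \<beta> = n / r")
        case True2: True
        define u where "u = (1 / n) *\<^sub>R v"
        have ux: "u \<bullet> x = (1 / n) * (v \<bullet> x)" for x by (simp add: u_def)
        have "2 * (1 / r)\<^sup>2 / (DIM('a) + 1) * measure (lborel_on D) UNIV < (DIM('a) + 2) * (\<integral>x. (u \<bullet> x)\<^sup>2 \<partial>lborel_on D)"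
        proof (rule variance_lower_bound_strict[OF D(1,2) inball[OF True] _ _ _ _ d2])
          show "0 < 1 / r" using r by simp
          show "norm u = 1" using n by (simp add: u_def n_def)
          show "\<bar>u \<bullet> x\<bar> \<le> 1 / r" if "x \<in> D" for x
          proof -
            have "\<bar>v \<bullet> x\<bar> \<le> n / r" using P(2)[OF that] Q(2)[OF that] True2 by (simp add: \<alpha>_def \<beta>_def abs_le_iff)
            then show ?thesis unfolding ux using n r by (simp add: abs_mult field_simps)
          qed
          show "(\<integral>x. u \<bullet> x \<partial>lborel_on D) = 0" unfolding ux using mom(1) z by simp
        qed
        then have "2 * (1 / r)\<^sup>2 / (d + 1) * V < (d + 2) * ((1 / n)\<^sup>2 * M)"
          unfolding ux M_def d_def V z by (simp add: power_mult_distrib power_divide add.commute)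
        moreover have "2 * (1 / r)\<^sup>2 / (d + 1) = 1"
        proof -
          have "2 * (1 / r)\<^sup>2 / (d + 1) = (2 / (d + 1)) / r\<^sup>2" by (simp add: power_divide)
          also have "\<dots> = 1" unfolding r2d[symmetric] using r2 by simp
          finally show ?thesis .
        qed
        ultimately have "V < (d + 2) * ((1 / n)\<^sup>2 * M)" by simp
        then have "n\<^sup>2 * V < n\<^sup>2 * ((d + 2) * ((1 / n)\<^sup>2 * M))" using n by (intro mult_strict_left_mono) auto
        also have "\<dots> = (d + 2) * M" using n by (simp add: power_divide)
        finally show ?thesis using z by (simp add: Nn)
      next
        case False
        have nr: "0 < n / r" using n r by simp
        have "(n / r) * (n / r) < \<alpha> * \<beta>"
        proof (cases "\<alpha> = n / r")
          case True
          then have "n / r < \<beta>" using False ge by simp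
          then show ?thesis unfolding True using nr by (rule mult_strict_left_mono)
        next
          case False
          then have "n / r < \<alpha>" using ge by simp
          then have "(n / r) * (n / r) < \<alpha> * (n / r)" using nr by (rule mult_strict_right_mono)
          also have "\<dots> \<le> \<alpha> * \<beta>" using ge \<alpha> by (intro mult_left_mono) auto
          finally show ?thesis .
        qed
        then have "r\<^sup>2 * ((n / r) * (n / r)) < r\<^sup>2 * (a * b)" unfolding ab' using r2 by (intro mult_strict_left_mono) auto
        moreover have "r\<^sup>2 * ((n / r) * (n / r)) = N" using r by (simp add: Nn power2_eq_square)
        ultimately have "N * V < r\<^sup>2 * (a * b) * V" using Vp by simp
        then show ?thesis using rv z by simp
      qed
    qed
  qed
  have "(\<integral>u. (v \<bullet> u)\<^sup>2 \<partial>lborel_on D) / V = M / V + s\<^sup>2"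
    using mom(2) Vp by (simp add: M_def add_divide_distrib)
  moreover have "N / (1 - q) + s\<^sup>2 < (d + 2) * (M / V)"
    using goal Vp by (simp add: less_divide_eq)
  ultimately have "N / (1 - q) + 2 * s\<^sup>2 < (d + 2) * ((\<integral>u. (v \<bullet> u)\<^sup>2 \<partial>lborel_on D) / V) - (d + 1) * s\<^sup>2"
    by (simp add: algebra_simps)
  then show ?thesis by (simp add: d_def q_def N_def add.commute)
qed

section \<open>Critical points of the volume functional\<close>

lemma centroid_lborel_on:
  fixes K :: "'a::euclidean_space set"
  assumes "compact K"
  shows "centroid K = (1 / measure (lborel_on K) UNIV) *\<^sub>R (\<integral>x. x \<partial>lborel_on K)"
  unfolding centroid_def using assms by (simp add: measure_lborel_on integral_lborel_on)

lemma inner_centroid: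
  fixes K :: "'a::euclidean_space set"
  assumes "compact K"
  shows "v \<bullet> centroid K = (\<integral>x. v \<bullet> x \<partial>lborel_on K) / measure (lborel_on K) UNIV"
proof -
  have "integrable (lborel_on K) (\<lambda>x. x)"
    using assms by (intro integrable_lborel_on) auto
  then show ?thesis using assms by (simp add: centroid_lborel_on)
qed

text \<open>The volume scales by the constant of \<open>lborel_linear\<close>, which cancels in the centroid.\<close>

lemma centroid_affine_image:
  fixes K :: "'a::euclidean_space set" and f :: "'a \<Rightarrow> 'a"
  assumes K: "compact K" "interior K \<noteq> {}" and f: "linear f" "inj f"
  shows "centroid ((\<lambda>x. a + f x) ` K) = a + f (centroid K)"
proof -
  interpret finite_measure "lborel_on K" using K(1) by (rule finite_measure_lborel_on)
  let ?T = "\<lambda>x. a + f x"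
  have [measurable]: "f \<in> borel_measurable borel" using f(1) by (rule linear_borel_measurable)
  have fc: "continuous_on A f" for A using f(1) by (simp add: linear_continuous_on linear_linear)
  have cT: "compact (?T ` K)" using K(1) by (intro compact_continuous_image continuous_intros fc)
  have [measurable]: "K \<in> sets borel" "?T ` K \<in> sets borel" using K(1) cT by (auto intro: borel_compact)
  obtain c :: real where c0: "c > 0" and c1: "\<forall>h\<in>borel_measurable borel. (\<integral>\<^sup>+y. h (f y) \<partial>lborel) = ennreal c * (\<integral>\<^sup>+x. h x \<partial>lborel)"
    using lborel_linear[OF f] by (elim exE conjE) (rule that)
  note c = c0 bspec[OF c1]
  have "inj ?T" by (rule injI) (simp add: inj_eq[OF f(2)])
  then have mem: "?T x \<in> ?T ` K \<longleftrightarrow> x \<in> K" for x by (rule inj_image_mem_iff)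
  have d: "distr (lborel_on K) borel ?T = density (lborel_on (?T ` K)) (\<lambda>_. ennreal c)"
  proof (rule measure_eqI)
    fix A assume "A \<in> sets (distr (lborel_on K) borel ?T)"
    then have [measurable]: "A \<in> sets borel" by simp
    have "emeasure (distr (lborel_on K) borel ?T) A = (\<integral>\<^sup>+y. indicator A y \<partial>distr (lborel_on K) borel ?T)" by simp
    also have "\<dots> = (\<integral>\<^sup>+x. indicator A (?T x) \<partial>lborel_on K)" by (rule nn_integral_distr) auto
    also have "\<dots> = (\<integral>\<^sup>+x. indicator A (?T x) * indicator (?T ` K) (?T x) \<partial>lborel)"
      by (subst nn_integral_lborel_on) (auto intro!: nn_integral_cong simp: indicator_def mem)
    also have "\<dots> = ennreal c * (\<integral>\<^sup>+y. indicator A (a + y) * indicator (?T ` K) (a + y) \<partial>lborel)"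
      by (rule c(2)) simp
    also have "(\<integral>\<^sup>+y. indicator A (a + y) * indicator (?T ` K) (a + y) \<partial>lborel) = (\<integral>\<^sup>+y. indicator A y * indicator (?T ` K) y \<partial>lborel)"
      by (subst (2) nn_integral_lborel_affine[where c=1 and t=a]) simp_all
    also have "(\<integral>\<^sup>+y. indicator A y * indicator (?T ` K) y \<partial>lborel) = emeasure (lborel_on (?T ` K)) A"
      by (subst nn_integral_lborel_on[symmetric]) auto
    also have "ennreal c * \<dots> = emeasure (density (lborel_on (?T ` K)) (\<lambda>_. ennreal c)) A"
      by (simp add: emeasure_density_const)
    finally show "emeasure (distr (lborel_on K) borel ?T) A = emeasure (density (lborel_on (?T ` K)) (\<lambda>_. ennreal c)) A" .
  qed simp
  have i: "(\<integral>x. h (?T x) \<partial>lborel_on K) = c *\<^sub>R (\<integral>y. h y \<partial>lborel_on (?T ` K))"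
    if [measurable]: "h \<in> borel_measurable borel" for h :: "'a \<Rightarrow> 'b::{banach, second_countable_topology}"
  proof -
    have "(\<integral>x. h (?T x) \<partial>lborel_on K) = (\<integral>y. h y \<partial>distr (lborel_on K) borel ?T)"
      by (rule integral_distr[symmetric]) auto
    also have "\<dots> = (\<integral>y. c *\<^sub>R h y \<partial>lborel_on (?T ` K))"
      unfolding d using c(1) by (intro integral_density) auto
    finally show ?thesis by simp
  qed
  define V where "V = measure (lborel_on K) UNIV"
  have V: "V > 0" unfolding V_def using K by (rule measure_lborel_on_pos)
  have VT: "V = c * measure (lborel_on (?T ` K)) UNIV"
    using i[of "\<lambda>_. 1::real"] by (simp add: V_def)
  have int: "integrable (lborel_on K) (\<lambda>x. x)" using K(1) by (intro integrable_lborel_on) auto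
  have bl: "bounded_linear f" using f(1) by (simp add: linear_linear)
  have "c *\<^sub>R (\<integral>y. y \<partial>lborel_on (?T ` K)) = (\<integral>x. a + f x \<partial>lborel_on K)"
    using i[of "\<lambda>y. y"] by simp
  also have "\<dots> = V *\<^sub>R a + f (\<integral>x. x \<partial>lborel_on K)"
    using int integrable_bounded_linear[OF bl int] integral_bounded_linear[OF bl int]
    by (simp add: V_def)
  also have "(\<integral>x. x \<partial>lborel_on K) = V *\<^sub>R centroid K" using V K(1) by (simp add: centroid_lborel_on V_def)
  also have "V *\<^sub>R a + f (V *\<^sub>R centroid K) = V *\<^sub>R (a + f (centroid K))"
    using f(1) by (simp add: linear_scale scaleR_add_right)
  finally have "c *\<^sub>R (\<integral>y. y \<partial>lborel_on (?T ` K)) = V *\<^sub>R (a + f (centroid K))" .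
  then have "(1 / V) *\<^sub>R (c *\<^sub>R (\<integral>y. y \<partial>lborel_on (?T ` K))) = a + f (centroid K)" using V by simp
  moreover have "centroid (?T ` K) = (c / V) *\<^sub>R (\<integral>y. y \<partial>lborel_on (?T ` K))"
    using VT V c(1) cT by (simp add: centroid_lborel_on)
  ultimately show ?thesis by simp
qed

lemma persp_volume:
  fixes K :: "'a::euclidean_space set"
  assumes K: "compact K" "\<And>x. x \<in> K \<Longrightarrow> p \<bullet> x < 1"
  shows "measure (lborel_on (persp p ` K)) UNIV = (\<integral>x. 1 / (1 - p \<bullet> x) ^ (DIM('a) + 1) \<partial>lborel_on K)"
proof -
  have "(\<integral>z. (1::real) \<partial>lborel_on (persp p ` K)) = (\<integral>x. (1 / (1 - p \<bullet> x) ^ (DIM('a) + 1)) *\<^sub>R 1 \<partial>lborel_on K)"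
    using K by (intro integral_persp_image borel_measurable_const)
  then show ?thesis by simp
qed

lemma continuous_on_persp_volume:
  fixes K :: "'a::euclidean_space set"
  assumes K: "compact K" and P: "compact P" and PK: "\<And>p x. p \<in> P \<Longrightarrow> x \<in> K \<Longrightarrow> p \<bullet> x < 1"
  shows "continuous_on P (\<lambda>p. measure (lborel_on (persp p ` K)) UNIV)"
proof (cases "P \<times> K = {}")
  case True
  then show ?thesis by (cases "P = {}") (auto intro: continuous_on_const)
next
  case False
  interpret finite_measure "lborel_on K" using K by (rule finite_measure_lborel_on)
  have "continuous_on (P \<times> K) (\<lambda>z. 1 - fst z \<bullet> snd z)" by (intro continuous_intros)
  then obtain z where z: "z \<in> P \<times> K" "\<And>w. w \<in> P \<times> K \<Longrightarrow> 1 - fst z \<bullet> snd z \<le> 1 - fst w \<bullet> snd w"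
    using continuous_attains_inf[OF compact_Times[OF P K] False] by blast
  define c where "c = 1 - fst z \<bullet> snd z"
  have c: "0 < c" using z(1) PK by (auto simp: c_def)
  have low: "c \<le> 1 - p \<bullet> x" if "p \<in> P" "x \<in> K" for p x
    using z(2)[of "(p, x)"] that by (simp add: c_def)
  have "continuous_on P (\<lambda>p. \<integral>x. 1 / (1 - p \<bullet> x) ^ (DIM('a) + 1) \<partial>lborel_on K)"
    unfolding continuous_on_sequentially comp_def
  proof (intro allI ballI impI)
    fix X p assume X: "p \<in> P" "(\<forall>n. X n \<in> P) \<and> X \<longlonglongrightarrow> p"
    show "(\<lambda>n. \<integral>x. 1 / (1 - X n \<bullet> x) ^ (DIM('a) + 1) \<partial>lborel_on K) \<longlonglongrightarrow> (\<integral>x. 1 / (1 - p \<bullet> x) ^ (DIM('a) + 1) \<partial>lborel_on K)"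
    proof (rule integral_dominated_convergence[where w="\<lambda>_. 1 / c ^ (DIM('a) + 1)"])
      show "AE x in lborel_on K. (\<lambda>n. 1 / (1 - X n \<bullet> x) ^ (DIM('a) + 1)) \<longlonglongrightarrow> 1 / (1 - p \<bullet> x) ^ (DIM('a) + 1)"
        using borel_compact[OF K]
      proof (rule AE_lborel_on)
        fix x assume "x \<in> K"
        then have "(1 - p \<bullet> x) ^ (DIM('a) + 1) \<noteq> 0" using PK[OF X(1)] by force
        then show "(\<lambda>n. 1 / (1 - X n \<bullet> x) ^ (DIM('a) + 1)) \<longlonglongrightarrow> 1 / (1 - p \<bullet> x) ^ (DIM('a) + 1)"
          using X(2) by (intro tendsto_intros) auto
      qed
      show "AE x in lborel_on K. norm (1 / (1 - X n \<bullet> x) ^ (DIM('a) + 1)) \<le> 1 / c ^ (DIM('a) + 1)" for n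
        using borel_compact[OF K]
      proof (rule AE_lborel_on)
        fix x assume "x \<in> K"
        then have lo: "c \<le> 1 - X n \<bullet> x" using low X(2) by blast
        then have "c ^ (DIM('a) + 1) \<le> (1 - X n \<bullet> x) ^ (DIM('a) + 1)" using c by (intro power_mono) auto
        moreover have "0 < c ^ (DIM('a) + 1)" using c by (rule zero_less_power)
        ultimately have "1 / (1 - X n \<bullet> x) ^ (DIM('a) + 1) \<le> 1 / c ^ (DIM('a) + 1)" by (intro divide_left_mono) auto
        moreover have "0 \<le> 1 / (1 - X n \<bullet> x) ^ (DIM('a) + 1)"
          using \<open>0 < c ^ (DIM('a) + 1)\<close> \<open>c ^ (DIM('a) + 1) \<le> (1 - X n \<bullet> x) ^ (DIM('a) + 1)\<close> by (intro divide_nonneg_nonneg) linarith+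
        ultimately show "norm (1 / (1 - X n \<bullet> x) ^ (DIM('a) + 1)) \<le> 1 / c ^ (DIM('a) + 1)" by (simp only: real_norm_def abs_of_nonneg)
      qed
    qed auto
  qed
  then show ?thesis
    by (rule continuous_on_eq) (use persp_volume[OF K] PK in \<open>simp add: persp_volume[OF K]\<close>)
qed

text \<open>At an extremum, the derivative at \<open>t = 0\<close> along \<open>u = t v\<close> vanishes. The logarithmic derivative of the volume is
\<open>(d + 1) v \<bullet> centroid L\<close> and that of \<open>1 - \<bar>y + t v\<bar>\<^sup>2\<close> is \<open>- 2 v \<bullet> y / (1 - \<bar>y\<bar>\<^sup>2)\<close>. The volume is squared
so that the exponent \<open>d + 1\<close> is an integer.\<close>

lemma critical_at_extremum:
  fixes L :: "'a::euclidean_space set" and y :: 'a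
  defines "G \<equiv> \<lambda>u. (measure (lborel_on (persp u ` L)) UNIV)\<^sup>2 * (1 - (norm (y + u))\<^sup>2) ^ (DIM('a) + 1)"
  assumes L: "compact L" "interior L \<noteq> {}" and y: "norm y < 1" and \<delta>: "0 < \<delta>"
    and ext: "(\<forall>u. norm u < \<delta> \<longrightarrow> G u \<le> G 0) \<or> (\<forall>u. norm u < \<delta> \<longrightarrow> G 0 \<le> G u)"
  shows "centroid L = (1 / (1 - (norm y)\<^sup>2)) *\<^sub>R y"
proof -
  let ?d = "DIM('a)"
  define q where "q = (norm y)\<^sup>2"
  have q: "0 < 1 - q" using y by (simp add: q_def power_less_one_iff)
  define V where "V = measure (lborel_on L) UNIV"
  have V: "V > 0" unfolding V_def using L by (rule measure_lborel_on_pos)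
  obtain B where B: "\<And>x. x \<in> L \<Longrightarrow> norm x \<le> B" using compact_imp_bounded[OF L(1)] by (auto simp: bounded_iff)
  have small: "v \<bullet> centroid L = v \<bullet> y / (1 - q)" if v: "norm v < \<delta>" "norm v * (\<bar>B\<bar> + 1) < 1" for v
  proof -
    have lt: "\<bar>v \<bullet> x\<bar> < 1" if "x \<in> L" for x
    proof -
      have "\<bar>v \<bullet> x\<bar> \<le> norm v * norm x" by (rule Cauchy_Schwarz_ineq2)
      also have "\<dots> \<le> norm v * (\<bar>B\<bar> + 1)" using B[OF that] by (intro mult_left_mono) auto
      finally show ?thesis using v(2) by linarith
    qed
    define n where "n j t = (\<integral>x. (v \<bullet> x) ^ j / (1 - t * (v \<bullet> x)) ^ (?d + 1 + j) \<partial>lborel_on L)" for j t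
    have nv: "measure (lborel_on (persp (t *\<^sub>R v) ` L)) UNIV = n 0 t" if "\<bar>t\<bar> < 1" for t
    proof -
      have "(t *\<^sub>R v) \<bullet> x < 1" if "x \<in> L" for x
      proof -
        have "\<bar>t * (v \<bullet> x)\<bar> \<le> 1 * \<bar>v \<bullet> x\<bar>" unfolding abs_mult using \<open>\<bar>t\<bar> < 1\<close> by (intro mult_right_mono) auto
        then show ?thesis using lt[OF that] by (simp add: abs_le_iff)
      qed
      then show ?thesis using persp_volume[OF L(1), of "t *\<^sub>R v"] by (simp add: n_def)
    qed
    have n': "(n 0 has_real_derivative (real ?d + 1) * n 1 0) (at 0)"
      using moment_has_derivative[OF L(1), of v 0 0 "?d + 1"] lt unfolding n_def by (force simp: add.commute)
    define w where "w t = 1 - (q + 2 * t * (v \<bullet> y) + t\<^sup>2 * (norm v)\<^sup>2)" for t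
    have wn: "1 - (norm (y + t *\<^sub>R v))\<^sup>2 = w t" for t
      unfolding w_def q_def power2_norm_eq_inner by (simp add: inner_add_left inner_add_right inner_commute power2_eq_square)
    have w': "(w has_real_derivative - 2 * (v \<bullet> y)) (at 0)"
      unfolding w_def by (auto intro!: derivative_eq_intros)
    have w0: "w 0 = 1 - q" by (simp add: w_def)
    define H where "H t = (n 0 t)\<^sup>2 * w t ^ (?d + 1)" for t
    have HG: "H t = G (t *\<^sub>R v)" if "\<bar>t\<bar> < 1" for t
      using nv[OF that] wn[of t] by (simp add: H_def G_def)
    have H': "(H has_real_derivative 2 * n 0 0 * ((real ?d + 1) * n 1 0) * w 0 ^ (?d + 1)
        + (real ?d + 1) * w 0 ^ ?d * (- 2 * (v \<bullet> y)) * (n 0 0)\<^sup>2) (at 0)"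
    proof -
      have "((\<lambda>t. (n 0 t)\<^sup>2) has_real_derivative 2 * n 0 0 * ((real ?d + 1) * n 1 0)) (at 0)"
        using DERIV_power[OF n', of 2] by (simp add: ac_simps)
      moreover have "((\<lambda>t. w t ^ (?d + 1)) has_real_derivative (real ?d + 1) * w 0 ^ ?d * (- 2 * (v \<bullet> y))) (at 0)"
        using DERIV_power[OF w', of "?d + 1"] by (simp add: ac_simps)
      ultimately show ?thesis
        unfolding H_def[abs_def] by (rule DERIV_cong[OF DERIV_mult']) (simp add: algebra_simps)
    qed
    have near: "norm (t *\<^sub>R v) < \<delta>" if "\<bar>t\<bar> < 1" for t
    proof -
      have "\<bar>t\<bar> * norm v \<le> 1 * norm v" using that by (intro mult_right_mono) auto
      then show ?thesis using v(1) by simp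
    qed
    have H0: "2 * n 0 0 * ((real ?d + 1) * n 1 0) * w 0 ^ (?d + 1) + (real ?d + 1) * w 0 ^ ?d * (- 2 * (v \<bullet> y)) * (n 0 0)\<^sup>2 = 0"
      using ext
    proof
      assume a: "\<forall>u. norm u < \<delta> \<longrightarrow> G u \<le> G 0"
      have "\<forall>t. \<bar>0 - t\<bar> < 1 \<longrightarrow> H t \<le> H 0"
        using a near HG by (metis abs_minus_commute abs_zero diff_zero scaleR_zero_left zero_less_one)
      then show ?thesis using DERIV_local_max[OF H', of 1] by simp
    next
      assume a: "\<forall>u. norm u < \<delta> \<longrightarrow> G 0 \<le> G u"
      have "\<forall>t. \<bar>0 - t\<bar> < 1 \<longrightarrow> H 0 \<le> H t"
        using a near HG by (metis abs_minus_commute abs_zero diff_zero scaleR_zero_left zero_less_one)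
      then show ?thesis using DERIV_local_min[OF H', of 1] by simp
    qed
    have n0: "n 0 0 = V" "n 1 0 = (\<integral>x. v \<bullet> x \<partial>lborel_on L)" by (simp_all add: n_def V_def)
    have "2 * (real ?d + 1) * V * (1 - q) ^ ?d * (n 1 0 * (1 - q) - V * (v \<bullet> y)) = 0"
      using H0 unfolding n0(1) w0 by (simp add: algebra_simps power2_eq_square)
    moreover have "2 * (real ?d + 1) * V * (1 - q) ^ ?d \<noteq> 0" using V q by (simp add: add_nonneg_eq_0_iff)
    ultimately have "n 1 0 * (1 - q) = V * (v \<bullet> y)" by simp
    then have "n 1 0 / V = v \<bullet> y / (1 - q)" using V q by (simp add: field_simps)
    then show ?thesis using L(1) unfolding n0(2) by (simp add: inner_centroid V_def)
  qed
  define e where "e = centroid L - (1 / (1 - q)) *\<^sub>R y"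
  have "e = 0"
  proof (rule ccontr)
    assume e: "e \<noteq> 0"
    \<comment> \<open>Rescale \<open>e\<close> to a direction that is short enough for the derivative argument.\<close>
    define r where "r = min (\<delta> / 2) (1 / (2 * (\<bar>B\<bar> + 1))) / norm e"
    have r: "0 < r" using e \<delta> by (simp add: r_def)
    have rn: "norm (r *\<^sub>R e) = min (\<delta> / 2) (1 / (2 * (\<bar>B\<bar> + 1)))"
    proof -
      have "norm (r *\<^sub>R e) = r * norm e" using r by simp
      then show ?thesis using e by (simp add: r_def)
    qed
    have "norm (r *\<^sub>R e) < \<delta>" unfolding rn using \<delta> by auto
    moreover have "norm (r *\<^sub>R e) * (\<bar>B\<bar> + 1) < 1"
    proof -
      have "norm (r *\<^sub>R e) * (\<bar>B\<bar> + 1) \<le> 1 / (2 * (\<bar>B\<bar> + 1)) * (\<bar>B\<bar> + 1)"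
        unfolding rn by (intro mult_right_mono) auto
      also have "\<dots> = 1 / 2" by (simp add: add_nonneg_eq_0_iff)
      finally show ?thesis by simp
    qed
    ultimately have "(r *\<^sub>R e) \<bullet> centroid L = (r *\<^sub>R e) \<bullet> y / (1 - q)" by (rule small)
    then have "r * (e \<bullet> centroid L) = r * (e \<bullet> y / (1 - q))" by simp
    then have "e \<bullet> centroid L = e \<bullet> y / (1 - q)" using r by (simp only: mult_cancel_left) auto
    moreover have "e \<bullet> e = e \<bullet> (centroid L - (1 / (1 - q)) *\<^sub>R y)" using arg_cong[OF e_def] .
    ultimately have "e \<bullet> e = 0" by (simp add: inner_diff_right)
    then show False using e by simp
  qed
  then show ?thesis by (simp add: e_def q_def)
qed

section \<open>Centers of the perspective images\<close>

lemma persp_translate_image: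
  assumes "\<And>x. x \<in> K \<Longrightarrow> p \<bullet> x < 1"
  shows "persp u ` persp p ` K = persp (p + u) ` K"
  unfolding image_image using persp_persp[of p] assms by (intro image_cong refl) force

lemma ball_inner_less_one:
  assumes "norm p \<le> 1" "norm x < 1"
  shows "p \<bullet> x < 1"
proof -
  have "p \<bullet> x \<le> norm p * norm x" by (rule norm_cauchy_schwarz)
  also have "\<dots> \<le> 1 * norm x" using assms by (intro mult_right_mono) auto
  finally show ?thesis using assms by simp
qed

text \<open>As \<open>K\<close> lies in the open ball, \<open>persp p\<close> is defined on \<open>K\<close> even for \<open>p\<close> on the sphere. There the functional
vanishes, so that its maximum over the closed ball is attained in the interior.\<close>

lemma projective_center_exists:
  fixes K :: "'a::euclidean_space set"
  assumes K: "compact K" "interior K \<noteq> {}" "K \<subseteq> ball 0 1"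
  shows "\<exists>p. norm p < 1 \<and> centroid (persp p ` K) = (1 / (1 - (norm p)\<^sup>2)) *\<^sub>R p"
proof -
  have lt: "p \<bullet> x < 1" if "norm p \<le> 1" "x \<in> K" for p x
    using that K(3) by (intro ball_inner_less_one) auto
  define G where "G p = (measure (lborel_on (persp p ` K)) UNIV)\<^sup>2 * (1 - (norm p)\<^sup>2) ^ (DIM('a) + 1)" for p
  have "continuous_on (cball 0 1) G"
    unfolding G_def using lt
    by (intro continuous_intros continuous_on_persp_volume[OF K(1) compact_cball]) auto
  then obtain p where p: "p \<in> cball 0 1" "\<And>u. u \<in> cball 0 1 \<Longrightarrow> G u \<le> G p"
    using continuous_attains_sup[of "cball (0::'a) 1" G] by (metis cball_eq_empty compact_cball not_one_less_zero)
  have pos: "0 < measure (lborel_on (persp u ` K)) UNIV" if "norm u \<le> 1" for u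
    using compact_persp_image[OF K(1), of u] interior_persp_image[OF K(2), of u] lt[OF that] by (intro measure_lborel_on_pos) auto
  have "0 < G 0" unfolding G_def using pos[of 0] by simp
  then have "0 < G p" using p(2)[of 0] by simp
  then have "norm p \<noteq> 1" by (auto simp: G_def)
  then have p1: "norm p < 1" using p(1) by simp
  let ?L = "persp p ` K"
  have tr: "persp u ` ?L = persp (p + u) ` K" for u
    using lt p1 by (intro persp_translate_image) auto
  have "centroid ?L = (1 / (1 - (norm p)\<^sup>2)) *\<^sub>R p"
  proof (rule critical_at_extremum[where \<delta>="1 - norm p"])
    show "compact ?L" using K(1) lt p1 by (intro compact_persp_image) auto
    show "interior ?L \<noteq> {}" using K(2) lt p1 by (intro interior_persp_image) auto
    have "G (p + u) \<le> G p" if "norm u < 1 - norm p" for u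
      using that norm_triangle_ineq[of p u] by (intro p(2)) simp
    then show "(\<forall>u. norm u < 1 - norm p \<longrightarrow> (measure (lborel_on (persp u ` ?L)) UNIV)\<^sup>2 * (1 - (norm (p + u))\<^sup>2) ^ (DIM('a) + 1)
          \<le> (measure (lborel_on (persp 0 ` ?L)) UNIV)\<^sup>2 * (1 - (norm (p + 0))\<^sup>2) ^ (DIM('a) + 1)) \<or>
       (\<forall>u. norm u < 1 - norm p \<longrightarrow> (measure (lborel_on (persp 0 ` ?L)) UNIV)\<^sup>2 * (1 - (norm (p + 0))\<^sup>2) ^ (DIM('a) + 1)
          \<le> (measure (lborel_on (persp u ` ?L)) UNIV)\<^sup>2 * (1 - (norm (p + u))\<^sup>2) ^ (DIM('a) + 1))"
      unfolding tr by (simp add: G_def)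
  qed (use p1 in auto)
  then show ?thesis using p1 by blast
qed

text \<open>The common part of both uniqueness statements: a family of bodies moved by perspective maps, and the sign
condition of \<open>not_two_critical_points\<close> at each of its members.\<close>

lemma critical_point_unique:
  fixes F :: "'a::euclidean_space \<Rightarrow> 'a set" and \<sigma> :: real
  assumes F: "\<And>y. y \<in> U \<Longrightarrow> compact (F y)" "\<And>y. y \<in> U \<Longrightarrow> interior (F y) \<noteq> {}"
    and U: "convex U" "U \<subseteq> ball 0 1"
    and tr: "\<And>y w. y \<in> U \<Longrightarrow> w \<in> U \<Longrightarrow> persp (w - y) ` F y = F w"
    and lt: "\<And>y w x. y \<in> U \<Longrightarrow> w \<in> U \<Longrightarrow> x \<in> F y \<Longrightarrow> (w - y) \<bullet> x < 1"
    and sgn: "\<And>y v V (s::real). y \<in> U \<Longrightarrow> v \<noteq> 0 \<Longrightarrow> measure (lborel_on (F y)) UNIV = V \<Longrightarrow> (\<integral>z. v \<bullet> z \<partial>lborel_on (F y)) / V = s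
       \<Longrightarrow> s = v \<bullet> y / (1 - (norm y)\<^sup>2) \<Longrightarrow>
       0 < \<sigma> * ((DIM('a) + 2) * ((\<integral>z. (v \<bullet> z)\<^sup>2 \<partial>lborel_on (F y)) / V) - (DIM('a) + 1) * s\<^sup>2 - ((norm v)\<^sup>2 / (1 - (norm y)\<^sup>2) + 2 * s\<^sup>2))"
    and a: "a \<in> U" "centroid (F a) = (1 / (1 - (norm a)\<^sup>2)) *\<^sub>R a"
    and b: "b \<in> U" "centroid (F b) = (1 / (1 - (norm b)\<^sup>2)) *\<^sub>R b"
  shows "a = b"
proof (rule ccontr)
  assume "a \<noteq> b"
  define v where "v = b - a"
  have v: "v \<noteq> 0" using \<open>a \<noteq> b\<close> by (simp add: v_def)
  have mem: "a + t *\<^sub>R v \<in> U" if "0 \<le> t" "t \<le> 1" for t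
  proof -
    have "a + t *\<^sub>R v = (1 - t) *\<^sub>R a + t *\<^sub>R b" by (simp add: v_def algebra_simps)
    then show ?thesis using convexD[OF U(1) a(1) b(1), of "1 - t" t] that by simp
  qed
  have Ft: "persp (t *\<^sub>R v) ` F a = F (a + t *\<^sub>R v)" if "0 \<le> t" "t \<le> 1" for t
    using tr[OF a(1) mem[OF that]] by simp
  have zero: "(\<integral>z. v \<bullet> z \<partial>lborel_on (F y)) / measure (lborel_on (F y)) UNIV = v \<bullet> y / (1 - (norm y)\<^sup>2)"
    if "y \<in> U" "centroid (F y) = (1 / (1 - (norm y)\<^sup>2)) *\<^sub>R y" for y
    using inner_centroid[OF F(1)[OF that(1)], of v] that(2) by simp
  show False
  proof (rule not_two_critical_points[of "F a" v a \<sigma>])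
    show "compact (F a)" "interior (F a) \<noteq> {}" using F a by auto
    show "v \<bullet> x < 1" if "x \<in> F a" for x using lt[OF a(1) b(1) that] by (simp add: v_def)
    show "norm a < 1" "norm (a + v) < 1" using U(2) a(1) b(1) by (auto simp: v_def)
    show "(\<integral>z. (v \<bullet> z) ^ 1 \<partial>lborel_on (persp (0 *\<^sub>R v) ` F a)) / (\<integral>z. (v \<bullet> z) ^ 0 \<partial>lborel_on (persp (0 *\<^sub>R v) ` F a)) = v \<bullet> a / (1 - (norm a)\<^sup>2)"
      using zero[OF a] Ft[of 0] by simp
    show "(\<integral>z. (v \<bullet> z) ^ 1 \<partial>lborel_on (persp (1 *\<^sub>R v) ` F a)) / (\<integral>z. (v \<bullet> z) ^ 0 \<partial>lborel_on (persp (1 *\<^sub>R v) ` F a)) = v \<bullet> (a + v) / (1 - (norm (a + v))\<^sup>2)"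
      using zero[OF b] Ft[of 1] by (simp add: v_def)
  next
    fix t :: real assume t: "0 \<le> t" "t \<le> 1"
    assume e: "(\<integral>z. (v \<bullet> z) ^ 1 \<partial>lborel_on (persp (t *\<^sub>R v) ` F a)) / (\<integral>z. (v \<bullet> z) ^ 0 \<partial>lborel_on (persp (t *\<^sub>R v) ` F a))
        = v \<bullet> (a + t *\<^sub>R v) / (1 - (norm (a + t *\<^sub>R v))\<^sup>2)"
    show "0 < \<sigma> * ((DIM('a) + 2) * ((\<integral>z. (v \<bullet> z) ^ 2 \<partial>lborel_on (persp (t *\<^sub>R v) ` F a)) / (\<integral>z. (v \<bullet> z) ^ 0 \<partial>lborel_on (persp (t *\<^sub>R v) ` F a)))
        - (DIM('a) + 1) * ((\<integral>z. (v \<bullet> z) ^ 1 \<partial>lborel_on (persp (t *\<^sub>R v) ` F a)) / (\<integral>z. (v \<bullet> z) ^ 0 \<partial>lborel_on (persp (t *\<^sub>R v) ` F a)))\<^sup>2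
        - ((norm v)\<^sup>2 / (1 - (norm (a + t *\<^sub>R v))\<^sup>2) + 2 * (v \<bullet> (a + t *\<^sub>R v) / (1 - (norm (a + t *\<^sub>R v))\<^sup>2))\<^sup>2))"
      using sgn[OF mem[OF t] v refl refl] e unfolding Ft[OF t] by simp
  qed
qed

lemma projective_center_unique:
  fixes K :: "'a::euclidean_space set" and r :: real
  assumes K: "compact K" "convex K" "interior K \<noteq> {}" "K \<subseteq> cball 0 r" and r: "0 < r" "r < 1"
    and dr: "(DIM('a) + 2) * r\<^sup>2 \<le> 3" "(DIM('a) + 2) * r\<^sup>2 < 3 \<or> 2 \<le> DIM('a)"
    and a: "norm a < 1" "centroid (persp a ` K) = (1 / (1 - (norm a)\<^sup>2)) *\<^sub>R a"
    and b: "norm b < 1" "centroid (persp b ` K) = (1 / (1 - (norm b)\<^sup>2)) *\<^sub>R b"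
  shows "a = b"
proof (rule critical_point_unique[of "ball 0 1" "\<lambda>p. persp p ` K" "-1"])
  have lt: "p \<bullet> x < 1" if "p \<in> ball 0 1" "x \<in> K" for p x
    using that K(4) r by (intro ball_inner_less_one) auto
  show "compact (persp y ` K)" if "y \<in> ball 0 1" for y
    using K(1) lt[OF that] by (rule compact_persp_image)
  show "interior (persp y ` K) \<noteq> {}" if "y \<in> ball 0 1" for y
    using K(3) lt[OF that] by (rule interior_persp_image)
  show "persp (w - y) ` persp y ` K = persp w ` K" if "y \<in> ball 0 1" for y w
    using persp_translate_image[of K y "w - y"] lt[OF that] by simp
  show "(w - y) \<bullet> x < 1" if yw: "y \<in> ball 0 1" "w \<in> ball 0 1" and x: "x \<in> persp y ` K" for y w x
  proof -
    obtain z where z: "z \<in> K" "x = persp y z" using x by blast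
    have "1 - (w - y) \<bullet> x = (1 - w \<bullet> z) / (1 - y \<bullet> z)"
      using persp_denominator[of y z "w - y"] lt[OF yw(1) z(1)] z(2) by simp
    moreover have "0 < (1 - w \<bullet> z) / (1 - y \<bullet> z)" using lt[OF yw(1) z(1)] lt[OF yw(2) z(1)] by simp
    ultimately show ?thesis by simp
  qed
  fix y v :: 'a and V s :: real
  assume y: "y \<in> ball 0 1" and v: "v \<noteq> 0" and V: "measure (lborel_on (persp y ` K)) UNIV = V"
    and s: "(\<integral>z. v \<bullet> z \<partial>lborel_on (persp y ` K)) / V = s" "s = v \<bullet> y / (1 - (norm y)\<^sup>2)"
  have "norm y < 1" using y by simp
  from ball_body_second_moment[OF K r dr this v V s]
  show "0 < - 1 * ((DIM('a) + 2) * ((\<integral>z. (v \<bullet> z)\<^sup>2 \<partial>lborel_on (persp y ` K)) / V) - (DIM('a) + 1) * s\<^sup>2 - ((norm v)\<^sup>2 / (1 - (norm y)\<^sup>2) + 2 * s\<^sup>2))"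
    by simp
qed (use a b in auto)

section \<open>Polar bodies and their centers\<close>

text \<open>The polar of \<open>K - y\<close> in the usual sign convention. It differs from \<open>polar_dual K y\<close> by a point reflection
and a translation; in this normalisation a change of the base point is exactly a perspective map.\<close>

definition dual_at :: "'a::euclidean_space set \<Rightarrow> 'a \<Rightarrow> 'a set" where
  "dual_at K y = {u. \<forall>z\<in>K. u \<bullet> (z - y) \<le> 1}"

lemma dual_at_closed_convex: "closed (dual_at K y)" "convex (dual_at K y)"
proof -
  have e: "dual_at K y = (\<Inter>z\<in>K. {u. (z - y) \<bullet> u \<le> 1})"
    by (auto simp: dual_at_def inner_commute)
  show "closed (dual_at K y)" unfolding e by (intro closed_INT ballI closed_halfspace_le)
  show "convex (dual_at K y)" unfolding e by (intro convex_INT convex_halfspace_le)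
qed

lemma dual_at_norm_bound:
  assumes "cball y e \<subseteq> K" "0 < e" "u \<in> dual_at K y"
  shows "norm u \<le> 1 / e"
proof (cases "u = 0")
  case False
  have "y + (e / norm u) *\<^sub>R u \<in> K" using assms False by (auto simp: dist_norm)
  then have "u \<bullet> ((e / norm u) *\<^sub>R u) \<le> 1" using assms(3) by (force simp: dual_at_def)
  moreover have "u \<bullet> ((e / norm u) *\<^sub>R u) = e * norm u"
    using False by (simp add: dot_square_norm power2_eq_square)
  ultimately show ?thesis using assms(2) by (simp add: field_simps)
qed (use assms in simp)

lemma dual_at_compact:
  assumes "y \<in> interior K"
  shows "compact (dual_at K y)"
proof -
  obtain e where e: "0 < e" "cball y e \<subseteq> K" using assms mem_interior_cball by blast
  have "bounded (dual_at K y)"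
    using dual_at_norm_bound[OF e(2,1)] by (auto simp: bounded_iff)
  then show ?thesis using dual_at_closed_convex(1) by (simp add: compact_eq_bounded_closed)
qed

lemma cball_subset_dual_at:
  assumes "\<And>z. z \<in> K \<Longrightarrow> norm (z - y) \<le> R" "0 < R"
  shows "cball 0 (1 / R) \<subseteq> dual_at K y"
proof
  fix u assume "u \<in> cball (0::'a) (1 / R)"
  then have u: "norm u \<le> 1 / R" by simp
  show "u \<in> dual_at K y"
    unfolding dual_at_def
  proof (intro CollectI ballI)
    fix z assume "z \<in> K"
    have "u \<bullet> (z - y) \<le> norm u * norm (z - y)" by (rule norm_cauchy_schwarz)
    also have "\<dots> \<le> (1 / R) * R" using u assms(1)[OF \<open>z \<in> K\<close>] assms(2) by (intro mult_mono) auto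
    finally show "u \<bullet> (z - y) \<le> 1" using assms(2) by simp
  qed
qed

lemma zero_in_interior_dual_at:
  assumes "K \<subseteq> cball 0 1" "norm y \<le> 1"
  shows "0 \<in> interior (dual_at K y)" "cball 0 (1 / 2) \<subseteq> dual_at K y"
proof -
  have "norm (z - y) \<le> 2" if "z \<in> K" for z
  proof -
    have "norm z \<le> 1" using assms(1) that by auto
    then show ?thesis using norm_triangle_ineq4[of z y] assms(2) by linarith
  qed
  then show c: "cball 0 (1 / 2) \<subseteq> dual_at K y" by (intro cball_subset_dual_at) simp_all
  have "ball 0 (1 / 2) \<subseteq> dual_at K y" using c ball_subset_cball by blast
  then show "0 \<in> interior (dual_at K y)" by (meson centre_in_ball half_gt_zero_iff interior_maximal open_ball subsetD zero_less_one)
qed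

lemma dual_at_inner_less:
  assumes "w \<in> interior K" "u \<in> dual_at K y"
  shows "(w - y) \<bullet> u < 1"
proof (cases "u = 0")
  case False
  obtain e where e: "0 < e" "cball w e \<subseteq> K" using assms(1) mem_interior_cball by blast
  have "w + (e / norm u) *\<^sub>R u \<in> K" using e False by (auto simp: dist_norm)
  then have "u \<bullet> (w + (e / norm u) *\<^sub>R u - y) \<le> 1" using assms(2) by (auto simp: dual_at_def)
  moreover have "u \<bullet> (w + (e / norm u) *\<^sub>R u - y) = (w - y) \<bullet> u + e * norm u"
    using False by (simp add: inner_add_right inner_diff_right inner_diff_left inner_commute dot_square_norm power2_eq_square)
  moreover have "0 < e * norm u" using e False by simp
  ultimately show ?thesis by linarith
qed simp

lemma persp_dual_at:
  assumes y: "y \<in> interior K" and w: "w \<in> interior K"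
  shows "persp (w - y) ` dual_at K y = dual_at K w"
proof -
  have sub: "persp (b - a) u \<in> dual_at K b" if a: "a \<in> interior K" and b: "b \<in> interior K" and u: "u \<in> dual_at K a" for a b u
  proof -
    have p: "0 < 1 - (b - a) \<bullet> u" using dual_at_inner_less[OF b u] by simp
    show ?thesis
      unfolding dual_at_def
    proof (intro CollectI ballI)
      fix z assume "z \<in> K"
      then have "u \<bullet> (z - a) \<le> 1" using u by (simp add: dual_at_def)
      then have "u \<bullet> (z - b) \<le> 1 - (b - a) \<bullet> u" by (simp add: inner_diff_right inner_diff_left inner_commute)
      then show "persp (b - a) u \<bullet> (z - b) \<le> 1" using p by (simp add: persp_def divide_le_eq)
    qed
  qed
  show ?thesis
  proof (intro equalityI subsetI)
    fix x assume "x \<in> persp (w - y) ` dual_at K y"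
    then show "x \<in> dual_at K w" using sub[OF y w] by blast
  next
    fix x assume x: "x \<in> dual_at K w"
    have "x = persp (w - y) (persp (y - w) x)"
      using persp_inverse[of "y - w" x] dual_at_inner_less[OF y x] by simp
    then show "x \<in> persp (w - y) ` dual_at K y" using sub[OF w y x] by blast
  qed
qed

text \<open>The bipolar theorem, in the form that a point outside \<open>K\<close> is cut off by an element of the polar.\<close>

lemma dual_at_separation:
  assumes K: "closed K" "convex K" and y: "y \<in> K" and w: "y + w \<notin> K"
  obtains u where "u \<in> dual_at K y" "1 < u \<bullet> w"
proof -
  obtain a b where ab: "a \<bullet> (y + w) < b" "\<And>x. x \<in> K \<Longrightarrow> b < a \<bullet> x"
    using separating_hyperplane_closed_point[OF K(2,1) w] by blast
  define c where "c = a \<bullet> y - b"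
  have c: "0 < c" using ab(2)[OF y] by (simp add: c_def)
  show thesis
  proof (rule that[of "(- 1 / c) *\<^sub>R a"])
    show "(- 1 / c) *\<^sub>R a \<in> dual_at K y"
      unfolding dual_at_def
    proof (intro CollectI ballI)
      fix z assume "z \<in> K"
      then have "a \<bullet> y - a \<bullet> z \<le> c" using ab(2) by (force simp: c_def)
      then show "(- 1 / c) *\<^sub>R a \<bullet> (z - y) \<le> 1" using c by (simp add: inner_diff_right field_simps)
    qed
    show "1 < (- 1 / c) *\<^sub>R a \<bullet> w"
      using ab(1) c by (simp add: c_def inner_add_right field_simps)
  qed
qed

text \<open>The convex hull of the ball and \<open>u\<close> contains \<open>N\<close> disjoint balls of radius \<open>\<rho> / 2\<close> with centers
on the first half of the segment from \<open>0\<close> to \<open>u\<close>.\<close>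

lemma convex_ball_far_point_volume:
  fixes C :: "'a::euclidean_space set"
  assumes C: "compact C" "convex C" and \<rho>: "0 < \<rho>" "ball 0 \<rho> \<subseteq> C" and u: "u \<in> C" and N: "2 * real N * \<rho> \<le> norm u"
  shows "real N * measure lborel (ball (0::'a) (\<rho> / 2)) \<le> measure (lborel_on C) UNIV"
proof (cases "u = 0")
  case True
  then have "N = 0" using N \<rho>(1) by (simp add: mult_le_0_iff)
  then show ?thesis by simp
next
  case False
  define x where "x k = (real k * \<rho> / norm u) *\<^sub>R u" for k :: nat
  have sub: "ball (x k) (\<rho> / 2) \<subseteq> C" if "k < N" for k
  proof
    fix z assume z: "z \<in> ball (x k) (\<rho> / 2)"
    define l where "l = real k * \<rho> / norm u"
    have "real k * \<rho> \<le> real N * \<rho>" using that \<rho>(1) by (intro mult_right_mono) auto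
    then have "2 * (real k * \<rho>) \<le> norm u" using N by linarith
    then have l: "0 \<le> l" "l \<le> 1 / 2" using \<rho>(1) False by (simp_all add: l_def divide_le_eq)
    define b where "b = (1 / (1 - l)) *\<^sub>R (z - x k)"
    have "norm (z - x k) < \<rho> / 2" using z by (simp add: dist_norm norm_minus_commute)
    also have "\<dots> \<le> (1 - l) * \<rho>" using l \<rho>(1) mult_right_mono[of "1/2" "1 - l" \<rho>] by simp
    finally have "norm (z - x k) < \<rho> * (1 - l)" by (simp add: mult.commute)
    moreover have "norm b = norm (z - x k) / (1 - l)" unfolding b_def norm_scaleR using l by simp
    ultimately have "norm b < \<rho>" using l by (simp add: divide_less_eq)
    then have "b \<in> C" using \<rho>(2) by auto
    moreover have "z = (1 - l) *\<^sub>R b + l *\<^sub>R u"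
    proof -
      have "x k = l *\<^sub>R u" by (simp add: x_def l_def)
      moreover have "(1 - l) *\<^sub>R b = z - x k" using l(2) by (simp add: b_def)
      ultimately show ?thesis by simp
    qed
    ultimately show "z \<in> C" using convexD[OF C(2) _ u, of b "1 - l" l] l by simp
  qed
  have disj: "disjoint_family_on (\<lambda>k. ball (x k) (\<rho> / 2)) {..<N}"
    unfolding disjoint_family_on_def
  proof (intro ballI impI)
    fix i j :: nat assume "i \<noteq> j"
    have "x i - x j = ((real i - real j) * \<rho> / norm u) *\<^sub>R u" by (simp add: x_def algebra_simps diff_divide_distrib)
    then have "norm (x i - x j) = \<bar>real i - real j\<bar> * \<rho>" using False \<rho>(1) by (simp add: abs_mult)
    moreover have "1 \<le> \<bar>real i - real j\<bar>" using \<open>i \<noteq> j\<close> by linarith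
    ultimately have "\<rho> \<le> dist (x i) (x j)" using \<rho>(1) mult_right_mono[of 1 "\<bar>real i - real j\<bar>" \<rho>] by (simp add: dist_norm)
    then show "ball (x i) (\<rho> / 2) \<inter> ball (x j) (\<rho> / 2) = {}" by (intro disjoint_ballI) simp
  qed
  have same: "measure lborel (ball (x k) (\<rho> / 2)) = measure lborel (ball (0::'a) (\<rho> / 2))" for k
    using content_ball_conv_unit_ball[of "\<rho> / 2" "x k"] content_ball_conv_unit_ball[of "\<rho> / 2" "0::'a"] \<rho>(1) by simp
  have "real N * measure lborel (ball (0::'a) (\<rho> / 2)) = (\<Sum>k<N. measure lborel (ball (x k) (\<rho> / 2)))"
    by (simp add: same)
  also have "\<dots> = measure lborel (\<Union>k<N. ball (x k) (\<rho> / 2))"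
  proof (rule measure_finite_Union[symmetric])
    show "emeasure lborel (ball (x k) (\<rho> / 2)) \<noteq> \<infinity>" for k
      using emeasure_lborel_ball_finite[of "x k" "\<rho> / 2"] by (metis less_irrefl)
  qed (use disj in auto)
  also have "\<dots> \<le> measure lborel C"
  proof (rule measure_mono_fmeasurable)
    show "(\<Union>k<N. ball (x k) (\<rho> / 2)) \<subseteq> C" using sub by blast
    show "C \<in> fmeasurable lborel" using C(1) by (rule fmeasurable_compact)
  qed auto
  also have "\<dots> = measure (lborel_on C) UNIV" using C(1) by (simp add: measure_lborel_on borel_compact)
  finally show ?thesis .
qed

text \<open>If \<open>y\<close> is within \<open>1 / N\<close> of the boundary of \<open>K\<close>, the polar contains a vector of norm at least \<open>N\<close>
besides a fixed ball, so by \<open>convex_ball_far_point_volume\<close> the functional is large, since \<open>1 - \<bar>y\<bar>\<^sup>2\<close> is bounded below on \<open>K\<close>.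
The minimum over the compact set \<open>P\<close> of points at distance at least \<open>1 / N\<close> from the boundary is therefore a minimum
over the whole interior.\<close>

lemma dual_center_exists:
  fixes K :: "'a::euclidean_space set"
  assumes K: "compact K" "convex K" "interior K \<noteq> {}" "K \<subseteq> cball 0 r" and r: "r < 1"
  shows "\<exists>y\<in>interior K. centroid (dual_at K y) = (1 / (1 - (norm y)\<^sup>2)) *\<^sub>R y"
proof -
  let ?d = "DIM('a)"
  have K1: "K \<subseteq> cball 0 1" using K(4) r by auto
  obtain y0 where y0: "y0 \<in> interior K" using K(3) by blast
  have nK: "norm y \<le> r" if "y \<in> interior K" for y
    using subsetD[OF K(4) subsetD[OF interior_subset that]] by simp
  have r0: "0 \<le> r" using nK[OF y0] norm_ge_zero order_trans by blast
  have r21: "0 < 1 - r\<^sup>2" using r r0 by (simp add: power_less_one_iff)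
  have D: "compact (dual_at K y)" "interior (dual_at K y) \<noteq> {}" "cball 0 (1 / 2) \<subseteq> dual_at K y" if "y \<in> interior K" for y
  proof -
    have "norm y \<le> 1" using nK[OF that] r by simp
    from zero_in_interior_dual_at[OF K1 this] show "interior (dual_at K y) \<noteq> {}" "cball 0 (1 / 2) \<subseteq> dual_at K y" by auto
    show "compact (dual_at K y)" using that by (rule dual_at_compact)
  qed
  define m where "m y = measure (lborel_on (dual_at K y)) UNIV" for y
  define G where "G y = (m y)\<^sup>2 * (1 - (norm y)\<^sup>2) ^ (?d + 1)" for y
  define c where "c = measure lborel (ball (0::'a) (1 / 2 / 2))"
  have c: "0 < c"
    unfolding c_def using emeasure_lborel_ball_positive[of "1 / 2 / 2" "0::'a"] emeasure_lborel_ball_finite[of "0::'a" "1 / 2 / 2"]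
    by (simp add: measure_def enn2real_positive_iff)
  define \<kappa> where "\<kappa> = (1 - r\<^sup>2) ^ (?d + 1)"
  have \<kappa>: "0 < \<kappa>" unfolding \<kappa>_def using r21 by (rule zero_less_power)
  obtain N :: nat where N: "max 1 (G y0 / (c\<^sup>2 * \<kappa>)) < real N" using reals_Archimedean2 by blast
  have N1: "1 \<le> real N" using N by auto
  have NG: "G y0 < (real N * c)\<^sup>2 * \<kappa>"
  proof -
    have "G y0 / (c\<^sup>2 * \<kappa>) < real N" using N by simp
    then have "G y0 < real N * (c\<^sup>2 * \<kappa>)" using c \<kappa> by (simp add: divide_less_eq)
    also have "\<dots> \<le> (real N)\<^sup>2 * (c\<^sup>2 * \<kappa>)" using N1 c \<kappa> by (intro mult_right_mono) (auto simp: power2_eq_square)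
    finally show ?thesis by (simp add: power_mult_distrib mult.assoc)
  qed
  define \<delta> where "\<delta> = 1 / real N"
  have \<delta>: "0 < \<delta>" using N1 by (simp add: \<delta>_def)
  have far: "G y0 < G y" if y: "y \<in> interior K" and n: "\<not> cball y \<delta> \<subseteq> K" for y
  proof -
    obtain w' where "w' \<in> cball y \<delta>" "w' \<notin> K" using n by blast
    then obtain w where w: "norm w \<le> \<delta>" "y + w \<notin> K"
      using that[of "w' - y"] by (metis add_diff_cancel_left' diff_add_cancel add.commute dist_commute dist_norm mem_cball)
    have yK: "y \<in> K" using y interior_subset by blast
    obtain u where u: "u \<in> dual_at K y" "1 < u \<bullet> w"
      using dual_at_separation[OF compact_imp_closed[OF K(1)] K(2) yK w(2)] by blast
    have "u \<bullet> w \<le> norm u * norm w" by (rule norm_cauchy_schwarz)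
    also have "\<dots> \<le> norm u * \<delta>" using w(1) by (intro mult_left_mono) auto
    finally have "1 < norm u * \<delta>" using u(2) by simp
    then have "2 * real N * (1 / 2) \<le> norm u" using N1 by (simp add: \<delta>_def field_simps)
    moreover have "ball 0 (1 / 2) \<subseteq> dual_at K y" using D(3)[OF y] ball_subset_cball by blast
    ultimately have mN: "real N * c \<le> m y"
      unfolding c_def m_def using u(1) D(1)[OF y] dual_at_closed_convex(2) by (intro convex_ball_far_point_volume) auto
    have "(norm y)\<^sup>2 \<le> r\<^sup>2" using nK[OF y] by (intro power_mono) auto
    then have "\<kappa> \<le> (1 - (norm y)\<^sup>2) ^ (?d + 1)" unfolding \<kappa>_def using r21 by (intro power_mono) auto
    moreover have "(real N * c)\<^sup>2 \<le> (m y)\<^sup>2" using mN c by (intro power_mono) auto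
    ultimately have "(real N * c)\<^sup>2 * \<kappa> \<le> G y" unfolding G_def using \<kappa> by (intro mult_mono) auto
    then show ?thesis using NG by simp
  qed
  define P where "P = {y. cball y \<delta> \<subseteq> K}"
  have PK: "P \<subseteq> interior K"
  proof
    fix y assume "y \<in> P"
    then have "cball y \<delta> \<subseteq> K" by (simp add: P_def)
    then show "y \<in> interior K" using \<delta> mem_interior_cball by blast
  qed
  have "P = (\<Inter>w\<in>cball 0 \<delta>. (\<lambda>x. x - w) ` K)"
  proof (intro equalityI subsetI)
    fix y assume y: "y \<in> P"
    show "y \<in> (\<Inter>w\<in>cball 0 \<delta>. (\<lambda>x. x - w) ` K)"
    proof
      fix w :: 'a assume "w \<in> cball 0 \<delta>"
      then have "y + w \<in> K" using y by (auto simp: P_def dist_norm)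
      then show "y \<in> (\<lambda>x. x - w) ` K" by (intro image_eqI[of _ _ "y + w"]) auto
    qed
  next
    fix y assume y: "y \<in> (\<Inter>w\<in>cball 0 \<delta>. (\<lambda>x. x - w) ` K)"
    show "y \<in> P" unfolding P_def
    proof (intro CollectI subsetI)
      fix x assume "x \<in> cball y \<delta>"
      then have "x - y \<in> cball 0 \<delta>" by (simp add: dist_norm norm_minus_commute)
      then obtain x' where "x' \<in> K" "y = x' - (x - y)" using y by blast
      then show "x \<in> K" by simp
    qed
  qed
  moreover have "compact ((\<lambda>x. x - w) ` K)" for w
    using K(1) by (intro compact_continuous_image continuous_intros)
  then have "closed (\<Inter>w\<in>cball 0 \<delta>. (\<lambda>x. x - w) ` K)"
    by (intro closed_INT ballI compact_imp_closed)
  ultimately have "closed P" by (simp only:)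
  moreover have "bounded P" using PK K(1) interior_subset by (meson bounded_subset compact_imp_bounded order_trans)
  ultimately have cP: "compact P" by (simp add: compact_eq_bounded_closed)
  have y0P: "y0 \<in> P" using far[OF y0] by (auto simp: P_def)
  have "continuous_on P m"
  proof -
    have "continuous_on ((\<lambda>y. y - y0) ` P) (\<lambda>p. measure (lborel_on (persp p ` dual_at K y0)) UNIV)"
    proof (rule continuous_on_persp_volume[OF D(1)[OF y0]])
      show "compact ((\<lambda>y. y - y0) ` P)" using cP by (intro compact_continuous_image continuous_intros)
      show "p \<bullet> x < 1" if "p \<in> (\<lambda>y. y - y0) ` P" "x \<in> dual_at K y0" for p x
        using that dual_at_inner_less PK by blast
    qed
    then have "continuous_on P (\<lambda>y. measure (lborel_on (persp (y - y0) ` dual_at K y0)) UNIV)"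
      by (rule continuous_on_compose2) (auto intro!: continuous_intros)
    then show ?thesis
      by (rule continuous_on_eq) (use persp_dual_at[OF y0] PK in \<open>auto simp: m_def\<close>)
  qed
  then have "continuous_on P G" unfolding G_def by (intro continuous_intros)
  then obtain y where y: "y \<in> P" "\<And>w. w \<in> P \<Longrightarrow> G y \<le> G w"
    using continuous_attains_inf[OF cP] y0P by blast
  have min: "G y \<le> G w" if "w \<in> interior K" for w
  proof (cases "w \<in> P")
    case False
    then have "G y0 < G w" using far[OF that] by (simp add: P_def)
    then show ?thesis using y(2)[OF y0P] by simp
  qed (rule y(2))
  have yK: "y \<in> interior K" using y(1) PK by blast
  obtain e where e: "0 < e" "ball y e \<subseteq> interior K"
    using yK open_interior open_contains_ball by blast
  have "centroid (dual_at K y) = (1 / (1 - (norm y)\<^sup>2)) *\<^sub>R y"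
  proof (rule critical_at_extremum[where \<delta>=e, OF D(1,2)[OF yK]])
    show "norm y < 1" using nK[OF yK] r by simp
    have "G (y + 0) \<le> G (y + u)" if "norm u < e" for u
    proof -
      have "y + u \<in> ball y e" using that by (simp add: dist_norm)
      then show ?thesis using e(2) min by auto
    qed
    moreover have "persp u ` dual_at K y = dual_at K (y + u)" if "norm u < e" for u
    proof -
      have "y + u \<in> ball y e" using that by (simp add: dist_norm)
      then have "y + u \<in> interior K" using e(2) by blast
      then show ?thesis using persp_dual_at[OF yK, of "y + u"] by simp
    qed
    ultimately show "(\<forall>u. norm u < e \<longrightarrow> (measure (lborel_on (persp u ` dual_at K y)) UNIV)\<^sup>2 * (1 - (norm (y + u))\<^sup>2) ^ (?d + 1)
          \<le> (measure (lborel_on (persp 0 ` dual_at K y)) UNIV)\<^sup>2 * (1 - (norm (y + 0))\<^sup>2) ^ (?d + 1)) \<or>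
       (\<forall>u. norm u < e \<longrightarrow> (measure (lborel_on (persp 0 ` dual_at K y)) UNIV)\<^sup>2 * (1 - (norm (y + 0))\<^sup>2) ^ (?d + 1)
          \<le> (measure (lborel_on (persp u ` dual_at K y)) UNIV)\<^sup>2 * (1 - (norm (y + u))\<^sup>2) ^ (?d + 1))"
      using e(1) by (simp add: G_def m_def)
  qed (rule e(1))
  then show ?thesis using yK by blast
qed

text \<open>By the bipolar theorem, the functionals bounded by \<open>1\<close> on the polar correspond to points of \<open>K\<close>, which
lie in the ball of radius \<open>r\<close>. This is the hypothesis \<open>dual\<close> of \<open>dual_body_second_moment\<close>.\<close>

lemma dual_center_unique:
  fixes K :: "'a::euclidean_space set" and r :: real
  assumes K: "compact K" "convex K" "K \<subseteq> cball 0 r" and r: "0 < r" "r < 1"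
    and dr: "(DIM('a) + 1) * r\<^sup>2 \<le> 2" "(DIM('a) + 1) * r\<^sup>2 < 2 \<or> 2 \<le> DIM('a)"
    and a: "a \<in> interior K" "centroid (dual_at K a) = (1 / (1 - (norm a)\<^sup>2)) *\<^sub>R a"
    and b: "b \<in> interior K" "centroid (dual_at K b) = (1 / (1 - (norm b)\<^sup>2)) *\<^sub>R b"
  shows "a = b"
proof (rule critical_point_unique[of "interior K" "dual_at K" 1])
  have K1: "K \<subseteq> cball 0 1" using K(3) r by auto
  have intK: "interior K \<subseteq> ball 0 r" using interior_mono[OF K(3)] by simp
  have n1: "norm y \<le> 1" if "y \<in> interior K" for y using that intK r by auto
  note zin = zero_in_interior_dual_at(1)[OF K1 n1]
  show "compact (dual_at K y)" if "y \<in> interior K" for y using that by (rule dual_at_compact)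
  show "interior (dual_at K y) \<noteq> {}" if "y \<in> interior K" for y using zin[OF that] by blast
  show "convex (interior K)" using K(2) by (rule convex_interior)
  show "interior K \<subseteq> ball 0 1" using intK r by auto
  show "persp (w - y) ` dual_at K y = dual_at K w" if "y \<in> interior K" "w \<in> interior K" for y w
    using that by (rule persp_dual_at)
  show "(w - y) \<bullet> x < 1" if "w \<in> interior K" "x \<in> dual_at K y" for y w x
    using that by (rule dual_at_inner_less)
  fix y v :: 'a and V s :: real
  assume y: "y \<in> interior K" and v: "v \<noteq> 0" and V: "measure (lborel_on (dual_at K y)) UNIV = V"
    and s: "(\<integral>z. v \<bullet> z \<partial>lborel_on (dual_at K y)) / V = s" "s = v \<bullet> y / (1 - (norm y)\<^sup>2)"
  have yr: "norm y < r" using y intK by auto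
  have yK: "y \<in> K" using y interior_subset by blast
  have dual: "norm (y + w) \<le> r" if w: "\<And>u. u \<in> dual_at K y \<Longrightarrow> w \<bullet> u \<le> 1" for w
  proof (rule ccontr)
    assume "\<not> norm (y + w) \<le> r"
    then have "y + w \<notin> K" using K(3) by auto
    then obtain u where u: "u \<in> dual_at K y" "1 < u \<bullet> w"
      using dual_at_separation[OF compact_imp_closed[OF K(1)] K(2) yK] by blast
    then show False using w[OF u(1)] by (simp add: inner_commute)
  qed
  have inball: "cball 0 (1 / r) \<subseteq> dual_at K y" if "y = 0"
    using K(3) r(1) that by (intro cball_subset_dual_at) auto
  show "0 < 1 * ((DIM('a) + 2) * ((\<integral>z. (v \<bullet> z)\<^sup>2 \<partial>lborel_on (dual_at K y)) / V) - (DIM('a) + 1) * s\<^sup>2 - ((norm v)\<^sup>2 / (1 - (norm y)\<^sup>2) + 2 * s\<^sup>2))"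
    using dual_body_second_moment[OF dual_at_compact[OF y] dual_at_closed_convex(2) zin[OF y] r dr yr v dual inball V s] by simp
qed (use a b in auto)

section \<open>Santalo points of the ball and a convex body\<close>

lemma polar_dual_eq_image: "polar_dual K y = (\<lambda>u. y + - u) ` dual_at K y"
proof (intro equalityI subsetI)
  fix x assume x: "x \<in> polar_dual K y"
  have "y - x \<in> dual_at K y"
    unfolding dual_at_def
  proof (intro CollectI ballI)
    fix z assume "z \<in> K"
    then have "- 1 \<le> (x - y) \<bullet> (z - y)" using x by (simp add: polar_dual_def)
    moreover have "(y - x) \<bullet> (z - y) = - ((x - y) \<bullet> (z - y))" by (metis inner_minus_left minus_diff_eq)
    ultimately show "(y - x) \<bullet> (z - y) \<le> 1" by simp
  qed
  then show "x \<in> (\<lambda>u. y + - u) ` dual_at K y" by (intro image_eqI[of _ _ "y - x"]) auto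
next
  fix x assume "x \<in> (\<lambda>u. y + - u) ` dual_at K y"
  then obtain u where "u \<in> dual_at K y" "x = y - u" by auto
  then show "x \<in> polar_dual K y" by (auto simp: polar_dual_def dual_at_def)
qed

lemma linear_uminus_inj: "linear (uminus :: 'a::real_vector \<Rightarrow> 'a)" "inj (uminus :: 'a \<Rightarrow> 'a)"
  by (auto intro!: linearI injI)

lemma centroid_polar_dual:
  fixes K :: "'a::euclidean_space set"
  assumes "y \<in> interior K" "K \<subseteq> cball 0 1"
  shows "centroid (polar_dual K y) = y - centroid (dual_at K y)"
proof -
  have "norm y \<le> 1" using subsetD[OF assms(2) subsetD[OF interior_subset assms(1)]] by simp
  then have "interior (dual_at K y) \<noteq> {}" using zero_in_interior_dual_at(1)[OF assms(2)] by blast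
  from centroid_affine_image[OF dual_at_compact[OF assms(1)] this linear_uminus_inj, of y]
  show ?thesis by (simp add: polar_dual_eq_image)
qed

lemma dual_at_unit_ball:
  fixes y :: "'a::euclidean_space"
  assumes "norm y < 1"
  shows "dual_at (cball 0 1) y = {u. (norm u)\<^sup>2 \<le> (1 + u \<bullet> y)\<^sup>2}"
proof -
  have sq: "norm u \<le> 1 + u \<bullet> y \<longleftrightarrow> (norm u)\<^sup>2 \<le> (1 + u \<bullet> y)\<^sup>2" for u
  proof
    assume "norm u \<le> 1 + u \<bullet> y"
    then show "(norm u)\<^sup>2 \<le> (1 + u \<bullet> y)\<^sup>2" by (intro power_mono) auto
  next
    assume "(norm u)\<^sup>2 \<le> (1 + u \<bullet> y)\<^sup>2"
    then have a: "norm u \<le> \<bar>1 + u \<bullet> y\<bar>" by (simp add: abs_le_square_iff[symmetric])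
    have "\<bar>u \<bullet> y\<bar> \<le> norm u * norm y" by (rule Cauchy_Schwarz_ineq2)
    also have "\<dots> \<le> norm u * 1" using assms by (intro mult_left_mono) auto
    finally show "norm u \<le> 1 + u \<bullet> y" using a by linarith
  qed
  have "u \<in> dual_at (cball 0 1) y \<longleftrightarrow> norm u \<le> 1 + u \<bullet> y" for u
  proof
    assume u: "u \<in> dual_at (cball 0 1) y"
    define z where "z = (1 / norm u) *\<^sub>R u"
    have "z \<in> cball 0 1" by (simp add: z_def)
    then have "u \<bullet> (z - y) \<le> 1" using u unfolding dual_at_def by blast
    moreover have "u \<bullet> z = norm u" by (cases "u = 0") (simp_all add: z_def dot_square_norm power2_eq_square)
    ultimately show "norm u \<le> 1 + u \<bullet> y" by (simp add: inner_diff_right)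
  next
    assume n: "norm u \<le> 1 + u \<bullet> y"
    show "u \<in> dual_at (cball 0 1) y"
      unfolding dual_at_def
    proof (intro CollectI ballI)
      fix z :: 'a assume "z \<in> cball 0 1"
      then have "norm u * norm z \<le> norm u * 1" by (intro mult_left_mono) auto
      then have "u \<bullet> z \<le> norm u" using norm_cauchy_schwarz[of u z] by linarith
      then show "u \<bullet> (z - y) \<le> 1" using n by (simp add: inner_diff_right)
    qed
  qed
  then show ?thesis using sq by blast
qed

text \<open>The polar is an ellipsoid; its centroid is \<open>c\<close> because the reflection in \<open>c = y / (1 - \<bar>y\<bar>\<^sup>2)\<close> maps it to itself.\<close>

lemma centroid_dual_unit_ball:
  fixes y :: "'a::euclidean_space"
  assumes y: "norm y < 1"
  shows "centroid (dual_at (cball 0 1) y) = (1 / (1 - (norm y)\<^sup>2)) *\<^sub>R y"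
proof -
  let ?D = "dual_at (cball 0 1) y"
  define q where "q = (norm y)\<^sup>2"
  have q: "q \<noteq> 1" using y by (simp add: q_def abs_square_eq_1)
  define c where "c = (1 / (1 - q)) *\<^sub>R y"
  have yy: "y \<bullet> y = q" by (simp add: q_def power2_norm_eq_inner)
  have cy: "c \<bullet> y = q / (1 - q)" by (simp add: c_def yy)
  have key: "(norm (2 *\<^sub>R c - u))\<^sup>2 - (1 + (2 *\<^sub>R c - u) \<bullet> y)\<^sup>2 = (norm u)\<^sup>2 - (1 + u \<bullet> y)\<^sup>2" for u
  proof -
    have cu: "c \<bullet> u = (u \<bullet> y) / (1 - q)" by (simp add: c_def inner_commute)
    have cc: "c \<bullet> c = q / (1 - q)\<^sup>2" by (simp add: c_def yy power2_eq_square)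
    have "(norm (2 *\<^sub>R c - u))\<^sup>2 = 4 * (c \<bullet> c) - 4 * (c \<bullet> u) + u \<bullet> u"
      unfolding power2_norm_eq_inner by (simp add: inner_diff_left inner_diff_right inner_commute)
    moreover have "(2 *\<^sub>R c - u) \<bullet> y = 2 * (q / (1 - q)) - u \<bullet> y" by (simp add: inner_diff_left cy)
    moreover have "4 * (q / (1 - q)\<^sup>2) - 4 * ((u \<bullet> y) / (1 - q)) - (1 + (2 * (q / (1 - q)) - u \<bullet> y))\<^sup>2 = - (1 + u \<bullet> y)\<^sup>2"
    proof -
      define b where "b = 1 / (1 - q)"
      have qb: "q = 1 - 1 / b" and b0: "b \<noteq> 0" using q by (simp_all add: b_def)
      have e1: "q / (1 - q) = b - 1" "q / (1 - q)\<^sup>2 = b * (b - 1)" "(u \<bullet> y) / (1 - q) = b * (u \<bullet> y)"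
        unfolding qb using b0 by (simp_all add: power2_eq_square field_simps)
      show ?thesis unfolding e1 by (simp add: power2_eq_square algebra_simps)
    qed
    ultimately show ?thesis unfolding cu cc by (simp add: power2_norm_eq_inner)
  qed
  have sym: "2 *\<^sub>R c - u \<in> ?D" if "u \<in> ?D" for u
    using that key[of u] unfolding dual_at_unit_ball[OF y] by simp
  have img: "(\<lambda>u. 2 *\<^sub>R c + - u) ` ?D = ?D"
  proof (intro equalityI subsetI)
    fix x assume "x \<in> (\<lambda>u. 2 *\<^sub>R c + - u) ` ?D"
    then show "x \<in> ?D" using sym by auto
  next
    fix x assume "x \<in> ?D"
    then show "x \<in> (\<lambda>u. 2 *\<^sub>R c + - u) ` ?D" using sym by (intro image_eqI[of _ _ "2 *\<^sub>R c - x"]) auto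
  qed
  have yi: "y \<in> interior (cball 0 1)" using y by (simp add: interior_cball)
  have "interior ?D \<noteq> {}" using zero_in_interior_dual_at(1)[of "cball 0 1" y] y by auto
  from centroid_affine_image[OF dual_at_compact[OF yi] this linear_uminus_inj, of "2 *\<^sub>R c"]
  have "centroid ?D = 2 *\<^sub>R c - centroid ?D" unfolding img by simp
  then have "2 *\<^sub>R centroid ?D = 2 *\<^sub>R c" by (simp add: scaleR_2 eq_diff_eq)
  then have "centroid ?D = c" unfolding scaleR_cancel_left by simp
  then show ?thesis by (simp add: c_def q_def)
qed

text \<open>Reflection and translation are the same for both bodies, so \<open>polar_dual\<close> can be replaced by \<open>dual_at\<close>.\<close>

lemma santalo_point_unit_ball_iff:
  fixes K :: "'a::euclidean_space set"
  assumes K: "K \<subseteq> cball 0 1"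
  shows "santalo_point (cball 0 1) K y \<longleftrightarrow> y \<in> interior K \<and> centroid (dual_at K y) = (1 / (1 - (norm y)\<^sup>2)) *\<^sub>R y"
proof (cases "y \<in> interior K")
  case True
  have y: "norm y < 1" using subsetD[OF interior_mono[OF K] True] by (simp add: interior_cball)
  have yi: "y \<in> interior (cball 0 1)" using y by (simp add: interior_cball)
  show ?thesis
    unfolding santalo_point_def centroid_polar_dual[OF yi order_refl] centroid_polar_dual[OF True K] centroid_dual_unit_ball[OF y]
    using True yi by auto
qed (simp add: santalo_point_def)

section \<open>Points and linear maps in homogeneous coordinates\<close>

text \<open>The Lorentzian form \<open>t t' - x \<bullet> x'\<close>. In homogeneous coordinates the unit ball is its cone of timelike
and lightlike directions.\<close>

definition minkowski :: "real \<times> 'a::euclidean_space \<Rightarrow> real \<times> 'a \<Rightarrow> real" where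
  "minkowski u w = fst u * fst w - snd u \<bullet> snd w"

lemma minkowski_add: "minkowski (u + v) w = minkowski u w + minkowski v w" "minkowski w (u + v) = minkowski w u + minkowski w v"
  by (simp_all add: minkowski_def inner_add_left inner_add_right algebra_simps)

lemma minkowski_scale: "minkowski (c *\<^sub>R u) w = c * minkowski u w" "minkowski w (c *\<^sub>R u) = c * minkowski w u"
  by (simp_all add: minkowski_def algebra_simps)

lemma minkowski_commute: "minkowski u w = minkowski w u"
  by (simp add: minkowski_def inner_commute)

lemma minkowski_diff: "minkowski (u - v) w = minkowski u w - minkowski v w" "minkowski w (u - v) = minkowski w u - minkowski w v"
  by (simp_all add: minkowski_def inner_diff_left inner_diff_right algebra_simps)

lemma Rep_Abs_line:
  fixes v :: "real \<times> 'a::euclidean_space"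
  assumes "v \<noteq> 0"
  shows "Rep_proj_space (Abs_proj_space (span {v})) = span {v}"
  using assms by (intro Abs_proj_space_inverse) blast

lemma Rep_affine_point: "Rep_proj_space (affine_point x) = span {(1, x)}"
  unfolding affine_point_def by (rule Rep_Abs_line) (simp add: zero_prod_def)

lemma span_scale_eq:
  fixes v :: "'a::real_vector"
  assumes "c \<noteq> 0"
  shows "span {c *\<^sub>R v} = span {v}"
proof -
  have "{x. \<exists>k. x = k *\<^sub>R c *\<^sub>R v} = {x. \<exists>k. x = k *\<^sub>R v}"
  proof (intro equalityI subsetI)
    fix x assume "x \<in> {x. \<exists>k. x = k *\<^sub>R v}"
    then obtain k where "x = k *\<^sub>R v" by blast
    then have "x = (k / c) *\<^sub>R c *\<^sub>R v" using assms by simp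
    then show "x \<in> {x. \<exists>k. x = k *\<^sub>R c *\<^sub>R v}" by blast
  qed auto
  then show ?thesis by (auto simp: span_singleton)
qed

lemma affine_point_inject [simp]: "affine_point x = affine_point y \<longleftrightarrow> x = y"
proof
  assume "affine_point x = affine_point y"
  then have "Rep_proj_space (affine_point x) = Rep_proj_space (affine_point y)" by simp
  then have "span {(1::real, x)} = span {(1, y)}" unfolding Rep_affine_point .
  then have "(1, x) \<in> span {(1::real, y)}" by (metis insertI1 span_base)
  then obtain k where "(1, x) = k *\<^sub>R (1::real, y)" by (auto simp: span_singleton)
  then show "x = y" by auto
qed simp

lemma proj_map_affine_point:
  assumes "linear A"
  shows "proj_map A (affine_point x) = Abs_proj_space (span {A (1, x)})"
  unfolding proj_map_def Rep_affine_point using linear_span_image[OF assms, of "{(1, x)}"] by simp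

lemma proj_map_affine_point_fst:
  assumes "linear A" "fst (A (1, x)) \<noteq> 0"
  shows "proj_map A (affine_point x) = affine_point ((1 / fst (A (1, x))) *\<^sub>R snd (A (1, x)))"
proof -
  let ?c = "1 / fst (A (1, x))"
  have "(1, ?c *\<^sub>R snd (A (1, x))) = ?c *\<^sub>R A (1, x)" using assms(2) by (simp add: prod_eq_iff)
  then have "span {(1, ?c *\<^sub>R snd (A (1, x)))} = span {A (1, x)}"
    using span_scale_eq[of ?c "A (1, x)"] assms(2) by simp
  then show ?thesis unfolding proj_map_affine_point[OF assms(1)] unfolding affine_point_def by simp
qed

lemma proj_map_affine_point_cases:
  fixes A :: "real \<times> 'a::euclidean_space \<Rightarrow> real \<times> 'a"
  assumes "linear A" "bij A" "proj_map A (affine_point x) = affine_point y"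
  shows "fst (A (1, x)) \<noteq> 0" "y = (1 / fst (A (1, x))) *\<^sub>R snd (A (1, x))"
proof -
  have A0: "A (1, x) \<noteq> 0"
  proof
    assume "A (1, x) = 0"
    then have "A (1, x) = A 0" using assms(1) by (simp add: linear_0)
    then show False using assms(2) by (simp add: bij_def inj_eq zero_prod_def)
  qed
  have "Rep_proj_space (proj_map A (affine_point x)) = span {A (1, x)}"
    unfolding proj_map_affine_point[OF assms(1)] using A0 by (rule Rep_Abs_line)
  then have "span {A (1, x)} = span {(1, y)}" using assms(3) Rep_affine_point by metis
  then have "A (1, x) \<in> span {(1, y)}" by (metis insertI1 span_base)
  then obtain k where k: "A (1, x) = k *\<^sub>R (1, y)" by (auto simp: span_singleton)
  then show "fst (A (1, x)) \<noteq> 0" using A0 by (auto simp: zero_prod_def)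
  then show "y = (1 / fst (A (1, x))) *\<^sub>R snd (A (1, x))" using k by simp
qed

lemma proj_map_scale:
  fixes A :: "real \<times> 'a::euclidean_space \<Rightarrow> real \<times> 'a"
  assumes "linear A" "c \<noteq> 0"
  shows "proj_map (\<lambda>u. c *\<^sub>R A u) = proj_map A"
proof
  fix p :: "'a proj_space"
  obtain v where v: "Rep_proj_space p = span {v}" using Rep_proj_space[of p] by blast
  have l: "linear (\<lambda>u. c *\<^sub>R A u)" using assms(1) by (intro linear_compose_scale_right)
  have "(\<lambda>u. c *\<^sub>R A u) ` span {v} = span {c *\<^sub>R A v}" using linear_span_image[OF l, of "{v}"] by simp
  also have "\<dots> = span {A v}" using assms(2) by (rule span_scale_eq)
  also have "\<dots> = A ` span {v}" using linear_span_image[OF assms(1), of "{v}"] by simp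
  finally show "proj_map (\<lambda>u. c *\<^sub>R A u) p = proj_map A p" unfolding proj_map_def v by simp
qed

lemma proj_map_comp:
  fixes A B :: "real \<times> 'a::euclidean_space \<Rightarrow> real \<times> 'a"
  assumes A: "linear A" "inj A" and B: "linear B"
  shows "proj_map (B \<circ> A) = proj_map B \<circ> proj_map A"
proof
  fix p :: "'a proj_space"
  obtain v where v: "Rep_proj_space p = span {v}" "v \<noteq> 0" using Rep_proj_space[of p] by blast
  have "A v \<noteq> 0" using A v(2) by (metis injD linear_0)
  moreover have e: "A ` span {v} = span {A v}" using linear_span_image[OF A(1), of "{v}"] by simp
  ultimately have "Rep_proj_space (proj_map A p) = A ` span {v}"
    unfolding proj_map_def v(1) e by (intro Rep_Abs_line)
  then show "proj_map (B \<circ> A) p = (proj_map B \<circ> proj_map A) p"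
    unfolding comp_def proj_map_def[of B] proj_map_def[of "\<lambda>x. B (A x)"] v(1) by (simp add: image_image)
qed

section \<open>Lorentz maps and the projective automorphisms of the ball\<close>

lemma minkowski_self: "minkowski u u = (fst u)\<^sup>2 - (norm (snd u))\<^sup>2"
  by (simp add: minkowski_def power2_norm_eq_inner power2_eq_square[of "fst u"])

text \<open>Isometries of the Minkowski form whose projective map sends \<open>p\<close> to the center of the ball. The factor
\<open>sqrt (1 - \<bar>p\<bar>\<^sup>2)\<close> is forced up to sign by the isometry property; its sign means that the direction of time is preserved.\<close>

definition lorentz_to_origin :: "(real \<times> 'a::euclidean_space \<Rightarrow> real \<times> 'a) \<Rightarrow> 'a \<Rightarrow> bool" where
  "lorentz_to_origin A p \<longleftrightarrow> linear A \<and> bij A \<and> (\<forall>u w. minkowski (A u) (A w) = minkowski u w) \<and>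
     norm p < 1 \<and> A (1, p) = (sqrt (1 - (norm p)\<^sup>2), 0)"

lemma lorentz_to_originD:
  assumes "lorentz_to_origin A p"
  shows "linear A" "bij A" "minkowski (A u) (A w) = minkowski u w" "norm p < 1" "A (1, p) = (sqrt (1 - (norm p)\<^sup>2), 0)"
    "0 < sqrt (1 - (norm p)\<^sup>2)"
proof -
  show "linear A" "bij A" "norm p < 1" "A (1, p) = (sqrt (1 - (norm p)\<^sup>2), 0)"
    using assms unfolding lorentz_to_origin_def by blast+
  then show "0 < sqrt (1 - (norm p)\<^sup>2)" by (simp add: abs_square_less_1)
  show "minkowski (A u) (A w) = minkowski u w" using assms unfolding lorentz_to_origin_def by blast
qed

text \<open>The first coordinate is the product with \<open>(1, 0)\<close>, which is the image of a multiple of \<open>(1, p)\<close>. So the projective map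
sends the same hyperplane to infinity as \<open>persp p\<close>.\<close>

lemma lorentz_to_origin_fst:
  assumes "lorentz_to_origin A p"
  shows "fst (A u) = (fst u - p \<bullet> snd u) / sqrt (1 - (norm p)\<^sup>2)"
proof -
  have "fst (A u) * sqrt (1 - (norm p)\<^sup>2) = minkowski (A u) (A (1, p))"
    unfolding lorentz_to_originD(5)[OF assms] by (simp add: minkowski_def)
  also have "\<dots> = minkowski u (1, p)" by (rule lorentz_to_originD(3)[OF assms])
  also have "\<dots> = fst u - p \<bullet> snd u" by (simp add: minkowski_def inner_commute)
  finally show ?thesis using lorentz_to_originD(6)[OF assms] by (simp add: eq_divide_eq)
qed

lemma lorentz_to_origin_fst_pos:
  assumes "lorentz_to_origin A p" "norm x \<le> 1"
  shows "0 < fst (A (1, x))"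
proof -
  have "p \<bullet> x \<le> norm p * norm x" by (rule norm_cauchy_schwarz)
  also have "\<dots> \<le> norm p * 1" using assms(2) by (intro mult_left_mono) auto
  finally have "p \<bullet> x < 1" using lorentz_to_originD(4)[OF assms(1)] by simp
  then show ?thesis using lorentz_to_originD(6)[OF assms(1)] by (simp add: lorentz_to_origin_fst[OF assms(1)])
qed

lemma linear_prod_split:
  assumes "linear A"
  shows "A (t, x) = t *\<^sub>R A (1, 0) + A (0, x)"
proof -
  have "A (t, x) = A (t *\<^sub>R (1, 0) + (0, x))" by simp
  then show ?thesis by (simp only: linear_add[OF assms] linear_scale[OF assms])
qed

text \<open>With \<open>z = persp p x\<close>, the vector \<open>(1, x)\<close> is a multiple of \<open>(1 + p \<bullet> z, z)\<close>, and by \<open>lorentz_to_origin_fst\<close> the first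
coordinate of \<open>A (1 + p \<bullet> z, z)\<close> is constant. So in the affine chart the projective map is an affine
map \<open>z \<mapsto> a + f z\<close> after \<open>persp p\<close>. At \<open>z = c p\<close> with \<open>c = 1 / (1 - \<bar>p\<bar>\<^sup>2)\<close> one has \<open>1 + p \<bullet> z = c\<close>, so the argument of \<open>A\<close> is
\<open>c (1, p)\<close> and the affine map takes the value \<open>0\<close>.\<close>

lemma centering_iff:
  fixes K :: "'a::euclidean_space set"
  assumes A: "lorentz_to_origin A p" and K: "compact K" "interior K \<noteq> {}" "K \<subseteq> ball 0 1"
  shows "centroid (affine_point -` proj_map A ` affine_point ` K) = 0 \<longleftrightarrow>
     centroid (persp p ` K) = (1 / (1 - (norm p)\<^sup>2)) *\<^sub>R p"
proof -
  define g where "g = sqrt (1 - (norm p)\<^sup>2)"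
  note lin = lorentz_to_originD(1)[OF A] and p1 = lorentz_to_originD(4)[OF A] and g0 = lorentz_to_originD(6)[OF A, folded g_def]
  note fstA = lorentz_to_origin_fst[OF A, folded g_def]
  have lt: "p \<bullet> x < 1" if "x \<in> K" for x
    using that p1 K(3) by (intro ball_inner_less_one) auto
  define f where "f z = g *\<^sub>R snd (A (p \<bullet> z, z))" for z
  define a where "a = g *\<^sub>R snd (A (1, 0))"
  have fR: "a + f z = g *\<^sub>R snd (A (1 + p \<bullet> z, z))" for z
  proof -
    have "A (1 + p \<bullet> z, z) = A (1, 0) + A (p \<bullet> z, z)" unfolding linear_add[OF lin, symmetric] by simp
    then show ?thesis by (simp add: a_def f_def scaleR_add_right)
  qed
  have "linear (\<lambda>z. (p \<bullet> z, z))" by (rule linearI) (simp_all add: inner_add_right)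
  then have lin2: "linear (\<lambda>z. A (p \<bullet> z, z))" using linear_compose[OF _ lin, of "\<lambda>z. (p \<bullet> z, z)"] by (simp add: o_def)
  have flin: "linear f"
  proof (rule linearI)
    show "f (x + y) = f x + f y" for x y
      unfolding f_def linear_add[OF lin2] by (simp add: scaleR_add_right)
    show "f (c *\<^sub>R x) = c *\<^sub>R f x" for c x
      unfolding f_def linear_scale[OF lin2] by simp
  qed
  have finj: "inj f"
    unfolding linear_injective_0[OF flin]
  proof (intro allI impI)
    fix z assume "f z = 0"
    then have "snd (A (p \<bullet> z, z)) = 0" using g0 by (simp add: f_def)
    moreover have "fst (A (p \<bullet> z, z)) = 0" by (simp add: fstA)
    ultimately have "A (p \<bullet> z, z) = A 0" using lin by (simp add: linear_0 prod_eq_iff)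
    then have "(p \<bullet> z, z) = 0" using lorentz_to_originD(2)[OF A] by (simp add: bij_def inj_eq)
    then show "z = 0" by (simp add: zero_prod_def)
  qed
  have T: "(1 / fst (A (1, x))) *\<^sub>R snd (A (1, x)) = a + f (persp p x)" if "x \<in> K" for x
  proof -
    define c where "c = 1 / (1 - p \<bullet> x)"
    have c: "c > 0" using lt[OF that] by (simp add: c_def)
    have "(1 + p \<bullet> persp p x, persp p x) = c *\<^sub>R (1, x)"
      using persp_denominator[of p x "- p"] lt[OF that] by (simp add: c_def persp_def)
    then have "a + f (persp p x) = g *\<^sub>R c *\<^sub>R snd (A (1, x))" unfolding fR by (simp only: linear_scale[OF lin] snd_scaleR)
    moreover have "1 / fst (A (1, x)) = g * c" using g0 by (simp add: fstA c_def)
    ultimately show ?thesis by simp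
  qed
  have pos: "fst (A (1, x)) \<noteq> 0" if "x \<in> K" for x
    using lorentz_to_origin_fst_pos[OF A, of x] K(3) that by auto
  have "affine_point -` proj_map A ` affine_point ` K = (\<lambda>z. a + f z) ` persp p ` K"
  proof -
    have "proj_map A ` affine_point ` K = affine_point ` (\<lambda>z. a + f z) ` persp p ` K"
      unfolding image_image using proj_map_affine_point_fst[OF lin pos] T by (intro image_cong refl) simp
    then show ?thesis by (auto simp: inj_vimage_image_eq inj_def)
  qed
  moreover have "centroid ((\<lambda>z. a + f z) ` persp p ` K) = a + f (centroid (persp p ` K))"
    using compact_persp_image[OF K(1) lt] interior_persp_image[OF K(2) lt] flin finj by (intro centroid_affine_image) auto
  moreover have "a + f ((1 / (1 - (norm p)\<^sup>2)) *\<^sub>R p) = 0"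
  proof -
    define c where "c = 1 / (1 - (norm p)\<^sup>2)"
    have nz: "1 - (norm p)\<^sup>2 \<noteq> 0" using g0 by (auto simp: g_def)
    have "(1 + p \<bullet> (c *\<^sub>R p), c *\<^sub>R p) = c *\<^sub>R (1, p)"
      using nz by (simp add: c_def power2_norm_eq_inner[symmetric] field_simps)
    then have "a + f (c *\<^sub>R p) = g *\<^sub>R c *\<^sub>R snd (A (1, p))" unfolding fR by (simp only: linear_scale[OF lin] snd_scaleR)
    then show ?thesis by (simp add: lorentz_to_originD(5)[OF A] c_def)
  qed
  ultimately have "centroid (affine_point -` proj_map A ` affine_point ` K) = 0 \<longleftrightarrow>
     a + f (centroid (persp p ` K)) = a + f ((1 / (1 - (norm p)\<^sup>2)) *\<^sub>R p)" by simp
  then show ?thesis using finj by (simp add: inj_eq)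
qed

text \<open>The normalised vectors \<open>P\<close> over \<open>p\<close> and \<open>e\<close> over the center are exchanged by the point reflection in their
hyperbolic midpoint, which is the direction of \<open>m = P + e\<close>. Being an involution that maps the ball into itself, it maps the
ball onto itself.\<close>

lemma lorentz_boost_exists:
  fixes p :: "'a::euclidean_space"
  assumes p: "norm p < 1"
  shows "\<exists>A. lorentz_to_origin A p \<and> proj_map A ` affine_point ` cball 0 1 = affine_point ` cball 0 1"
proof -
  define g where "g = sqrt (1 - (norm p)\<^sup>2)"
  have g0: "0 < g" using p by (simp add: g_def abs_square_less_1)
  have g2: "g\<^sup>2 = 1 - (norm p)\<^sup>2" using p by (simp add: g_def abs_square_le_1 less_imp_le)
  define e :: "real \<times> 'a" where "e = (1, 0)"
  define P :: "real \<times> 'a" where "P = (1 / g) *\<^sub>R (1, p)"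
  have ee: "minkowski e e = 1" by (simp add: e_def minkowski_def)
  have Pe: "minkowski P e = 1 / g" by (simp add: P_def e_def minkowski_def)
  have PP: "minkowski P P = 1"
  proof -
    have "minkowski (1, p) (1, p) = g\<^sup>2" by (simp add: minkowski_def g2 power2_norm_eq_inner)
    moreover have "minkowski P P = (1 / g) * ((1 / g) * minkowski (1, p) (1, p))" unfolding P_def minkowski_scale ..
    ultimately show ?thesis using g0 by (simp add: power2_eq_square)
  qed
  define m where "m = P + e"
  define k where "k = 1 + 1 / g"
  have k0: "0 < k" using g0 by (simp add: k_def add_pos_pos)
  have mm: "minkowski m m = 2 * k" by (simp add: m_def minkowski_add PP ee Pe minkowski_commute[of e P] k_def)
  define A where "A u = (minkowski u m / k) *\<^sub>R m - u" for u
  have lin: "linear A"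
    unfolding A_def by (rule linearI) (simp_all add: minkowski_add minkowski_scale add_divide_distrib algebra_simps)
  have lm: "minkowski (A u) m = minkowski u m" for u
    using k0 by (simp add: A_def minkowski_diff minkowski_scale mm)
  have inv: "A (A u) = u" for u by (subst A_def) (simp add: lm, simp add: A_def)
  have iso: "minkowski (A u) (A w) = minkowski u w" for u w
  proof -
    have "minkowski (A u) (A w) = (minkowski w m / k) * minkowski (A u) m - minkowski (A u) w"
      unfolding A_def[of w] by (simp add: minkowski_diff minkowski_scale)
    also have "minkowski (A u) w = (minkowski u m / k) * minkowski m w - minkowski u w" by (simp add: A_def minkowski_diff minkowski_scale)
    finally show ?thesis by (simp add: lm minkowski_commute[of m w])
  qed
  have AP: "A P = e"
  proof -
    have "minkowski P m = k" by (simp add: m_def minkowski_add PP Pe k_def)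
    then show ?thesis using k0 by (simp add: A_def m_def)
  qed
  have "(1, p) = g *\<^sub>R P" using g0 by (simp add: P_def)
  then have "A (1, p) = g *\<^sub>R A P" by (simp only: linear_scale[OF lin])
  then have Ap: "A (1, p) = (g, 0)" by (simp add: AP e_def)
  have "bij A" using inv by (intro o_bij[of A A]) (auto simp: fun_eq_iff)
  then have L: "lorentz_to_origin A p" using lin iso p Ap by (simp add: lorentz_to_origin_def g_def)
  define T where "T x = (1 / fst (A (1, x))) *\<^sub>R snd (A (1, x))" for x
  have pos: "0 < fst (A (1, x))" if "x \<in> cball 0 1" for x
    using lorentz_to_origin_fst_pos[OF L] that by simp
  have Tb: "T x \<in> cball 0 1" if x: "x \<in> cball 0 1" for x
  proof -
    have "minkowski (A (1, x)) (A (1, x)) = 1 - (norm x)\<^sup>2"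
      unfolding iso by (simp add: minkowski_def power2_norm_eq_inner)
    moreover have "0 \<le> 1 - (norm x)\<^sup>2" using x by (simp add: abs_square_le_1)
    ultimately have "(norm (snd (A (1, x))))\<^sup>2 \<le> (fst (A (1, x)))\<^sup>2"
      unfolding minkowski_self by linarith
    then have "norm (snd (A (1, x))) \<le> fst (A (1, x))" by (rule power2_le_imp_le) (rule less_imp_le[OF pos[OF x]])
    then show ?thesis using pos[OF x] by (simp add: T_def divide_le_eq)
  qed
  \<comment> \<open>The map \<open>A\<close> is an involution, hence so is its projective map.\<close>
  have TT: "T (T x) = x" if x: "x \<in> cball 0 1" for x
  proof -
    have "(1, T x) = (1 / fst (A (1, x))) *\<^sub>R A (1, x)" using pos[OF x] by (simp add: T_def prod_eq_iff)
    then have "A (1, T x) = (1 / fst (A (1, x))) *\<^sub>R A (A (1, x))" by (simp only: linear_scale[OF lin])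
    then show ?thesis using pos[OF x] unfolding inv by (simp add: T_def[of "T x"])
  qed
  have "proj_map A ` affine_point ` cball 0 1 = affine_point ` T ` cball 0 1"
    unfolding image_image T_def using proj_map_affine_point_fst[OF lin] pos by (intro image_cong refl) (metis less_irrefl)
  also have "T ` cball 0 1 = cball 0 1"
    using Tb TT by (auto simp: image_iff) (metis mem_cball_0 TT Tb)
  finally show ?thesis using L by blast
qed

lemma lorentz_to_origin_rotation:
  fixes A :: "real \<times> 'a::euclidean_space \<Rightarrow> real \<times> 'a"
  assumes A: "lorentz_to_origin A p" and Q: "orthogonal_transformation Q"
  shows "lorentz_to_origin (map_prod id Q \<circ> A) p"
    and "proj_map (map_prod id Q \<circ> A) = proj_extension Q \<circ> proj_map A"
    and "proj_extension Q ` affine_point ` cball 0 1 = affine_point ` cball 0 1"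
proof -
  have Ql: "linear Q" using Q by (rule orthogonal_transformation_linear)
  have Qb: "bij Q" using Q by (rule orthogonal_transformation_bij)
  have l: "linear (map_prod id Q :: real \<times> 'a \<Rightarrow> real \<times> 'a)"
    using Ql by (intro linearI) (auto simp: linear_add linear_scale)
  have b: "bij (map_prod id Q :: real \<times> 'a \<Rightarrow> real \<times> 'a)"
    using Qb by (auto simp: bij_def intro!: map_prod_inj_on[where A=UNIV and B=UNIV, simplified] map_prod_surj)
  have o: "minkowski (map_prod id Q u) (map_prod id Q w) = minkowski u w" for u w :: "real \<times> 'a"
    using Q by (simp add: minkowski_def orthogonal_transformation_def)
  show "lorentz_to_origin (map_prod id Q \<circ> A) p"
    unfolding lorentz_to_origin_def
  proof (intro conjI allI)
    show "linear (map_prod id Q \<circ> A)" using lorentz_to_originD(1)[OF A] l by (rule linear_compose)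
    show "bij (map_prod id Q \<circ> A)" using lorentz_to_originD(2)[OF A] b by (rule bij_comp)
    show "minkowski ((map_prod id Q \<circ> A) u) ((map_prod id Q \<circ> A) w) = minkowski u w" for u w
      using o lorentz_to_originD(3)[OF A] by simp
    show "norm p < 1" using lorentz_to_originD(4)[OF A] .
    show "(map_prod id Q \<circ> A) (1, p) = (sqrt (1 - (norm p)\<^sup>2), 0)"
      using lorentz_to_originD(5)[OF A] Ql by (simp add: linear_0)
  qed
  show "proj_map (map_prod id Q \<circ> A) = proj_extension Q \<circ> proj_map A"
    unfolding proj_extension_def using lorentz_to_originD(1,2)[OF A] l by (intro proj_map_comp) (auto simp: bij_def)
  have "proj_extension Q (affine_point x) = affine_point (Q x)" for x
    unfolding proj_extension_def by (subst proj_map_affine_point_fst[OF l]) auto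
  then have "proj_extension Q ` affine_point ` cball 0 1 = affine_point ` Q ` cball 0 1"
    by (simp add: image_image)
  also have "Q ` cball 0 1 = cball 0 1" using image_orthogonal_transformation_cball[OF Q, of 0 1] Ql by (simp add: linear_0)
  finally show "proj_extension Q ` affine_point ` cball 0 1 = affine_point ` cball 0 1" .
qed

text \<open>Two such maps differ by a Lorentz map that fixes \<open>(1, 0)\<close>; it preserves the orthogonal complement \<open>{0} \<times> \<real>\<^sup>d\<close>
and acts on it as an orthogonal transformation.\<close>

lemma lorentz_to_origin_unique:
  fixes A B :: "real \<times> 'a::euclidean_space \<Rightarrow> real \<times> 'a"
  assumes A: "lorentz_to_origin A p" and B: "lorentz_to_origin B p"
  shows "\<exists>Q. orthogonal_transformation Q \<and> proj_map B = proj_extension Q \<circ> proj_map A"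
proof -
  define g where "g = sqrt (1 - (norm p)\<^sup>2)"
  have g0: "0 < g" using lorentz_to_originD(6)[OF A] by (simp add: g_def)
  define C where "C = B \<circ> inv A"
  have iA: "linear (inv A)"
    using lorentz_to_originD(1,2)[OF A] by (metis bij_is_inj bij_is_surj inj_linear_imp_inv_linear)
  have AA: "A (inv A u) = u" for u using lorentz_to_originD(2)[OF A] by (simp add: bij_is_surj surj_f_inv_f)
  have Cl: "linear C" unfolding C_def using iA lorentz_to_originD(1)[OF B] by (rule linear_compose)
  have CA: "C \<circ> A = B" using lorentz_to_originD(2)[OF A] by (auto simp: C_def fun_eq_iff bij_is_inj)
  have Co: "minkowski (C u) (C w) = minkowski u w" for u w
    using lorentz_to_originD(3)[OF B, of "inv A u" "inv A w"] lorentz_to_originD(3)[OF A, of "inv A u" "inv A w"] by (simp add: C_def AA)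
  have Ce: "C (1, 0) = (1, 0)"
  proof -
    have "C (A (1, p)) = B (1, p)" using CA by (metis comp_apply)
    then have "C (g *\<^sub>R (1, 0)) = g *\<^sub>R (1, 0)" using lorentz_to_originD(5)[OF A] lorentz_to_originD(5)[OF B] by (simp add: g_def)
    then have "g *\<^sub>R C (1, 0) = g *\<^sub>R (1, 0)" by (simp only: linear_scale[OF Cl])
    then show ?thesis using g0 by (simp only: scaleR_cancel_left) auto
  qed
  define Q where "Q x = snd (C (0, x))" for x
  have f0: "fst (C (0, x)) = 0" for x
    using Co[of "(0, x)" "(1, 0)"] unfolding Ce by (simp add: minkowski_def)
  have Cm: "C = map_prod id Q"
  proof
    fix u :: "real \<times> 'a"
    show "C u = map_prod id Q u"
      using linear_prod_split[OF Cl, of "fst u" "snd u"] f0[of "snd u"] by (simp add: Ce Q_def prod_eq_iff)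
  qed
  have l0: "linear (\<lambda>x. C (0, x))"
    using linear_compose[OF _ Cl, of "\<lambda>x. (0, x)"] by (simp add: o_def linear_iff)
  have "linear Q"
  proof (rule linearI)
    show "Q (x + y) = Q x + Q y" for x y
      unfolding Q_def linear_add[OF l0] by simp
    show "Q (c *\<^sub>R x) = c *\<^sub>R Q x" for c x
      unfolding Q_def linear_scale[OF l0] by simp
  qed
  moreover have "Q x \<bullet> Q y = x \<bullet> y" for x y
    using Co[of "(0, x)" "(0, y)"] f0 by (simp add: minkowski_def Q_def)
  ultimately have Q: "orthogonal_transformation Q" by (simp add: orthogonal_transformation_def)
  have "proj_map B = proj_extension Q \<circ> proj_map A"
    using lorentz_to_origin_rotation(2)[OF A Q] CA Cm by metis
  then show ?thesis using Q by blast
qed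

text \<open>Evaluating the form at \<open>(1, x)\<close> and \<open>(1, - x)\<close> for unit vectors \<open>x\<close> shows that its mixed terms vanish and that its
restriction to \<open>{0} \<times> \<real>\<^sup>d\<close> takes the value \<open>- b (1, 0) (1, 0)\<close> on the unit sphere. Polarisation does the rest.\<close>

lemma vanishing_on_light_cone:
  fixes b :: "real \<times> 'a::euclidean_space \<Rightarrow> real \<times> 'a \<Rightarrow> real"
  assumes add: "\<And>u v w. b (u + v) w = b u w + b v w" and scale: "\<And>c u w. b (c *\<^sub>R u) w = c * b u w"
    and sym: "\<And>u w. b u w = b w u" and cone: "\<And>x. norm x = 1 \<Longrightarrow> b (1, x) (1, x) = 0"
  shows "b u w = b (1, 0) (1, 0) * minkowski u w"
proof -
  have add': "b w (u + v) = b w u + b w v" and scale': "b w (c *\<^sub>R u) = c * b w u" for u v w c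
    using add scale sym by metis+
  define \<alpha> where "\<alpha> = b (1, 0) (1, 0)"
  define \<beta> where "\<beta> x = b (1, 0) (0, x)" for x
  define S where "S x y = b (0, x) (0, y)" for x y
  have split: "(t, x) = t *\<^sub>R (1, 0) + (0, x)" for t and x :: 'a by simp
  have gen: "b (t, x) (r, y) = t * r * \<alpha> + t * \<beta> y + r * \<beta> x + S x y" for t r x y
    unfolding split[of t x] split[of r y] add add' scale scale' sym[of "(0, x)" "(1, 0)"]
    by (simp add: \<alpha>_def \<beta>_def S_def algebra_simps)
  have neg: "(0, - x) = (- 1) *\<^sub>R (0 :: real, x)" for x :: 'a by simp
  have \<beta>m: "\<beta> (- x) = - \<beta> x" and Sm: "S (- x) (- x) = S x x" for x
    unfolding \<beta>_def S_def neg scale scale' by simp_all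
  have unit: "\<beta> x = 0 \<and> S x x = - \<alpha>" if "norm x = 1" for x
    using cone[OF that] cone[of "- x"] that unfolding gen \<beta>m Sm by simp
  have scl: "(0, c *\<^sub>R x) = c *\<^sub>R (0 :: real, x)" for c and x :: 'a by simp
  have all: "\<beta> x = 0 \<and> S x x = - \<alpha> * (x \<bullet> x)" for x
  proof (cases "x = 0")
    case True
    have z: "(0, 0) = 0 *\<^sub>R (0 :: real, 0 :: 'a)" by simp
    show ?thesis unfolding True \<beta>_def S_def by (subst (1 2 3) z) (simp only: scale scale', simp)
  next
    case False
    define n where "n = norm x"
    have n: "n \<noteq> 0" using False by (simp add: n_def)
    define y where "y = (1 / n) *\<^sub>R x"
    have y: "norm y = 1" "x = n *\<^sub>R y" using n by (simp_all add: y_def n_def)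
    have "\<beta> x = n * \<beta> y" "S x x = n * (n * S y y)" unfolding \<beta>_def S_def y(2) scl scale scale' by simp_all
    then show ?thesis using unit[OF y(1)] by (simp add: n_def power2_norm_eq_inner[symmetric] power2_eq_square)
  qed
  have S: "S x y = - \<alpha> * (x \<bullet> y)" for x y
  proof -
    have "(0, x + y) = (0 :: real, x) + (0, y)" by simp
    then have "S (x + y) (x + y) = S x x + 2 * S x y + S y y"
      unfolding S_def by (simp only: add add' sym[of "(0, y)" "(0, x)"])
    moreover have "(x + y) \<bullet> (x + y) = x \<bullet> x + 2 * (x \<bullet> y) + y \<bullet> y" by (simp add: inner_add_left inner_add_right inner_commute)
    ultimately have "2 * S x y = 2 * (- \<alpha> * (x \<bullet> y))" using all by (simp add: algebra_simps)
    then show ?thesis by simp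
  qed
  show ?thesis
    using gen[of "fst u" "snd u" "fst w" "snd w"] all S by (simp add: minkowski_def \<alpha>_def algebra_simps)
qed

text \<open>The linear map can be rescaled so that it maps \<open>{1} \<times> B\<close> to the half space of positive time. Then it maps the cone
over the ball onto itself, and its boundary, the light cone, to itself. By \<open>vanishing_on_light_cone\<close> it multiplies
the Minkowski form by a constant \<open>\<alpha>\<close>, which is positive, and division by \<open>sqrt \<alpha>\<close> makes it an isometry.\<close>

lemma ball_fixing_lorentz:
  fixes \<psi> :: "'a::euclidean_space proj_space \<Rightarrow> 'a proj_space"
  assumes \<psi>: "projective_transformation \<psi>" and ball: "\<psi> ` affine_point ` cball 0 1 = affine_point ` cball 0 1"
  shows "\<exists>A p. lorentz_to_origin A p \<and> \<psi> = proj_map A"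
proof -
  obtain A0 where A0: "linear A0" "bij A0" "\<psi> = proj_map A0"
    using \<psi> unfolding projective_transformation_def by blast
  have img: "\<exists>y\<in>cball 0 1. proj_map A0 (affine_point x) = affine_point y" if "x \<in> cball 0 1" for x
  proof -
    have "\<psi> (affine_point x) \<in> \<psi> ` affine_point ` cball 0 1" using that by (intro imageI)
    then have "proj_map A0 (affine_point x) \<in> affine_point ` cball 0 1" by (simp only: ball A0(3)[symmetric])
    then show ?thesis by (simp only: image_iff)
  qed
  have f0: "fst (A0 (1, x)) \<noteq> 0" if "x \<in> cball 0 1" for x
    using img[OF that] proj_map_affine_point_cases(1)[OF A0(1,2), of x] by force
  define s where "s = fst (A0 (1, 0))"
  have s0: "s \<noteq> 0" using f0[of 0] by (simp add: s_def)
  define A1 where "A1 u = (1 / s) *\<^sub>R A0 u" for u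
  have lin: "linear A1" 
    unfolding A1_def by (rule linearI) (simp_all add: linear_add[OF A0(1)] linear_scale[OF A0(1)] scaleR_add_right)
  have bijs: "bij (\<lambda>u::real \<times> 'a. (1 / s) *\<^sub>R u)"
    by (rule o_bij[where g = "\<lambda>u::real \<times> 'a. s *\<^sub>R u"]) (use s0 in \<open>simp_all add: fun_eq_iff\<close>)
  have bij: "bij A1"
    using bij_comp[OF A0(2) bijs] by (simp add: A1_def[abs_def] o_def)
  have \<psi>1: "\<psi> = proj_map A1"
    unfolding A1_def[abs_def] A0(3) using A0(1) s0 by (subst proj_map_scale) auto
  have inj: "A1 u = A1 w \<Longrightarrow> u = w" for u w using bij by (simp add: bij_def inj_eq)
  have pos: "0 < fst (A1 (1, x))" if x: "x \<in> cball 0 1" for x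
  proof (rule ccontr)
    define h where "h = fst (A1 (1, x))"
    assume "\<not> 0 < fst (A1 (1, x))"
    then have h: "h \<le> 0" by (simp add: h_def)
    \<comment> \<open>Otherwise the first coordinate would vanish at a point of the segment from \<open>0\<close> to \<open>x\<close>, whose image would be at infinity.\<close>
    define t where "t = 1 / (1 - h)"
    have t: "0 \<le> t" "t \<le> 1" using h by (auto simp: t_def divide_le_eq)
    have e1: "fst (A1 (1, 0)) = 1" using s0 by (simp add: A1_def s_def)
    have "(1 :: real, t *\<^sub>R x) = (1 - t) *\<^sub>R (1, 0) + t *\<^sub>R (1, x)" by simp
    then have "A1 (1, t *\<^sub>R x) = (1 - t) *\<^sub>R A1 (1, 0) + t *\<^sub>R A1 (1, x)"
      by (simp only: linear_add[OF lin, symmetric] linear_scale[OF lin, symmetric])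
    then have "fst (A1 (1, t *\<^sub>R x)) = (1 - t) + t * h" by (simp add: e1 h_def)
    also have "\<dots> = 0" using h by (simp add: t_def field_simps)
    finally have "fst (A0 (1, t *\<^sub>R x)) = 0" using s0 by (simp add: A1_def)
    moreover have "t *\<^sub>R x \<in> cball 0 1" using x t by (simp add: mult_le_one)
    ultimately show False using f0 by blast
  qed
  have Tb: "norm (snd (A1 (1, x))) \<le> fst (A1 (1, x))" if x: "x \<in> cball 0 1" for x
  proof -
    obtain y where y: "y \<in> cball 0 1" "proj_map A1 (affine_point x) = affine_point y"
      using img[OF x] by (simp only: A0(3)[symmetric] \<psi>1) (elim bexE, rule that)
    then have "y = (1 / fst (A1 (1, x))) *\<^sub>R snd (A1 (1, x))"
      using proj_map_affine_point_cases(2)[OF lin bij] by blast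
    then have "norm (snd (A1 (1, x))) / fst (A1 (1, x)) \<le> 1" using y(1) pos[OF x] by simp
    then show ?thesis using pos[OF x] by (simp add: divide_le_eq)
  qed
  have onto: "w \<in> cball 0 1" if w: "0 < fst (A1 (1, w))" "norm (snd (A1 (1, w))) \<le> fst (A1 (1, w))" for w
  proof -
    define y where "y = (1 / fst (A1 (1, w))) *\<^sub>R snd (A1 (1, w))"
    have "y \<in> cball 0 1" using w by (simp add: y_def divide_le_eq)
    then have "affine_point y \<in> \<psi> ` affine_point ` cball 0 1" unfolding ball by (rule imageI)
    then obtain x where x: "x \<in> cball 0 1" "affine_point y = proj_map A1 (affine_point x)"
      unfolding \<psi>1 by (elim imageE) (simp only: that)
    have yx: "y = (1 / fst (A1 (1, x))) *\<^sub>R snd (A1 (1, x))"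
      using proj_map_affine_point_cases(2)[OF lin bij x(2)[symmetric]] .
    have a: "(1 / fst (A1 (1, w))) *\<^sub>R A1 (1, w) = (1, y)" using w(1) by (simp add: prod_eq_iff y_def)
    have b: "(1 / fst (A1 (1, x))) *\<^sub>R A1 (1, x) = (1, y)" using pos[OF x(1)] by (simp add: prod_eq_iff yx)
    have "A1 ((1 / fst (A1 (1, w))) *\<^sub>R (1, w)) = A1 ((1 / fst (A1 (1, x))) *\<^sub>R (1, x))"
      unfolding linear_scale[OF lin] a b ..
    then have "(1 / fst (A1 (1, w))) *\<^sub>R (1 :: real, w) = (1 / fst (A1 (1, x))) *\<^sub>R (1, x)" by (rule inj)
    then have "w = x" using w(1) pos[OF x(1)] by auto
    then show ?thesis using x(1) by simp
  qed
  have cone: "minkowski (A1 (1, x)) (A1 (1, x)) = 0" if x: "norm x = 1" for x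
  proof -
    have xb: "x \<in> cball 0 1" using x by simp
    \<comment> \<open>If the image of a boundary point were an interior point of the cone, then so would be the images of points slightly
      outside the ball, which contradicts \<open>onto\<close>.\<close>
    have "\<not> norm (snd (A1 (1, x))) < fst (A1 (1, x))"
    proof
      assume lt: "norm (snd (A1 (1, x))) < fst (A1 (1, x))"
      define F where "F t = fst (A1 (1, t *\<^sub>R x)) - norm (snd (A1 (1, t *\<^sub>R x)))" for t
      have Ac: "continuous_on UNIV A1" using lin by (simp add: linear_continuous_on linear_linear)
      have "continuous_on UNIV (\<lambda>t. A1 (1, t *\<^sub>R x))"
        by (rule continuous_on_compose2[OF Ac]) (auto intro!: continuous_intros)
      then have "continuous_on UNIV F" unfolding F_def by (intro continuous_intros)
      then have "isCont F 1" by (simp add: continuous_on_eq_continuous_at)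
      moreover have "0 < F 1" using lt by (simp add: F_def)
      ultimately obtain e where e: "0 < e" "\<And>t. \<bar>t - 1\<bar> < e \<Longrightarrow> \<bar>F t - F 1\<bar> < F 1"
        unfolding continuous_at_real_range by fastforce
      have "\<bar>F (1 + e / 2) - F 1\<bar> < F 1" using e(1) by (intro e(2)) simp
      then have "0 < F (1 + e / 2)" by linarith
      then have "norm (snd (A1 (1, (1 + e / 2) *\<^sub>R x))) < fst (A1 (1, (1 + e / 2) *\<^sub>R x))" by (simp add: F_def)
      moreover from this have "0 < fst (A1 (1, (1 + e / 2) *\<^sub>R x))" using norm_ge_zero order_le_less_trans by blast
      ultimately have "(1 + e / 2) *\<^sub>R x \<in> cball 0 1" by (intro onto) auto
      then show False using x e(1) by simp
    qed
    then have "norm (snd (A1 (1, x))) = fst (A1 (1, x))" using Tb[OF xb] by simp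
    then have "(norm (snd (A1 (1, x))))\<^sup>2 = (fst (A1 (1, x)))\<^sup>2" by simp
    then show ?thesis by (simp add: minkowski_self)
  qed
  define \<alpha> where "\<alpha> = minkowski (A1 (1, 0)) (A1 (1, 0))"
  have conf: "minkowski (A1 u) (A1 w) = \<alpha> * minkowski u w" for u w
    unfolding \<alpha>_def by (rule vanishing_on_light_cone[where b="\<lambda>u w. minkowski (A1 u) (A1 w)"])
      (simp_all add: linear_add[OF lin] linear_scale[OF lin] minkowski_add minkowski_scale minkowski_commute cone)
  have "0 \<le> \<alpha>"
  proof -
    have "(norm (snd (A1 (1, 0))))\<^sup>2 \<le> (fst (A1 (1, 0)))\<^sup>2" using Tb[of 0] by (intro power_mono) auto
    then show ?thesis by (simp add: \<alpha>_def minkowski_self)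
  qed
  moreover have "\<alpha> \<noteq> 0"
  proof
    assume "\<alpha> = 0"
    obtain u where u: "A1 u = (1, 0)" using bij_is_surj[OF bij] by (metis surjD)
    have "minkowski (A1 u) (A1 u) = 0" using conf \<open>\<alpha> = 0\<close> by simp
    then show False unfolding u by (simp add: minkowski_def)
  qed
  ultimately have \<alpha>: "0 < \<alpha>" by simp
  define k where "k = 1 / sqrt \<alpha>"
  have k: "0 < k" "k * k * \<alpha> = 1" using \<alpha> by (simp_all add: k_def)
  define A where "A u = k *\<^sub>R A1 u" for u
  have Al: "linear A"
    unfolding A_def by (rule linearI) (simp_all add: linear_add[OF lin] linear_scale[OF lin] scaleR_add_right)
  have bijk: "bij (\<lambda>u::real \<times> 'a. k *\<^sub>R u)"
    by (rule o_bij[where g = "\<lambda>u::real \<times> 'a. (1 / k) *\<^sub>R u"]) (use k in \<open>simp_all add: fun_eq_iff\<close>)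
  have Ab: "bij A" using bij_comp[OF bij bijk] by (simp add: A_def[abs_def] o_def)
  have \<psi>A: "\<psi> = proj_map A" unfolding A_def[abs_def] \<psi>1 using lin k by (subst proj_map_scale) auto
  have iso: "minkowski (A u) (A w) = minkowski u w" for u w
    using k(2) by (simp add: A_def minkowski_scale conf mult.assoc[symmetric])
  obtain P where P: "A P = (1, 0)" using bij_is_surj[OF Ab] by (metis surjD)
  have fstA: "fst (A u) = minkowski u P" for u
    using iso[of u P] unfolding P by (simp add: minkowski_def)
  have PP: "(fst P)\<^sup>2 - (norm (snd P))\<^sup>2 = 1"
    using iso[of P P] unfolding P minkowski_self by simp
  have "0 < fst (A (1, 0))" using pos[of 0] k by (simp add: A_def)
  then have c: "0 < fst P" unfolding fstA by (simp add: minkowski_def)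
  define p where "p = (1 / fst P) *\<^sub>R snd P"
  have np: "1 - (norm p)\<^sup>2 = (1 / fst P)\<^sup>2"
  proof -
    have "(norm p)\<^sup>2 = (norm (snd P))\<^sup>2 / (fst P)\<^sup>2" by (simp add: p_def power_mult_distrib power_divide)
    moreover have "(norm (snd P))\<^sup>2 = (fst P)\<^sup>2 - 1" using PP by simp
    ultimately show ?thesis using c by (simp add: diff_divide_distrib power_divide)
  qed
  have "0 < (1 / fst P)\<^sup>2" using c by simp
  then have "(norm p)\<^sup>2 < 1" unfolding np[symmetric] by simp
  then have p1: "norm p < 1" by (simp add: abs_square_less_1)
  have "(1, p) = (1 / fst P) *\<^sub>R P" using c by (simp add: p_def prod_eq_iff)
  then have "A (1, p) = (1 / fst P) *\<^sub>R A P" by (simp only: linear_scale[OF Al])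
  also have "\<dots> = (1 / fst P, 0)" unfolding P by simp
  also have "1 / fst P = sqrt (1 - (norm p)\<^sup>2)" unfolding np using c by simp
  finally have "lorentz_to_origin A p" using Al Ab iso p1 by (simp add: lorentz_to_origin_def)
  then show ?thesis using \<psi>A by blast
qed

lemma compact_subset_ball_radius:
  fixes K :: "'a::euclidean_space set"
  assumes "compact K" "K \<subseteq> ball 0 1"
  obtains r where "0 < r" "r < 1" "K \<subseteq> cball 0 r"
proof (cases "K = {}")
  case True
  then show thesis using that[of "1 / 2"] by simp
next
  case False
  obtain x where x: "x \<in> K" "\<And>y. y \<in> K \<Longrightarrow> norm y \<le> norm x"
    using continuous_attains_sup[OF assms(1) False continuous_on_norm_id] by auto
  show thesis
  proof (rule that[of "max (norm x) (1 / 2)"])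
    show "max (norm x) (1 / 2) < 1" using x(1) assms(2) by auto
    show "K \<subseteq> cball 0 (max (norm x) (1 / 2))" using x(2) by (auto simp: le_max_iff_disj)
  qed auto
qed

theorem corollary1p6:
  fixes K :: "(real ^ 'n) set"
  assumes "convex_body K"
    and "CARD('n) = 1 \<Longrightarrow> K \<subseteq> ball 0 1"
  shows "(K \<subseteq> cball 0 (sqrt (3 / (real CARD('n) + 2))) \<longrightarrow>
           (\<exists>\<phi>. ball_fixing_centering K \<phi> \<and>
              (\<forall>\<psi>. ball_fixing_centering K \<psi> \<longleftrightarrow>
                 (\<exists>Q. orthogonal_transformation Q \<and> \<psi> = proj_extension Q \<circ> \<phi>)))) \<and>
         (K \<subseteq> cball 0 (sqrt (2 / (real CARD('n) + 1))) \<longrightarrow>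
           (\<exists>!y. santalo_point (cball 0 1) K y))"
proof -
  have K: "compact K" "convex K" "interior K \<noteq> {}"
    using assms(1) by (auto simp: convex_body_def)
  have d1: "1 \<le> CARD('n)" by (simp add: Suc_leI)
  \<comment> \<open>For \<open>m = 2\<close> and \<open>m = 1\<close> this treats the two radii at once. In dimension one, both are \<open>1\<close>
    and the compact set \<open>K\<close> in the open ball leaves room for a strict inequality.\<close>
  have radius: "\<exists>r. 0 < r \<and> r < 1 \<and> K \<subseteq> cball 0 r \<and> (real CARD('n) + m) * r\<^sup>2 \<le> m + 1 \<and>
       ((real CARD('n) + m) * r\<^sup>2 < m + 1 \<or> 2 \<le> CARD('n))"
    if m: "0 < m" and sub: "K \<subseteq> cball 0 (sqrt ((m + 1) / (real CARD('n) + m)))" for m :: real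
  proof (cases "CARD('n) = 1")
    case True
    obtain r where r: "0 < r" "r < 1" "K \<subseteq> cball 0 r"
      using compact_subset_ball_radius[OF K(1) assms(2)[OF True]] by blast
    have "r\<^sup>2 < 1" using r by (simp add: power_less_one_iff)
    then have "(1 + m) * r\<^sup>2 < (1 + m) * 1" using m by (intro mult_strict_left_mono) auto
    then have "(real CARD('n) + m) * r\<^sup>2 < m + 1" using True by simp
    then show ?thesis using r by (intro exI[of _ r]) auto
  next
    case False
    then have d2: "2 \<le> CARD('n)" using d1 by linarith
    define q where "q = (m + 1) / (real CARD('n) + m)"
    have q: "0 < q" "q < 1" using m d2 by (auto simp: q_def)
    have "(real CARD('n) + m) * (sqrt q)\<^sup>2 = m + 1" using q m by (simp add: q_def)
    then show ?thesis using q sub d2 by (intro exI[of _ "sqrt q"]) (auto simp: q_def)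
  qed
  show ?thesis
  proof (intro conjI impI)
    assume sub: "K \<subseteq> cball 0 (sqrt (3 / (real CARD('n) + 2)))"
    obtain r where r: "0 < r" "r < 1" "K \<subseteq> cball 0 r" "(real CARD('n) + 2) * r\<^sup>2 \<le> 3"
      "(real CARD('n) + 2) * r\<^sup>2 < 3 \<or> 2 \<le> CARD('n)"
      using radius[of 2] sub by auto
    have Kb: "K \<subseteq> ball 0 1" using r(2,3) by auto
    obtain p where p: "norm p < 1" "centroid (persp p ` K) = (1 / (1 - (norm p)\<^sup>2)) *\<^sub>R p"
      using projective_center_exists[OF K(1,3) Kb] by blast
    have uniq: "p' = p" if "norm p' < 1" "centroid (persp p' ` K) = (1 / (1 - (norm p')\<^sup>2)) *\<^sub>R p'" for p'
      using r(4,5) by (intro projective_center_unique[OF K r(3,1,2) _ _ that p]) (simp_all add: add.commute)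
    obtain A where A: "lorentz_to_origin A p" "proj_map A ` affine_point ` cball 0 1 = affine_point ` cball 0 1"
      using lorentz_boost_exists[OF p(1)] by blast
    have proj: "projective_transformation (proj_map B)" if "lorentz_to_origin B p'" for B and p' :: "real ^ 'n"
      using that unfolding projective_transformation_def lorentz_to_origin_def by blast
    have main: "ball_fixing_centering K \<psi> \<longleftrightarrow> (\<exists>Q. orthogonal_transformation Q \<and> \<psi> = proj_extension Q \<circ> proj_map A)" for \<psi>
    proof
      assume \<psi>: "ball_fixing_centering K \<psi>"
      then have "projective_transformation \<psi>" "\<psi> ` affine_point ` cball 0 1 = affine_point ` cball 0 1"
        unfolding ball_fixing_centering_def by (simp_all only:)
      from ball_fixing_lorentz[OF this] obtain B p' where B: "lorentz_to_origin B p'" "\<psi> = proj_map B"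
        by (elim exE conjE) (rule that)
      have "centroid (persp p' ` K) = (1 / (1 - (norm p')\<^sup>2)) *\<^sub>R p'"
        using \<psi> centering_iff[OF B(1) K(1,3) Kb] unfolding B(2) ball_fixing_centering_def by (simp only:)
      then have "p' = p" using uniq lorentz_to_originD(4)[OF B(1)] by blast
      then show "\<exists>Q. orthogonal_transformation Q \<and> \<psi> = proj_extension Q \<circ> proj_map A"
        using lorentz_to_origin_unique[OF A(1)] B by (simp only:)
    next
      assume "\<exists>Q. orthogonal_transformation Q \<and> \<psi> = proj_extension Q \<circ> proj_map A"
      then obtain Q where Q: "orthogonal_transformation Q" "\<psi> = proj_extension Q \<circ> proj_map A" by blast
      note rot = lorentz_to_origin_rotation[OF A(1) Q(1)]
      have \<psi>: "\<psi> = proj_map (map_prod id Q \<circ> A)" using Q(2) rot(2) by simp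
      have "\<psi> ` affine_point ` cball 0 1 = proj_extension Q ` (proj_map A ` affine_point ` cball 0 1)"
        unfolding Q(2) by (simp only: image_comp comp_assoc)
      also have "\<dots> = affine_point ` cball 0 1" unfolding A(2) by (rule rot(3))
      finally have "\<psi> ` affine_point ` cball 0 1 = affine_point ` cball 0 1" .
      moreover have "centroid (affine_point -` \<psi> ` affine_point ` K) = 0"
        unfolding \<psi> centering_iff[OF rot(1) K(1,3) Kb] by (rule p(2))
      ultimately show "ball_fixing_centering K \<psi>"
        using proj[OF rot(1)] unfolding ball_fixing_centering_def \<psi> by (simp only: simp_thms)
    qed
    have "ball_fixing_centering K (proj_map A)"
      unfolding ball_fixing_centering_def using proj[OF A(1)] A(2) centering_iff[OF A(1) K(1,3) Kb] p(2) by (simp only: simp_thms)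
    then show "\<exists>\<phi>. ball_fixing_centering K \<phi> \<and> (\<forall>\<psi>. ball_fixing_centering K \<psi> \<longleftrightarrow>
         (\<exists>Q. orthogonal_transformation Q \<and> \<psi> = proj_extension Q \<circ> \<phi>))"
      using main by blast
  next
    assume sub: "K \<subseteq> cball 0 (sqrt (2 / (real CARD('n) + 1)))"
    obtain r where r: "0 < r" "r < 1" "K \<subseteq> cball 0 r" "(real CARD('n) + 1) * r\<^sup>2 \<le> 2"
      "(real CARD('n) + 1) * r\<^sup>2 < 2 \<or> 2 \<le> CARD('n)"
      using radius[of 1] sub by auto
    have K1: "K \<subseteq> cball 0 1" using r(2,3) by auto
    obtain y where y: "y \<in> interior K" "centroid (dual_at K y) = (1 / (1 - (norm y)\<^sup>2)) *\<^sub>R y"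
      using dual_center_exists[OF K r(3,2)] by blast
    have "w = y" if "w \<in> interior K" "centroid (dual_at K w) = (1 / (1 - (norm w)\<^sup>2)) *\<^sub>R w" for w
      using r(4,5) by (intro dual_center_unique[OF K(1,2) r(3,1,2) _ _ that y]) (simp_all add: add.commute)
    then show "\<exists>!y. santalo_point (cball 0 1) K y"
      unfolding santalo_point_unit_ball_iff[OF K1] using y by blast
  qed
qed

end
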